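(* Let $M,\omega>0$ be constants such that $\|S(t)\|_{\mathcal L(\mathcal H)}\le Me^{-\omega t}$ for all $t\ge0$, and assume that there exist two constants $\omega'\in[0,\omega)$ and $\gamma\in\mathbb R$ such that $$b^2Me^{\omega\tau}\int_0^t|k(s+\tau)|\,ds\le\gamma+\omega' t\qquad\text{for all }t\ge0.$$ Consider the system $$\begin{aligned} &u_{tt}(t)+(1-\tilde\mu)Au(t)+\int_0^{+\infty}\mu(s)A\eta^t(s)\,ds+k(t)BB^*u_t(t-\tau)=\nabla\psi(u(t)),\quad t\in(0,+\infty),\\ &\eta^t_t(s)=-\eta^t_s(s)+u_t(t),\quad t,s\in(0,+\infty),\\ &u(0)=u_0(0),\quad u_t(0)=u_1,\quad B^*u_t(t)=g(t),\ t\in(-\tau,0),\\ &\eta^0(s)=\eta_0(s)=u_0(0)-u_0(-s),\quad s\in(0,+\infty). \end{aligned}$$ Then there exists $\delta>0$ such that if $$(1-\tilde\mu)\|A^{1/2}u_0(0)\|_H^2+\|u_1\|_H^2+\int_0^{+\infty}\mu(s)\|A^{1/2}\eta_0(s)\|_H^2\,ds+\int_0^\tau|k(s)|\,\|Bg(s-\tau)\|_H^2\,ds<\delta,$$ then the solution $u$ is globally defined and it satisfies $$E(t)\le Ce^{-\beta t},\qquad t\ge 0,$$ where $C$ is a constant depending only on the initial data and $\beta>0$.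
   Context: Setting. $H$ is a Hilbert space and $A$ is a positive self-adjoint operator in $H$ with dense domain $D(A)$ and compact inverse. $\tau>0$; $B$ is a bounded linear operator of $H$ into itself with adjoint $B^*$, and $b:=\|B\|_{\mathcal L(H)}=\|B^*\|_{\mathcal L(H)}$. The function $k:[0,+\infty)\to\mathbb R$ is in $L^1_{loc}([0,+\infty))$ and there is a constant $C^*$ with $\int_{\max(0,t-\tau)}^t|k(s)|\,ds<C^*$ for all $t>0$. The memory kernel $\mu:[0,+\infty)\to[0,+\infty)$ satisfies: $\mu\in C^1(\mathbb R^+)\cap L^1(\mathbb R^+)$; $\mu(0)=\mu_0>0$; $\int_0^{+\infty}\mu(t)\,dt=\tilde\mu<1$; $\mu'(t)\le-\delta_0\mu(t)$ for some $\delta_0>0$. The functional $\psi:D(A^{1/2})\to\mathbb R$ has a Gâteaux derivative $D\psi(u)$ at every $u\in D(A^{1/2})$ and satisfies: - for every $u\in D(A^{1/2})$ there is $c(u)>0$ with $|D\psi(u)(v)|\le c(u)\|v\|_H$ for all $v\in D(A^{1/2})$; $\nabla\psi(u)\in H$ denotes the unique vector representing (the extension to $H$ of) $D\psi(u)$, i.e. $\langle\nabla\psi(u),v\rangle_H=D\psi(u)(v)$; - for all $r>0$ there is a constant $L(r)>0$ with $\|\nabla\psi(u)-\nabla\psi(v)\|_H\le L(r)\|A^{1/2}(u-v)\|_H$ whenever $\|A^{1/2}u\|_H\le r$ and $\|A^{1/2}v\|_H\le r$; - $\psi(0)=0$, $\nabla\psi(0)=0$, and there is a strictly increasing continuous function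 $h$ with $\|\nabla\psi(u)\|_H\le h(\|A^{1/2}u\|_H)\|A^{1/2}u\|_H$ for all $u\in D(A^{1/2})$. $L^2_\mu((0,+\infty);D(A^{1/2}))$ is the Hilbert space of $D(A^{1/2})$-valued functions on $(0,+\infty)$ with scalar product $\int_0^\infty\mu(s)\langle A^{1/2}\varphi(s),A^{1/2}\phi(s)\rangle_H\,ds$, and $$\mathcal H=D(A^{1/2})\times H\times L^2_\mu((0,+\infty);D(A^{1/2})),$$ $$\langle(u,v,w),(\tilde u,\tilde v,\tilde w)\rangle_{\mathcal H}=(1-\tilde\mu)\langle A^{1/2}u,A^{1/2}\tilde u\rangle_H+\langle v,\tilde v\rangle_H+\int_0^\infty\mu(s)\langle A^{1/2}w,A^{1/2}\tilde w\rangle_H\,ds.$$ The operator $\mathcal A$ in $\mathcal H$ is $$\mathcal A(u,v,w)=\Big(v,\ -(1-\tilde\mu)Au-\int_0^{+\infty}\mu(s)Aw(s)\,ds,\ -w_s+v\Big),$$ where the second component is understood as $-A\big((1-\tilde\mu)u+\int_0^{+\infty}\mu(s)w(s)\,ds\big)$, with domain the set of $(u,v,w)\in D(A^{1/2})\times D(A^{1/2})\times L^2_\mu((0,+\infty);D(A^{1/2}))$ such that $(1-\tilde\mu)u+\int_0^{+\infty}\mu(s)w(s)\,ds\in D(A)$, $w_s\in L^2_\mu((0,+\infty);D(A^{1/2}))$ and $w(0)=0$. It is known that $\mathcal A$ generates an exponentially stable $C_0$-semigroup $\{S(t)\}_{t\ge0}$ on $\mathcal H$, so constants $M,\omega>0$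 as in the claim exist. The bounded operator $\mathcal B:\mathcal H\to\mathcal H$ is $\mathcal B(u,v,w)=(0,BB^*v,0)$, and $F(u,v,w)=(0,\nabla\psi(u),0)$. With $\eta^t(s)=u(t)-u(t-s)$, $U=(u,u_t,\eta^t)$, $U_0=(u_0(0),u_1,\eta_0)\in\mathcal H$ and $\tilde g(t)=(0,Bg(t-\tau),0)\in C([0,\tau];\mathcal H)$, the system is written abstractly as $U'(t)=\mathcal AU(t)-k(t)\mathcal BU(t-\tau)+F(U(t))$, $\mathcal BU(t-\tau)=\tilde g(t)$ for $t\in[0,\tau]$, $U(0)=U_0$. Solutions are mild solutions: $U$ is continuous with values in $\mathcal H$ and $U(t)=S(t)U_0+\int_0^tS(t-s)\big[-k(s)\mathcal BU(s-\tau)+F(U(s))\big]ds$, where $\mathcal BU(s-\tau)$ is replaced by $\tilde g(s)$ for $s\in[0,\tau]$. The energy is $$E(t)=\frac12\|u_t(t)\|_H^2+\frac{1-\tilde\mu}2\|A^{1/2}u(t)\|_H^2-\psi(u(t))+\frac12\int_{t-\tau}^t|k(s+\tau)|\,\|B^*u_t(s)\|_H^2\,ds+\frac12\int_0^{+\infty}\mu(s)\|A^{1/2}\eta^t(s)\|_H^2\,ds,$$ where $B^*u_t(s)=g(s)$ for $s\in(-\tau,0)$.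
   Formalization: The strictly increasing continuous function h is additionally required to satisfy h(0)=0, since otherwise a source with a large linear part gives blow-up for small data; the delay term |k(s+τ)|·‖g(s)‖² of the initial energy is required to be integrable on (-τ,0). *)

theory Defs
  imports "HOL-Analysis.Analysis"
begin

section \<open>Unbounded operators\<close>

text \<open>
  An unbounded operator is a pair of a domain and a total function of which only the values on the
  domain matter.
\<close>

definition linear_operator_on :: "'h::real_vector set \<Rightarrow> ('h \<Rightarrow> 'h) \<Rightarrow> bool" where
  "linear_operator_on D A \<longleftrightarrow>
     subspace D \<and>
     (\<forall>x\<in>D. \<forall>y\<in>D. A (x + y) = A x + A y) \<and>
     (\<forall>c. \<forall>x\<in>D. A (c *\<^sub>R x) = c *\<^sub>R A x)"

text \<open>
  The last clause says that the graph of the adjoint, i.e. the set of all \<open>(y, z)\<close> with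
  \<open>\<langle>A x, y\<rangle> = \<langle>x, z\<rangle>\<close> for every \<open>x\<close> in the domain, is the graph of \<open>A\<close> itself.
\<close>

definition self_adjoint_operator :: "'h::real_inner set \<Rightarrow> ('h \<Rightarrow> 'h) \<Rightarrow> bool" where
  "self_adjoint_operator D A \<longleftrightarrow>
     linear_operator_on D A \<and> closure D = UNIV \<and>
     (\<forall>y z. (\<forall>x\<in>D. A x \<bullet> y = x \<bullet> z) \<longleftrightarrow> y \<in> D \<and> z = A y)"

definition positive_self_adjoint :: "'h::real_inner set \<Rightarrow> ('h \<Rightarrow> 'h) \<Rightarrow> bool" where
  "positive_self_adjoint D A \<longleftrightarrow> self_adjoint_operator D A \<and> (\<forall>x\<in>D. 0 \<le> A x \<bullet> x)"

definition compact_inverse :: "'h::real_normed_vector set \<Rightarrow> ('h \<Rightarrow> 'h) \<Rightarrow> bool" where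
  "compact_inverse D A \<longleftrightarrow>
     bij_betw A D UNIV \<and> (\<forall>X. bounded X \<longrightarrow> compact (closure (inv_into D A ` X)))"

text \<open>
  \<open>(V, R)\<close> is the positive square root of \<open>(D, A)\<close>, so that \<open>V = D(A^{1/2})\<close> and
  \<open>R = A^{1/2}\<close> on \<open>V\<close>.
\<close>

definition square_root_operator ::
    "'h::real_inner set \<Rightarrow> ('h \<Rightarrow> 'h) \<Rightarrow> 'h set \<Rightarrow> ('h \<Rightarrow> 'h) \<Rightarrow> bool" where
  "square_root_operator D A V R \<longleftrightarrow>
     positive_self_adjoint V R \<and> D = {x \<in> V. R x \<in> V} \<and> (\<forall>x\<in>D. A x = R (R x))"

section \<open>Memory kernel and delay coefficient\<close>

definition mu_tilde :: "(real \<Rightarrow> real) \<Rightarrow> real" where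
  "mu_tilde \<mu> = (LINT s:{0..}|lborel. \<mu> s)"

text \<open>
  The kernel is \<open>C^1\<close> on the open half-line and continuous up to \<open>0\<close>; a kernel that is \<open>C^1\<close> on
  the closed half-line is a special case.
\<close>

definition memory_kernel :: "(real \<Rightarrow> real) \<Rightarrow> bool" where
  "memory_kernel \<mu> \<longleftrightarrow>
     (\<forall>s\<ge>0. 0 \<le> \<mu> s) \<and> 0 < \<mu> 0 \<and> continuous_on {0..} \<mu> \<and>
     (\<exists>\<mu>'. continuous_on {0<..} \<mu>' \<and>
           (\<forall>s>0. (\<mu> has_real_derivative \<mu>' s) (at s)) \<and>
           (\<exists>\<delta>\<^sub>0>0. \<forall>s>0. \<mu>' s \<le> - \<delta>\<^sub>0 * \<mu> s)) \<and>
     set_integrable lborel {0..} \<mu> \<and> mu_tilde \<mu> < 1"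

definition delay_coefficient :: "real \<Rightarrow> (real \<Rightarrow> real) \<Rightarrow> bool" where
  "delay_coefficient \<tau> k \<longleftrightarrow>
     (\<forall>t\<ge>0. set_integrable lborel {0..t} k) \<and>
     (\<exists>Cstar. \<forall>t>0. (LINT s:{max 0 (t - \<tau>)..t}|lborel. \<bar>k s\<bar>) < Cstar)"

section \<open>Source term\<close>

definition gateaux_derivative_on ::
    "'h::real_vector set \<Rightarrow> ('h \<Rightarrow> real) \<Rightarrow> 'h \<Rightarrow> ('h \<Rightarrow> real) \<Rightarrow> bool" where
  "gateaux_derivative_on V \<psi> u d \<longleftrightarrow>
     (\<forall>v\<in>V. \<forall>w\<in>V. d (v + w) = d v + d w) \<and> (\<forall>c. \<forall>v\<in>V. d (c *\<^sub>R v) = c * d v) \<and>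
     (\<forall>v\<in>V. ((\<lambda>\<epsilon>. (\<psi> (u + \<epsilon> *\<^sub>R v) - \<psi> u) / \<epsilon>) \<longlongrightarrow> d v) (at 0))"

text \<open>
  \<open>G u\<close> is the gradient \<open>\<nabla>\<psi>(u)\<close>, an element of the whole space \<open>H\<close>; it is determined by the
  representation clause because \<open>V\<close> is dense. The modulus \<open>h\<close> vanishes at \<open>0\<close>: it makes the
  source superlinear near \<open>0\<close>. Without this the source could contain a large linear part, which
  destroys both stability and global existence for small data.
\<close>

definition admissible_source ::
    "'h::real_inner set \<Rightarrow> ('h \<Rightarrow> 'h) \<Rightarrow> ('h \<Rightarrow> real) \<Rightarrow> ('h \<Rightarrow> 'h \<Rightarrow> real) \<Rightarrow> ('h \<Rightarrow> 'h) \<Rightarrow> bool" where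
  "admissible_source V R \<psi> D\<psi> G \<longleftrightarrow>
     (\<forall>u\<in>V. gateaux_derivative_on V \<psi> u (D\<psi> u)) \<and>
     (\<forall>u\<in>V. \<exists>c>0. \<forall>v\<in>V. \<bar>D\<psi> u v\<bar> \<le> c * norm v) \<and>
     (\<forall>u\<in>V. \<forall>v\<in>V. G u \<bullet> v = D\<psi> u v) \<and>
     (\<forall>r>0. \<exists>L>0. \<forall>u\<in>V. \<forall>v\<in>V. norm (R u) \<le> r \<longrightarrow> norm (R v) \<le> r \<longrightarrow>
        norm (G u - G v) \<le> L * norm (R (u - v))) \<and>
     \<psi> 0 = 0 \<and> G 0 = 0 \<and>
     (\<exists>h::real \<Rightarrow> real. strict_mono_on {0..} h \<and> continuous_on {0..} h \<and> h 0 = 0 \<and>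
        (\<forall>u\<in>V. norm (G u) \<le> h (norm (R u)) * norm (R u)))"

section \<open>Phase space\<close>

text \<open>Representatives of the elements of \<open>L^2_\<mu>((0,\<infinity>); V)\<close>.\<close>

definition L2mu ::
    "'h::real_inner set \<Rightarrow> ('h \<Rightarrow> 'h) \<Rightarrow> (real \<Rightarrow> real) \<Rightarrow> (real \<Rightarrow> 'h) set" where
  "L2mu V R \<mu> =
     {w. (\<forall>s>0. w s \<in> V) \<and> set_borel_measurable lborel {0<..} (\<lambda>s. R (w s)) \<and>
         set_integrable lborel {0<..} (\<lambda>s. \<mu> s * (norm (R (w s)))\<^sup>2)}"

definition phase_carrier ::
    "'h::real_inner set \<Rightarrow> ('h \<Rightarrow> 'h) \<Rightarrow> (real \<Rightarrow> real) \<Rightarrow> ('h \<times> 'h \<times> (real \<Rightarrow> 'h)) set" where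
  "phase_carrier V R \<mu> = {(u, v, w). u \<in> V \<and> w \<in> L2mu V R \<mu>}"

fun phase_inner ::
    "('h::real_inner \<Rightarrow> 'h) \<Rightarrow> (real \<Rightarrow> real) \<Rightarrow>
     'h \<times> 'h \<times> (real \<Rightarrow> 'h) \<Rightarrow> 'h \<times> 'h \<times> (real \<Rightarrow> 'h) \<Rightarrow> real" where
  "phase_inner R \<mu> (u, v, w) (u', v', w') =
     (1 - mu_tilde \<mu>) * (R u \<bullet> R u') + v \<bullet> v' +
     (LINT s:{0<..}|lborel. \<mu> s * (R (w s) \<bullet> R (w' s)))"

text \<open>
  The phase space \<open>\<H> = V \<times> H \<times> L^2_\<mu>((0,\<infinity>); V)\<close> identifies third components that agree almost
  everywhere with respect to the weight, so it is not a set of triples. It is modelled by a Hilbert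
  space \<open>'x\<close> with the class map \<open>J\<close> from triples of representatives onto it: linear, surjective and
  with the prescribed inner product, so that two triples have the same image exactly when they
  represent the same element of \<open>\<H>\<close>.

  The sort \<open>second_countable_topology\<close>, which the Bochner integral of the library needs, is no
  restriction: \<open>H\<close> is the closure of the range of the compact operator \<open>A^{-1}\<close>, hence separable,
  and then so is \<open>\<H>\<close>.
\<close>

definition phase_space ::
    "'h::real_inner set \<Rightarrow> ('h \<Rightarrow> 'h) \<Rightarrow> (real \<Rightarrow> real) \<Rightarrow>
     ('h \<times> 'h \<times> (real \<Rightarrow> 'h) \<Rightarrow> 'x::{real_inner, banach, second_countable_topology}) \<Rightarrow> bool" where
  "phase_space V R \<mu> J \<longleftrightarrow>
     J ` phase_carrier V R \<mu> = UNIV \<and>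
     (\<forall>u v w u' v' w'. (u, v, w) \<in> phase_carrier V R \<mu> \<longrightarrow> (u', v', w') \<in> phase_carrier V R \<mu> \<longrightarrow>
        J (u + u', v + v', \<lambda>s. w s + w' s) = J (u, v, w) + J (u', v', w')) \<and>
     (\<forall>c u v w. (u, v, w) \<in> phase_carrier V R \<mu> \<longrightarrow>
        J (c *\<^sub>R u, c *\<^sub>R v, \<lambda>s. c *\<^sub>R w s) = c *\<^sub>R J (u, v, w)) \<and>
     (\<forall>x\<in>phase_carrier V R \<mu>. \<forall>y\<in>phase_carrier V R \<mu>. J x \<bullet> J y = phase_inner R \<mu> x y)"

section \<open>Semigroup and generator\<close>

definition C0_semigroup :: "(real \<Rightarrow> 'x \<Rightarrow> 'x::real_normed_vector) \<Rightarrow> bool" where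
  "C0_semigroup S \<longleftrightarrow>
     (\<forall>t\<ge>0. bounded_linear (S t)) \<and> S 0 = id \<and>
     (\<forall>s\<ge>0. \<forall>t\<ge>0. S (s + t) = S s \<circ> S t) \<and>
     (\<forall>x. ((\<lambda>t. S t x) \<longlongrightarrow> x) (at_right 0))"

definition generator_graph :: "(real \<Rightarrow> 'x \<Rightarrow> 'x::real_normed_vector) \<Rightarrow> ('x \<times> 'x) set" where
  "generator_graph S = {(x, y). ((\<lambda>t. (S t x - x) /\<^sub>R t) \<longlongrightarrow> y) (at_right 0)}"

text \<open>
  \<open>w'\<close> is the derivative \<open>w\<^sub>s\<close> and \<open>w\<close> the absolutely continuous representative, for which \<open>w 0\<close>
  is the trace at \<open>0\<close>. For \<open>w'\<close> in \<open>L^2_\<mu>\<close> the integral exists whenever \<open>\<mu> s > 0\<close>, since \<open>\<mu>\<close>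
  is decreasing; where \<open>\<mu>\<close> vanishes the values of \<open>w\<close> are irrelevant.
\<close>

definition s_derivative ::
    "(real \<Rightarrow> real) \<Rightarrow> (real \<Rightarrow> 'h::{banach, second_countable_topology}) \<Rightarrow> (real \<Rightarrow> 'h) \<Rightarrow> bool" where
  "s_derivative \<mu> w w' \<longleftrightarrow>
     (\<forall>s>0. \<mu> s > 0 \<longrightarrow> w s = w 0 + (LINT r:{0..s}|lborel. w' r))"

text \<open>The graph of the operator \<open>\<A>\<close>, as a relation on the phase space.\<close>

definition evolution_graph ::
    "'h::{real_inner, banach, second_countable_topology} set \<Rightarrow> ('h \<Rightarrow> 'h) \<Rightarrow>
     'h set \<Rightarrow> ('h \<Rightarrow> 'h) \<Rightarrow> (real \<Rightarrow> real) \<Rightarrow>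
     ('h \<times> 'h \<times> (real \<Rightarrow> 'h) \<Rightarrow> 'x) \<Rightarrow> ('x \<times> 'x) set" where
  "evolution_graph D A V R \<mu> J =
     {(J (u, v, w),
       J (v,
          - A ((1 - mu_tilde \<mu>) *\<^sub>R u + (LINT s:{0<..}|lborel. \<mu> s *\<^sub>R w s)),
          \<lambda>s. - w' s + v)) | u v w w'.
        u \<in> V \<and> v \<in> V \<and> w \<in> L2mu V R \<mu> \<and>
        (1 - mu_tilde \<mu>) *\<^sub>R u + (LINT s:{0<..}|lborel. \<mu> s *\<^sub>R w s) \<in> D \<and>
        w' \<in> L2mu V R \<mu> \<and> s_derivative \<mu> w w' \<and> w 0 = 0}"

section \<open>Abstract evolution equation\<close>

fun delay_op :: "('h::real_inner \<Rightarrow> 'h) \<Rightarrow> 'h \<times> 'h \<times> (real \<Rightarrow> 'h) \<Rightarrow> 'h \<times> 'h \<times> (real \<Rightarrow> 'h)" where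
  "delay_op B (u, v, w) = (0, B (adjoint B v), \<lambda>_. 0)"

fun source_op :: "('h::real_vector \<Rightarrow> 'h) \<Rightarrow> 'h \<times> 'h \<times> (real \<Rightarrow> 'h) \<Rightarrow> 'h \<times> 'h \<times> (real \<Rightarrow> 'h)" where
  "source_op G (u, v, w) = (0, G u, \<lambda>_. 0)"

definition g_tilde ::
    "('h::real_vector \<Rightarrow> 'h) \<Rightarrow> real \<Rightarrow> (real \<Rightarrow> 'h) \<Rightarrow> real \<Rightarrow> 'h \<times> 'h \<times> (real \<Rightarrow> 'h)" where
  "g_tilde B \<tau> g t = (0, B (g (t - \<tau>)), \<lambda>_. 0)"

text \<open>
  \<open>U(t) = (u(t), u\<^sub>t(t), \<eta>^t)\<close> with \<open>\<eta>^t(s) = u(t) - u(t - s)\<close>; here \<open>u\<close> is defined on the whole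
  line and includes its own past.
\<close>

definition state :: "(real \<Rightarrow> 'h::real_vector) \<Rightarrow> (real \<Rightarrow> 'h) \<Rightarrow> real \<Rightarrow> 'h \<times> 'h \<times> (real \<Rightarrow> 'h)" where
  "state u ut t = (u t, ut t, \<lambda>s. u t - u (t - s))"

definition initial_state :: "(real \<Rightarrow> 'h::real_vector) \<Rightarrow> 'h \<Rightarrow> 'h \<times> 'h \<times> (real \<Rightarrow> 'h)" where
  "initial_state u0 u1 = (u0 0, u1, \<lambda>s. u0 0 - u0 (- s))"

text \<open>
  Initial data: the history \<open>u0\<close> on \<open>(-\<infinity>, 0]\<close>, the velocity \<open>u1\<close> and the function \<open>g\<close> on
  \<open>[-\<tau>, 0]\<close>. Since only \<open>B g\<close> is assumed continuous, finiteness of the delay term of the initial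
  energy is required separately.
\<close>

definition admissible_data ::
    "'h::real_inner set \<Rightarrow> ('h \<Rightarrow> 'h) \<Rightarrow> (real \<Rightarrow> real) \<Rightarrow> ('h \<times> 'h \<times> (real \<Rightarrow> 'h) \<Rightarrow> 'x::real_inner) \<Rightarrow>
     ('h \<Rightarrow> 'h) \<Rightarrow> real \<Rightarrow> (real \<Rightarrow> real) \<Rightarrow> (real \<Rightarrow> 'h) \<Rightarrow> 'h \<Rightarrow> (real \<Rightarrow> 'h) \<Rightarrow> bool" where
  "admissible_data V R \<mu> J B \<tau> k u0 u1 g \<longleftrightarrow>
     initial_state u0 u1 \<in> phase_carrier V R \<mu> \<and>
     continuous_on {0..\<tau>} (\<lambda>t. J (g_tilde B \<tau> g t)) \<and>
     set_integrable lborel {- \<tau>..0} (\<lambda>s. \<bar>k (s + \<tau>)\<bar> * (norm (g s))\<^sup>2)"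

text \<open>
  Mild solutions on a time interval \<open>I\<close> that starts at \<open>0\<close>; \<open>ut\<close> is the velocity (the derivative
  of \<open>u\<close> with values in \<open>H\<close>).
\<close>

definition mild_solution ::
    "'h::real_inner set \<Rightarrow> ('h \<Rightarrow> 'h) \<Rightarrow> (real \<Rightarrow> real) \<Rightarrow>
     ('h \<times> 'h \<times> (real \<Rightarrow> 'h) \<Rightarrow> 'x::{real_inner, banach, second_countable_topology}) \<Rightarrow>
     (real \<Rightarrow> 'x \<Rightarrow> 'x) \<Rightarrow> ('h \<Rightarrow> 'h) \<Rightarrow> real \<Rightarrow> (real \<Rightarrow> real) \<Rightarrow> ('h \<Rightarrow> 'h) \<Rightarrow>
     (real \<Rightarrow> 'h) \<Rightarrow> 'h \<Rightarrow> (real \<Rightarrow> 'h) \<Rightarrow> real set \<Rightarrow> (real \<Rightarrow> 'h) \<Rightarrow> (real \<Rightarrow> 'h) \<Rightarrow> bool" where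
  "mild_solution V R \<mu> J S B \<tau> k G u0 u1 g I u ut \<longleftrightarrow>
     (\<forall>t\<le>0. u t = u0 t) \<and> ut 0 = u1 \<and>
     (\<forall>t\<in>I. (u has_vector_derivative ut t) (at t within I)) \<and>
     (\<forall>t\<in>I. state u ut t \<in> phase_carrier V R \<mu>) \<and>
     continuous_on I (\<lambda>t. J (state u ut t)) \<and>
     (\<forall>t\<in>I.
        let f = (\<lambda>s. S (t - s)
                   (- k s *\<^sub>R (if s \<le> \<tau> then J (g_tilde B \<tau> g s)
                                else J (delay_op B (state u ut (s - \<tau>))))
                    + J (source_op G (state u ut s))))
        in set_integrable lborel {0..t} f \<and>
           J (state u ut t) = S t (J (initial_state u0 u1)) + (LINT s:{0..t}|lborel. f s))"

definition energy ::
    "('h::real_inner \<Rightarrow> 'h) \<Rightarrow> (real \<Rightarrow> real) \<Rightarrow> ('h \<Rightarrow> 'h) \<Rightarrow> real \<Rightarrow> (real \<Rightarrow> real) \<Rightarrow>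
     ('h \<Rightarrow> real) \<Rightarrow> (real \<Rightarrow> 'h) \<Rightarrow> (real \<Rightarrow> 'h) \<Rightarrow> (real \<Rightarrow> 'h) \<Rightarrow> real \<Rightarrow> real" where
  "energy R \<mu> B \<tau> k \<psi> g u ut t =
     1/2 * (norm (ut t))\<^sup>2 + (1 - mu_tilde \<mu>) / 2 * (norm (R (u t)))\<^sup>2 - \<psi> (u t)
     + 1/2 * (LINT s:{t - \<tau>..t}|lborel.
                \<bar>k (s + \<tau>)\<bar> * (norm (if s < 0 then g s else adjoint B (ut s)))\<^sup>2)
     + 1/2 * (LINT s:{0<..}|lborel. \<mu> s * (norm (R (u t - u (t - s))))\<^sup>2)"

end

theory Submission
  imports Defs
begin

text \<open>
  The theorem is a perturbation result for the exponentially decaying semigroup \<open>S\<close>. In the phase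
  space the equation reads \<open>U' = \<A> U - k(t) \<B> U(t - \<tau>) + F(U)\<close>, and three smallness mechanisms keep
  the decay rate \<open>\<omega>\<close> of \<open>S\<close> positive: the delayed feedback costs at most \<open>\<omega>'\<close>, by the hypothesis on
  the primitive of \<open>k\<close>; the source costs an arbitrarily small amount, because it is superlinear at
  \<open>0\<close>; and small data keep the solution in a ball on which the source is that small.

  The solution is constructed globally from the start. The source is cut off by composing it with the
  radial retraction \<open>truncate r\<close> onto a small ball. The result is globally Lipschitz, so that a single contraction
      in an
  exponentially weighted space of bounded continuous functions gives a solution \<open>U\<close> on the whole
  half-line (\<open>delayed_evolution_exists\<close>); and it is bounded by \<open>e \<parallel>U\<parallel>\<close> with \<open>e\<close> small
  (\<open>source_small\<close>), while its Lipschitz constant may be large. Multiplying the Duhamel formula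
  by \<open>exp (\<omega> t)\<close> and shifting the delayed term by \<open>\<tau>\<close> leads to a Gronwall inequality with the merely
  integrable kernel \<open>b\<^sup>2 M exp (\<omega> \<tau>) |k (s + \<tau>)| + M e\<close>, whose primitive is bounded by
  \<open>\<gamma> + (\<omega>' + M e) t\<close>; hence \<open>\<parallel>U t\<parallel>\<close> is at most a multiple of the data times
  \<open>exp (- (\<omega> - \<omega>' - M e) t)\<close> (\<open>delayed_evolution_decay\<close>). For small data this bound stays below \<open>r\<close>, the
  cut-off is never active, and \<open>U\<close> solves the original equation. Uniqueness follows
  from the same estimate (\<open>delayed_duhamel_decay\<close>), applied to the difference of two solutions, and the
  energy is dominated by \<open>\<parallel>U t\<parallel>\<^sup>2\<close> and by the integral of \<open>|k| \<parallel>U\<parallel>\<^sup>2\<close> over one delay window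
  (\<open>energy_decay\<close>).

  It remains to see that the abstract \<open>U\<close> comes from a function \<open>u\<close>: that \<open>U t\<close> is the class of
  \<open>(u t, u' t, \<lambda>s. u t - u (t - s))\<close>. What is known about \<open>\<A>\<close> is only that it generates \<open>S\<close>. For every mild
  solution the pair \<open>(\<integral>\<^sub>0\<^sup>t U, U t - U 0 - \<integral>\<^sub>0\<^sup>t f)\<close> lies in the graph of the generator
  (\<open>mild_solution_integral_in_generator\<close>). Since the forcing has only a second component, the first
  component of this relation says \<open>u t = u 0 + \<integral>\<^sub>0\<^sup>t u'\<close>, and the third is a transport equation, integrated
  in time and in the memory variable \<open>s\<close>, for the memory component. The memory
  of the trajectory \<open>u\<close> satisfies the same equation, and the difference vanishes by the method of
  characteristics (\<open>transport_zero\<close>, \<open>history_primitive_trajectory\<close>, \<open>trajectory_state\<close>).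
\<close>

section \<open>Bochner integrals over subsets of the line\<close>

lemma set_integral_split:
  fixes f :: "real \<Rightarrow> 'a::{banach, second_countable_topology}"
  assumes f: "set_integrable lborel {a..c} f" and "a \<le> b" "b \<le> c"
  shows "(LBINT s:{a..c}. f s) = (LBINT s:{a..b}. f s) + (LBINT s:{b..c}. f s)"
proof -
  have eq: "{a..c} = {a..b} \<union> {b..c}" using assms by auto
  show ?thesis unfolding eq
  proof (rule set_integral_Un_AE)
    show "AE x in lborel. \<not> (x \<in> {a..b} \<and> x \<in> {b..c})"
      by (rule AE_mp[OF AE_lborel_singleton[of b]]) auto
    show "set_integrable lborel {a..b} f" "set_integrable lborel {b..c} f"
      using assms by (auto intro: set_integrable_subset[OF f])
  qed auto
qed

lemma set_integral_singleton_zero: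
  fixes f :: "real \<Rightarrow> 'a::{banach, second_countable_topology}"
  shows "(LBINT s:{a..a}. f s) = 0"
  unfolding set_lebesgue_integral_def
  by (rule integral_eq_zero_AE) (rule AE_mp[OF AE_lborel_singleton[of a]], auto)

lemma set_integral_nonneg:
  fixes f :: "real \<Rightarrow> real"
  assumes "\<And>s. s \<in> A \<Longrightarrow> 0 \<le> f s"
  shows "0 \<le> (LBINT s:A. f s)"
  unfolding set_lebesgue_integral_def
  by (rule Bochner_Integration.integral_nonneg) (use assms in \<open>auto simp: indicator_def\<close>)

lemma norm_set_integral_le:
  fixes f :: "real \<Rightarrow> 'a::{banach, second_countable_topology}"
  assumes f: "set_integrable lborel A f" and g: "set_integrable lborel A g"
    and le: "\<And>s. s \<in> A \<Longrightarrow> norm (f s) \<le> g s"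
  shows "norm (LBINT s:A. f s) \<le> (LBINT s:A. g s)"
  unfolding set_lebesgue_integral_def
  by (rule Bochner_Integration.integral_norm_bound_integral)
    (use assms in \<open>auto simp: set_integrable_def indicator_def\<close>)

lemma set_integral_bounded_linear:
  fixes f :: "real \<Rightarrow> 'a::{banach, second_countable_topology}"
    and T :: "'a \<Rightarrow> 'b::{banach, second_countable_topology}"
  assumes T: "bounded_linear T" and f: "set_integrable lborel A f"
  shows "set_integrable lborel A (\<lambda>s. T (f s))" "(LBINT s:A. T (f s)) = T (LBINT s:A. f s)"
proof -
  have eq: "(\<lambda>s. indicator A s *\<^sub>R T (f s)) = (\<lambda>s. T (indicator A s *\<^sub>R f s))"
    using T by (simp add: bounded_linear.linear linear_scale)
  show "set_integrable lborel A (\<lambda>s. T (f s))"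
    using f integrable_bounded_linear[OF T] unfolding set_integrable_def eq by blast
  show "(LBINT s:A. T (f s)) = T (LBINT s:A. f s)"
    using f integral_bounded_linear[OF T] unfolding set_integrable_def set_lebesgue_integral_def eq by blast
qed

lemma set_integral_shift:
  fixes f :: "real \<Rightarrow> 'a::{banach, second_countable_topology}"
  shows "(LBINT s:{a + h..b + h}. f s) = (LBINT s:{a..b}. f (s + h))"
  unfolding set_lebesgue_integral_def
  by (subst lborel_integral_real_affine[of 1 _ h]) (auto intro!: Bochner_Integration.integral_cong simp:
      indicator_def add.commute)

lemma set_integrable_shift:
  fixes f :: "real \<Rightarrow> 'a::{banach, second_countable_topology}"
  assumes "set_integrable lborel {a + h..b + h} f"
  shows "set_integrable lborel {a..b} (\<lambda>s. f (s + h))"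
proof -
  have "integrable lborel (\<lambda>s. indicator {a + h..b + h} (h + 1 * s) *\<^sub>R f (h + 1 * s))"
    using assms unfolding set_integrable_def by (intro lborel_integrable_real_affine) auto
  then show ?thesis unfolding set_integrable_def
    by (rule Bochner_Integration.integrable_cong[THEN iffD1, rotated -1]) (auto simp: indicator_def add.commute)
qed

lemma set_integral_reflect:
  fixes f :: "real \<Rightarrow> 'a::{banach, second_countable_topology}"
  shows "(LBINT s:{a..b}. f (c - s)) = (LBINT s:{c - b..c - a}. f s)"
  unfolding set_lebesgue_integral_def
  by (subst lborel_integral_real_affine[of "-1" _ c]) (auto intro!: Bochner_Integration.integral_cong simp:
      indicator_def)

lemma set_integrable_reflect:
  fixes f :: "real \<Rightarrow> 'a::{banach, second_countable_topology}"
  assumes "set_integrable lborel {c - b..c - a} f"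
  shows "set_integrable lborel {a..b} (\<lambda>s. f (c - s))"
proof -
  have "integrable lborel (\<lambda>s. indicator {c - b..c - a} (c + (-1) * s) *\<^sub>R f (c + (-1) * s))"
    using assms unfolding set_integrable_def by (intro lborel_integrable_real_affine) auto
  then show ?thesis unfolding set_integrable_def
    by (rule Bochner_Integration.integrable_cong[THEN iffD1, rotated -1]) (auto simp: indicator_def)
qed

lemma set_integrable_scaleR_bounded:
  fixes \<xi> :: "real \<Rightarrow> 'a::{banach, second_countable_topology}" and k :: "real \<Rightarrow> real"
  assumes k: "set_integrable lborel S k" and \<xi>: "set_borel_measurable lborel S \<xi>"
    and Q: "\<And>s. s \<in> S \<Longrightarrow> norm (\<xi> s) \<le> Q"
  shows "set_integrable lborel S (\<lambda>s. k s *\<^sub>R \<xi> s)"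
  unfolding set_integrable_def
proof (rule Bochner_Integration.integrable_bound)
  show "integrable lborel (\<lambda>s. Q * (indicator S s *\<^sub>R k s))"
    using k by (simp add: set_integrable_def)
  have "(\<lambda>s. (indicator S s *\<^sub>R k s) *\<^sub>R (indicator S s *\<^sub>R \<xi> s)) \<in> borel_measurable lborel"
    using k \<xi> unfolding set_integrable_def set_borel_measurable_def
    by (intro borel_measurable_scaleR[of "\<lambda>s. indicator S s *\<^sub>R k s" _ "\<lambda>s. indicator S s *\<^sub>R \<xi> s"])
      (blast dest: borel_measurable_integrable)+
  then show "(\<lambda>s. indicator S s *\<^sub>R k s *\<^sub>R \<xi> s) \<in> borel_measurable lborel"
    by (rule measurable_cong[THEN iffD1, rotated]) (auto simp: indicator_def)
  show "AE s in lborel. norm (indicator S s *\<^sub>R k s *\<^sub>R \<xi> s) \<le> norm (Q * (indicator S s *\<^sub>R k s))"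
  proof (rule AE_I2)
    fix s show "norm (indicator S s *\<^sub>R k s *\<^sub>R \<xi> s) \<le> norm (Q * (indicator S s *\<^sub>R k s))"
      using mult_right_mono[OF order_trans[OF Q abs_ge_self], of s "\<bar>k s\<bar>"]
      by (auto simp: indicator_def abs_mult mult.commute)
  qed
qed

lemma set_borel_measurable_continuous:
  fixes f :: "real \<Rightarrow> 'a::real_normed_vector"
  assumes "continuous_on {a..b} f"
  shows "set_borel_measurable lborel {a..b} f"
  unfolding set_borel_measurable_def
  using borel_measurable_continuous_on_indicator[OF _ assms] by simp

lemma set_integrable_scaleR_continuous:
  fixes \<xi> :: "real \<Rightarrow> 'a::{banach, second_countable_topology}" and k :: "real \<Rightarrow> real"
  assumes k: "set_integrable lborel {a..b} k" and \<xi>: "continuous_on {a..b} \<xi>"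
  shows "set_integrable lborel {a..b} (\<lambda>s. k s *\<^sub>R \<xi> s)"
proof -
  have "bounded (\<xi> ` {a..b})" using compact_continuous_image[OF \<xi>] compact_imp_bounded by blast
  then obtain Q where "\<And>s. s \<in> {a..b} \<Longrightarrow> norm (\<xi> s) \<le> Q" unfolding bounded_iff by fast
  then show ?thesis using set_integrable_scaleR_bounded[OF k set_borel_measurable_continuous[OF \<xi>]] by blast
qed

lemma set_borel_measurable_scaleR:
  fixes f :: "real \<Rightarrow> 'a::{banach, second_countable_topology}"
  assumes "set_borel_measurable lborel A f" shows "set_borel_measurable lborel A (\<lambda>s. c *\<^sub>R f s)"
proof -
  have "(\<lambda>s. c *\<^sub>R (indicator A s *\<^sub>R f s)) \<in> borel_measurable lborel"
    using assms unfolding set_borel_measurable_def by (rule borel_measurable_scaleR[OF borel_measurable_const])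
  then show ?thesis unfolding set_borel_measurable_def by (simp add: mult.commute)
qed

lemma set_borel_measurable_cong_on:
  fixes f g :: "real \<Rightarrow> 'a::{banach, second_countable_topology}"
  assumes "set_borel_measurable lborel A f" "\<And>s. s \<in> A \<Longrightarrow> f s = g s"
  shows "set_borel_measurable lborel A g"
proof -
  have "(\<lambda>s. indicator A s *\<^sub>R f s) = (\<lambda>s. indicator A s *\<^sub>R g s)"
    using assms(2) by (intro ext) (use assms(2) in \<open>force simp: indicator_def\<close>)
  then show ?thesis using assms(1) by (simp add: set_borel_measurable_def)
qed

text \<open>
  The integrand of every equation with delay has this form: prescribed data \<open>\<phi>\<close> up to time \<open>\<tau>\<close>, the
  solution at the delayed time afterwards.
\<close>

lemma set_integrable_delayed:
  fixes \<phi> y :: "real \<Rightarrow> 'a::{banach, second_countable_topology}" and P :: "real \<Rightarrow> real"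
  assumes P: "set_integrable lborel {0..t} P" and y: "continuous_on {0..t} y"
    and \<phi>: "continuous_on {0..\<tau>} \<phi>" and "0 < \<tau>" "0 \<le> t"
  shows "set_integrable lborel {0..t} (\<lambda>s. P s *\<^sub>R (if s \<le> \<tau> then \<phi> s else y (s - \<tau>)))"
proof -
  define \<xi> where "\<xi> s = (if s \<le> \<tau> then \<phi> (max 0 (min \<tau> s)) else y (max 0 (min t (s - \<tau>))))" for s
  have "bounded (\<phi> ` {0..\<tau>})" "bounded (y ` {0..t})"
    using compact_continuous_image[OF \<phi>] compact_continuous_image[OF y] compact_imp_bounded by blast+
  then obtain Q1 Q2 where Q: "\<And>s. s \<in> {0..\<tau>} \<Longrightarrow> norm (\<phi> s) \<le> Q1" "\<And>s. s \<in> {0..t} \<Longrightarrow> norm (y s) \<le> Q2"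
    unfolding bounded_iff by fast
  have "continuous_on UNIV (\<lambda>s. \<phi> (max 0 (min \<tau> s)))"
    by (rule continuous_on_compose2[OF \<phi>]) (use \<open>0 < \<tau>\<close> in \<open>auto intro!: continuous_intros\<close>)
  moreover have "continuous_on UNIV (\<lambda>s. y (max 0 (min t (s - \<tau>))))"
    by (rule continuous_on_compose2[OF y]) (use \<open>0 \<le> t\<close> in \<open>auto intro!: continuous_intros\<close>)
  ultimately have "\<xi> \<in> borel_measurable borel"
    unfolding \<xi>_def by (intro measurable_If borel_measurable_continuous_onI) auto
  then have "set_borel_measurable lborel {0..t} \<xi>"
    unfolding set_borel_measurable_def by (intro borel_measurable_scaleR) auto
  moreover have "norm (\<xi> s) \<le> max Q1 Q2" if "s \<in> {0..t}" for s
    using Q(1)[of "max 0 (min \<tau> s)"] Q(2)[of "max 0 (min t (s - \<tau>))"] \<open>0 < \<tau>\<close> \<open>0 \<le> t\<close>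
    by (auto simp: \<xi>_def intro: order_trans[OF _ max.cobounded1] order_trans[OF _ max.cobounded2])
  ultimately have "set_integrable lborel {0..t} (\<lambda>s. P s *\<^sub>R \<xi> s)"
    by (rule set_integrable_scaleR_bounded[OF P])
  then show ?thesis
    by (rule set_integrable_cong[THEN iffD1, rotated -1]) (use \<open>0 < \<tau>\<close> in \<open>auto simp: \<xi>_def\<close>)
qed

lemma continuous_on_set_integral:
  fixes f :: "real \<Rightarrow> real"
  assumes "set_integrable lborel {a..b} f"
  shows "continuous_on {a..b} (\<lambda>t. LBINT s:{a..t}. f s)"
proof -
  have "continuous_on {a..b} (\<lambda>t. integral {a..t} f)"
    by (rule indefinite_integral_continuous_1[OF set_borel_integral_eq_integral(1)[OF assms]])
  moreover have "(LBINT s:{a..t}. f s) = integral {a..t} f" if "t \<in> {a..b}" for t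
    using that by (intro set_borel_integral_eq_integral(2) set_integrable_subset[OF assms]) auto
  ultimately show ?thesis by (subst continuous_on_cong[OF refl])
qed

text \<open>
  Both integrals commute with the inner product by a fixed vector, which reduces the claim to real functions.
\<close>

lemma set_integral_eq_integral:
  fixes f :: "real \<Rightarrow> 'a::{real_inner, banach, second_countable_topology}"
  assumes f: "continuous_on {a..b} f"
  shows "(LBINT s:{a..b}. f s) = integral {a..b} f"
proof (rule vector_eq_rdot[THEN iffD1], rule allI)
  fix e
  have i: "set_integrable lborel {a..b} f" by (rule borel_integrable_atLeastAtMost'[OF f])
  have "(LBINT s:{a..b}. f s) \<bullet> e = (LBINT s:{a..b}. f s \<bullet> e)"
    by (rule set_integral_bounded_linear(2)[OF bounded_linear_inner_left i, symmetric])
  also have "\<dots> = integral {a..b} (\<lambda>s. f s \<bullet> e)"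
    by (rule set_borel_integral_eq_integral(2)[OF set_integral_bounded_linear(1)[OF bounded_linear_inner_left i]])
  also have "\<dots> = integral {a..b} f \<bullet> e"
    using integral_linear[OF integrable_continuous_interval[OF f] bounded_linear_inner_left[of e]]
        by (simp add: comp_def)
  finally show "(LBINT s:{a..b}. f s) \<bullet> e = integral {a..b} f \<bullet> e" .
qed

lemma primitive_has_vector_derivative:
  fixes f :: "real \<Rightarrow> 'a::{real_inner, banach, second_countable_topology}"
  assumes f: "continuous_on {0..} f" and "0 \<le> t"
  shows "((\<lambda>t. LBINT s:{0..t}. f s) has_vector_derivative f t) (at t within {0..})"
proof -
  have c: "continuous_on {0..r} f" for r by (rule continuous_on_subset[OF f]) auto
  have "((\<lambda>t. LBINT s:{0..t}. f s) has_vector_derivative f t) (at t within {0..t + 1})"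
    unfolding set_integral_eq_integral[OF c]
    by (rule integral_has_vector_derivative[OF c]) (use \<open>0 \<le> t\<close> in auto)
  moreover have "at t within {0..t + 1} = at t within {0..}"
    by (rule at_within_nhd[of t "{..<t + 1}"]) auto
  ultimately show ?thesis by simp
qed

text \<open>
  The half-lines \<open>{..c}\<close> form a generator of the Borel sets that is stable under intersection, so vanishing
  integrals over half-lines force vanishing integrals over all Borel sets.
\<close>

lemma AE_zero_if_primitive_zero:
  fixes g :: "real \<Rightarrow> 'a::{banach, second_countable_topology}"
  assumes g: "set_integrable lborel {0..b} g" and "0 \<le> b"
    and zero: "\<And>s. s \<in> {0..b} \<Longrightarrow> (LBINT r:{0..s}. g r) = 0"
  shows "AE s in lborel. s \<in> {0..b} \<longrightarrow> g s = 0"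
proof -
  define G where "G s = indicator {0..b} s *\<^sub>R g s" for s
  have G: "integrable lborel G" using g unfolding set_integrable_def G_def .
  have Gi: "set_integrable lborel A G" if "A \<in> sets borel" for A
    unfolding set_integrable_def using that G by (intro integrable_mult_indicator) auto
  have half: "(LBINT r:{..c}. G r) = 0" for c
  proof -
    have "(LBINT r:{..c}. G r) = (LBINT r:{0..min b c}. g r)"
      unfolding set_lebesgue_integral_def
      by (rule Bochner_Integration.integral_cong) (auto simp: G_def indicator_def)
    also have "\<dots> = 0"
      by (cases "0 \<le> c") (use zero[of "min b c"] \<open>0 \<le> b\<close> in \<open>auto simp: set_lebesgue_integral_def\<close>)
    finally show ?thesis .
  qed
  have all: "(LBINT r. G r) = 0"
  proof -
    have "(LBINT r. G r) = (LBINT r:{..b}. G r)"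
      unfolding set_lebesgue_integral_def
      by (rule Bochner_Integration.integral_cong) (auto simp: G_def indicator_def)
    then show ?thesis using half by simp
  qed
  have int0: "(LBINT r:A. G r) = 0" if "A \<in> sets borel" for A
  proof -
    have "Int_stable (range (atMost :: real \<Rightarrow> real set))" by (auto simp: Int_stable_def)
    moreover have "range (atMost :: real \<Rightarrow> real set) \<subseteq> Pow UNIV" by simp
    moreover have "A \<in> sigma_sets UNIV (range atMost)"
      using that by (simp add: borel_eq_atMost)
    ultimately show ?thesis
    proof (induction rule: sigma_sets_induct_disjoint)
      case (basic A) then show ?case using half by auto
    next
      case empty then show ?case by (simp add: set_lebesgue_integral_def)
    next
      case (compl A)
      then have A: "A \<in> sets borel" by (simp add: borel_eq_atMost)
      have "(LBINT r:A \<union> (UNIV - A). G r) = (LBINT r:A. G r) + (LBINT r:UNIV - A. G r)"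
        by (rule set_integral_Un) (use A Gi in auto)
      then show ?case using compl all by (simp add: set_lebesgue_integral_def[of _ UNIV])
    next
      case (union A)
      have A: "A i \<in> sets borel" for i using union(2) by (auto simp: borel_eq_atMost)
      have "(LBINT r:(\<Union>i. A i). G r) = (\<Sum>i. LBINT r:A i. G r)"
        by (rule lebesgue_integral_countable_add) (use A union(1) Gi in \<open>auto simp: disjoint_family_on_def\<close>)
      then show ?case using union(3) by simp
    qed
  qed
  have "AE s in lborel. G s = 0"
    by (rule sigma_finite_measure.density_zero[OF sigma_finite_lborel G]) (use int0 in auto)
  then show ?thesis by eventually_elim (auto simp: G_def)
qed

section \<open>Gronwall inequalities with integrable kernels and delay\<close>

text \<open>
  Since \<open>\<kappa>\<close> is only integrable, its primitive \<open>K\<close> need not be differentiable and there is no integrating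
  factor to differentiate. Instead the range of \<open>K\<close> is cut into \<open>n\<close> pieces of equal length \<open>K T / n\<close>.
  While \<open>K\<close> runs through one piece, the right-hand side \<open>Y\<close> of the inequality grows at most by the factor
  \<open>1 / (1 - K T / n)\<close>, and \<open>(1 - K T / n)\<^sup>n\<close> tends to \<open>exp (- K T)\<close>.
\<close>

lemma gronwall_integrable_kernel:
  fixes \<kappa> y :: "real \<Rightarrow> real"
  assumes "0 \<le> T" and \<kappa>: "set_integrable lborel {0..T} \<kappa>"
    and \<kappa>0: "\<And>s. s \<in> {0..T} \<Longrightarrow> 0 \<le> \<kappa> s"
    and y: "continuous_on {0..T} y" and y0: "\<And>s. s \<in> {0..T} \<Longrightarrow> 0 \<le> y s"
    and le: "\<And>t. t \<in> {0..T} \<Longrightarrow> y t \<le> a + (LBINT s:{0..t}. \<kappa> s * y s)"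
  shows "y T \<le> a * exp (LBINT s:{0..T}. \<kappa> s)"
proof -
  have ky: "set_integrable lborel {0..T} (\<lambda>s. \<kappa> s * y s)"
    using set_integrable_scaleR_continuous[OF \<kappa> y] by simp
  define K where "K t = (LBINT s:{0..t}. \<kappa> s)" for t
  define Y where "Y t = a + (LBINT s:{0..t}. \<kappa> s * y s)" for t
  have Kdiff: "K t - K s = (LBINT r:{s..t}. \<kappa> r)" if "0 \<le> s" "s \<le> t" "t \<le> T" for s t
    using set_integral_split[OF set_integrable_subset[OF \<kappa>], of 0 t s] that by (simp add: K_def)
  have Ydiff: "Y t - Y s = (LBINT r:{s..t}. \<kappa> r * y r)" if "0 \<le> s" "s \<le> t" "t \<le> T" for s t
    using set_integral_split[OF set_integrable_subset[OF ky], of 0 t s] that by (simp add: Y_def)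
  have sub\<kappa>: "set_integrable lborel {s..t} \<kappa>" and subky: "set_integrable lborel {s..t} (\<lambda>s. \<kappa> s * y s)"
    if "0 \<le> s" "t \<le> T" for s t
    using that by (auto intro: set_integrable_subset[OF \<kappa>] set_integrable_subset[OF ky])
  have Kmono: "K s \<le> K t" if "0 \<le> s" "s \<le> t" "t \<le> T" for s t
  proof -
    have "0 \<le> (LBINT r:{s..t}. \<kappa> r)"
      by (rule set_integral_nonneg) (use that \<kappa>0 in auto)
    then show ?thesis using Kdiff[OF that] by simp
  qed
  have Ymono: "Y s \<le> Y t" if "0 \<le> s" "s \<le> t" "t \<le> T" for s t
  proof -
    have "0 \<le> (LBINT r:{s..t}. \<kappa> r * y r)"
      by (rule set_integral_nonneg) (use that \<kappa>0 y0 in auto)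
    then show ?thesis using Ydiff[OF that] by simp
  qed
  have step: "Y t * (1 - (K t - K s)) \<le> Y s" if "0 \<le> s" "s \<le> t" "t \<le> T" for s t
  proof -
    have "Y t - Y s \<le> (LBINT r:{s..t}. \<kappa> r * Y t)"
      unfolding Ydiff[OF that]
    proof (rule set_integral_mono)
      show "set_integrable lborel {s..t} (\<lambda>r. \<kappa> r * y r)" using subky that by auto
      show "set_integrable lborel {s..t} (\<lambda>r. \<kappa> r * Y t)"
        using sub\<kappa>[of s t] that by auto
      fix r assume r: "r \<in> {s..t}"
      have "y r \<le> Y r" using le[of r] r that by (simp add: Y_def)
      also have "Y r \<le> Y t" using Ymono r that by auto
      finally show "\<kappa> r * y r \<le> \<kappa> r * Y t"
        using \<kappa>0[of r] r that by (auto intro: mult_left_mono)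
    qed
    also have "\<dots> = (K t - K s) * Y t" unfolding Kdiff[OF that] by simp
    finally show ?thesis by (simp add: algebra_simps)
  qed
  have K0: "K 0 = 0" and Y0: "Y 0 = a"
    by (simp_all add: K_def Y_def set_integral_singleton_zero[of 0, simplified])
  have a0: "0 \<le> a" using le[of 0] y0[of 0] \<open>0 \<le> T\<close> Y0 by (simp add: Y_def)
  have Kcont: "continuous_on {0..T} K"
    unfolding K_def by (rule continuous_on_set_integral[OF \<kappa>])
  have bound: "Y T * (1 - K T / real n) ^ n \<le> a" if n: "real n > K T" for n
  proof -
    have n0: "n > 0" using n Kmono[of 0 T] K0 \<open>0 \<le> T\<close> by (auto intro: gr0I)
    define q where "q = K T / real n"
    have q: "0 \<le> q" "q < 1" using n n0 Kmono[of 0 T] K0 \<open>0 \<le> T\<close> by (auto simp: q_def)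
    have "\<forall>t\<in>{0..T}. K t \<le> real i * q \<longrightarrow> Y t * (1 - q) ^ i \<le> a" for i
    proof (induction i)
      case 0
      show ?case
      proof safe
        fix t assume t: "t \<in> {0..T}" "K t \<le> real 0 * q"
        then have "K t = 0" using Kmono[of 0 t] K0 by auto
        then show "Y t * (1 - q) ^ 0 \<le> a" using step[of 0 t] t K0 Y0 by auto
      qed
    next
      case (Suc i)
      show ?case
      proof safe
        fix t assume t: "t \<in> {0..T}" "K t \<le> real (Suc i) * q"
        have Yt: "0 \<le> Y t" using Ymono[of 0 t] t a0 Y0 by auto
        show "Y t * (1 - q) ^ Suc i \<le> a"
        proof (cases "K t \<le> real i * q")
          case True
          have "Y t * (1 - q) ^ Suc i \<le> Y t * (1 - q) ^ i"
            using q Yt by (intro mult_left_mono power_decreasing) auto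
          then show ?thesis using Suc.IH t True by force
        next
          case False
          \<comment> \<open>\<open>K\<close> is continuous, so there is a time at which exactly the first \<open>i\<close> pieces have been used up.\<close>
          have "\<exists>s\<ge>0. s \<le> t \<and> K s = real i * q"
            by (rule IVT') (use False t q K0 continuous_on_subset[OF Kcont, of "{0..t}"] in auto)
          then obtain s where s: "0 \<le> s" "s \<le> t" "K s = real i * q" by auto
          have "Y t * (1 - q) \<le> Y t * (1 - (K t - K s))"
            using t s Yt by (intro mult_left_mono) (auto simp: algebra_simps)
          also have "\<dots> \<le> Y s" by (rule step) (use s t in auto)
          finally have "Y t * (1 - q) * (1 - q) ^ i \<le> Y s * (1 - q) ^ i"
            using q by (intro mult_right_mono) auto
          also have "\<dots> \<le> a" using Suc.IH s t by auto
          finally show ?thesis by (simp add: mult_ac)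
        qed
      qed
    qed
    from this[of n] show ?thesis using \<open>0 \<le> T\<close> n0 by (auto simp: q_def)
  qed
  have "(\<lambda>n. Y T * (1 + (- K T) / real n) ^ n) \<longlonglongrightarrow> Y T * exp (- K T)"
    by (intro tendsto_intros tendsto_exp_limit_sequentially)
  moreover have "eventually (\<lambda>n. Y T * (1 + (- K T) / real n) ^ n \<le> a) sequentially"
    using eventually_gt_at_top[of "nat \<lceil>K T\<rceil>"]
  proof eventually_elim
    case (elim n)
    then have "K T < real n" by linarith
    then show ?case using bound[of n] by simp
  qed
  ultimately have "Y T * exp (- K T) \<le> a"
    by (rule tendsto_upperbound) simp
  then have "Y T \<le> a * exp (K T)" by (simp add: exp_minus field_simps)
  moreover have "y T \<le> Y T" using le[of T] \<open>0 \<le> T\<close> by (simp add: Y_def)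
  ultimately show ?thesis by (simp add: K_def)
qed

text \<open>
  At time \<open>s\<close> the delayed term only sees \<open>y (s - \<tau>)\<close>. Shifting the integration variable by \<open>\<tau>\<close> therefore
  turns it into an undelayed term with kernel \<open>P (s + \<tau>)\<close>, at the price of enlarging the interval.
\<close>

lemma delayed_gronwall:
  fixes P y :: "real \<Rightarrow> real"
  assumes "0 \<le> T" "0 < \<tau>" and P: "set_integrable lborel {0..T + \<tau>} P"
    and P0: "\<And>s. 0 \<le> P s" and "0 \<le> L"
    and y: "continuous_on {0..T} y" and y0: "\<And>s. s \<in> {0..T} \<Longrightarrow> 0 \<le> y s"
    and le: "\<And>t. t \<in> {0..T} \<Longrightarrow> y t \<le> a + (LBINT s:{0..t}. P s * (if s \<le> \<tau> then 0 else y (s - \<tau>)))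
        + (LBINT s:{0..t}. L * y s)"
  shows "y T \<le> a * exp ((LBINT s:{0..T}. P (s + \<tau>)) + L * T)"
proof -
  have Psh: "set_integrable lborel {0..T} (\<lambda>s. P (s + \<tau>))"
    using \<open>0 < \<tau>\<close> by (intro set_integrable_shift set_integrable_subset[OF P]) auto
  have Lc: "set_integrable lborel {0..T} (\<lambda>s. L)"
    by (rule borel_integrable_atLeastAtMost') auto
  have 1: "y t \<le> a + (LBINT s:{0..t}. (P (s + \<tau>) + L) * y s)" if t: "t \<in> {0..T}" for t
  proof -
    have i1: "set_integrable lborel {0..t} (\<lambda>s. P (s + \<tau>) * y s)"
      using set_integrable_scaleR_continuous[OF set_integrable_subset[OF Psh] continuous_on_subset[OF y]] t by auto
    have i2: "set_integrable lborel {0..t} (\<lambda>s. L * y s)"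
      using t by (intro borel_integrable_atLeastAtMost' continuous_intros continuous_on_subset[OF y]) auto
    have "(LBINT s:{0..t}. P s * (if s \<le> \<tau> then 0 else y (s - \<tau>)))
        = (LBINT s:{0 - \<tau>..t - \<tau>}. P (s + \<tau>) * (if s + \<tau> \<le> \<tau> then 0 else y (s + \<tau> - \<tau>)))"
      by (subst set_integral_shift[symmetric]) simp
    also have "\<dots> \<le> (LBINT s:{0..t}. P (s + \<tau>) * y s)"
      unfolding set_lebesgue_integral_def
    proof (rule integral_mono')
      show "integrable lborel (\<lambda>x. indicat_real {0..t} x *\<^sub>R (P (x + \<tau>) * y x))"
        using i1 by (simp add: set_integrable_def)
    qed (use t P0 y0 \<open>0 < \<tau>\<close> in \<open>auto simp: indicator_def\<close>)
    finally have "y t \<le> a + ((LBINT s:{0..t}. P (s + \<tau>) * y s) + (LBINT s:{0..t}. L * y s))"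
      using le[OF t] by simp
    also have "(LBINT s:{0..t}. P (s + \<tau>) * y s) + (LBINT s:{0..t}. L * y s)
       = (LBINT s:{0..t}. (P (s + \<tau>) + L) * y s)"
      by (subst set_integral_add(2)[symmetric, OF i1 i2]) (simp add: distrib_right)
    finally show ?thesis .
  qed
  have "y T \<le> a * exp (LBINT s:{0..T}. P (s + \<tau>) + L)"
    by (rule gronwall_integrable_kernel[OF \<open>0 \<le> T\<close> set_integral_add(1)[OF Psh Lc] _ y y0 1])
      (use P0 \<open>0 \<le> L\<close> in auto)
  also have "(LBINT s:{0..T}. P (s + \<tau>) + L) = (LBINT s:{0..T}. P (s + \<tau>)) + L * T"
    using set_integral_add(2)[OF Psh Lc] \<open>0 \<le> T\<close> by (simp add: set_integral_const mult.commute)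
  finally show ?thesis .
qed

text \<open>
  Splitting off the last window of length \<open>\<tau>\<close> costs at most \<open>C\<close> and leaves the same integral at time
  \<open>t - \<tau>\<close>, scaled by \<open>exp (- l \<tau>) \<le> 1/2\<close>. The bound is the sum of the geometric series.
\<close>

lemma weighted_window_bound:
  fixes k :: "real \<Rightarrow> real"
  assumes k: "\<And>t. 0 \<le> t \<Longrightarrow> set_integrable lborel {0..t} k"
    and C: "\<And>t. 0 < t \<Longrightarrow> (LBINT s:{max 0 (t - \<tau>)..t}. \<bar>k s\<bar>) \<le> C"
    and "0 < \<tau>" "0 < l" "exp (- (l * \<tau>)) \<le> 1 / 2" "0 \<le> t"
  shows "(LBINT s:{0..t}. exp (- (l * (t - s))) * \<bar>k s\<bar>) \<le> 2 * C"
proof -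
  have ak: "set_integrable lborel {a..b} (\<lambda>s. \<bar>k s\<bar>)" if "0 \<le> a" for a b
  proof (cases "a \<le> b")
    case True
    show ?thesis
      by (rule set_integrable_abs, rule set_integrable_subset[OF k[of b]]) (use that True in auto)
  qed (auto simp: set_integrable_def)
  have wk: "set_integrable lborel {a..b} (\<lambda>s. exp (- (l * (t - s))) * \<bar>k s\<bar>)" if "0 \<le> a" for a b t
    using set_integrable_scaleR_continuous[OF ak[OF that], of b "\<lambda>s. exp (- (l * (t - s)))"]
    by (simp add: mult.commute continuous_on_exp continuous_on_mult continuous_on_minus continuous_on_diff)
  have part: "(LBINT s:{a..t}. exp (- (l * (t - s))) * \<bar>k s\<bar>) \<le> (LBINT s:{a..t}. \<bar>k s\<bar>)" if "0 \<le> a" for a t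
    by (rule set_integral_mono[OF wk[OF that] ak[OF that]])
      (use \<open>0 < l\<close> in \<open>auto intro!: mult_left_le_one_le\<close>)
  have C0: "0 \<le> C" using order_trans[OF set_integral_nonneg C[of 1]] by auto
  have "\<forall>t. 0 \<le> t \<longrightarrow> t \<le> real (Suc n) * \<tau> \<longrightarrow> (LBINT s:{0..t}. exp (- (l * (t - s))) * \<bar>k s\<bar>) \<le> 2 * C" for n
  proof (induction n)
    case 0
    show ?case
    proof safe
      fix t assume t: "0 \<le> t" "t \<le> real (Suc 0) * \<tau>"
      show "(LBINT s:{0..t}. exp (- (l * (t - s))) * \<bar>k s\<bar>) \<le> 2 * C"
      proof (cases "t = 0")
        case True then show ?thesis using C0 by (simp add: set_integral_singleton_zero[of 0, simplified])
      next
        case False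
        have "max 0 (t - \<tau>) = 0" using t by simp
        then show ?thesis using part[of 0 t] C[of t] t C0 False by simp
      qed
    qed
  next
    case (Suc n)
    show ?case
    proof safe
      fix t assume t: "0 \<le> t" "t \<le> real (Suc (Suc n)) * \<tau>"
      show "(LBINT s:{0..t}. exp (- (l * (t - s))) * \<bar>k s\<bar>) \<le> 2 * C"
      proof (cases "t \<le> real (Suc n) * \<tau>")
        case True then show ?thesis using Suc t by auto
      next
        case False
        have "\<tau> \<le> real (Suc n) * \<tau>" using \<open>0 < \<tau>\<close> by simp
        then have tt: "\<tau> < t" using False by linarith
        have eq: "(LBINT s:{0..t - \<tau>}. exp (- (l * (t - s))) * \<bar>k s\<bar>)
           = exp (- (l * \<tau>)) * (LBINT s:{0..t - \<tau>}. exp (- (l * ((t - \<tau>) - s))) * \<bar>k s\<bar>)"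
          by (subst set_integral_mult_right[symmetric], rule set_lebesgue_integral_cong)
            (auto simp: exp_add[symmetric] algebra_simps mult.assoc[symmetric])
        have ih: "(LBINT s:{0..t - \<tau>}. exp (- (l * ((t - \<tau>) - s))) * \<bar>k s\<bar>) \<le> 2 * C"
          using Suc.IH[rule_format, of "t - \<tau>"] t tt by (simp add: distrib_right)
        have "exp (- (l * \<tau>)) * (LBINT s:{0..t - \<tau>}. exp (- (l * ((t - \<tau>) - s))) * \<bar>k s\<bar>) \<le> 1 / 2 * (2 * C)"
          by (rule mult_mono) (use assms ih set_integral_nonneg in auto)
        moreover have "(LBINT s:{t - \<tau>..t}. exp (- (l * (t - s))) * \<bar>k s\<bar>) \<le> C"
          using part[of "t - \<tau>" t] C[of t] tt \<open>0 < \<tau>\<close> by (simp add: max_def)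
        ultimately show ?thesis
          using set_integral_split[OF wk, of 0 "t - \<tau>" t t] tt \<open>0 < \<tau>\<close> eq by simp
      qed
    qed
  qed
  moreover obtain n where "t / \<tau> \<le> real n" using real_arch_simple by blast
  then have "t \<le> real (Suc n) * \<tau>" using \<open>0 < \<tau>\<close> by (simp add: field_simps)
  ultimately show ?thesis using \<open>0 \<le> t\<close> by blast
qed

section \<open>Adjoints of bounded operators on a Hilbert space\<close>

text \<open>
  The representing vector minimizes the functional \<open>q x = x \<bullet> x / 2 - f x\<close>, which is bounded below. By the
  parallelogram law every minimizing sequence is Cauchy, and the first variation of \<open>q\<close> at the limit \<open>z\<close>
  is \<open>z \<bullet> v - f v\<close>.
\<close>

lemma riesz_representation:
  fixes f :: "'a::{real_inner, complete_space} \<Rightarrow> real"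
  assumes "bounded_linear f"
  shows "\<exists>z. \<forall>x. f x = z \<bullet> x"
proof -
  interpret f: bounded_linear f by fact
  define q where "q x = x \<bullet> x / 2 - f x" for x
  obtain K where K: "\<And>x. norm (f x) \<le> norm x * K" using f.bounded by blast
  have low: "- (K\<^sup>2) / 2 \<le> q x" for x
  proof -
    have "0 \<le> (norm x - K)\<^sup>2" by simp
    then have "norm x * K \<le> x \<bullet> x / 2 + K\<^sup>2 / 2"
      by (simp add: power2_diff dot_square_norm)
    then show ?thesis using K[of x] by (simp add: q_def)
  qed
  define m where "m = Inf (range q)"
  have bdd: "bdd_below (range q)" using low by (intro bdd_belowI[of _ "- (K\<^sup>2) / 2"]) blast
  have mle: "m \<le> q x" for x unfolding m_def using bdd by (auto intro: cInf_lower)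
  have "\<exists>x. q x < m + inverse (real (Suc n))" for n
  proof (rule ccontr)
    assume "\<nexists>x. q x < m + inverse (real (Suc n))"
    then have "m + inverse (real (Suc n)) \<le> m"
      unfolding m_def by (intro cInf_greatest) (auto simp: not_less)
    then show False by simp
  qed
  then obtain X where X: "\<And>n. q (X n) < m + inverse (real (Suc n))" by metis
  have par: "(norm (x - y))\<^sup>2 / 4 = q x + q y - 2 * q ((1/2) *\<^sub>R (x + y))" for x y
  proof -
    have "q ((1/2) *\<^sub>R (x + y)) = (x \<bullet> x + 2 * (x \<bullet> y) + y \<bullet> y) / 8 - (f x + f y) / 2"
      by (simp add: q_def f.scaleR f.add inner_add_left inner_add_right inner_commute[of y x])
        argo
    moreover have "(norm (x - y))\<^sup>2 = x \<bullet> x - 2 * (x \<bullet> y) + y \<bullet> y"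
      by (simp add: power2_norm_eq_inner inner_diff_left inner_diff_right inner_commute[of y x])
    ultimately show ?thesis by (simp add: q_def field_simps)
  qed
  have dist: "(norm (X i - X j))\<^sup>2 \<le> 8 * inverse (real (Suc n))" if "n \<le> i" "n \<le> j" for i j n
  proof -
    have "inverse (real (Suc i)) \<le> inverse (real (Suc n))" "inverse (real (Suc j)) \<le> inverse (real (Suc n))"
      using that by auto
    then show ?thesis using par[of "X i" "X j"] X[of i] X[of j] mle[of "(1/2) *\<^sub>R (X i + X j)"] by linarith
  qed
  have "Cauchy X"
  proof (rule metric_CauchyI)
    fix e :: real assume "e > 0"
    then obtain n where n: "inverse (real (Suc n)) < e\<^sup>2 / 8"
      using reals_Archimedean[of "e\<^sup>2 / 8"] by auto
    have "dist (X i) (X j) < e" if "n \<le> i" "n \<le> j" for i j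
      using dist[OF that] n \<open>e > 0\<close> by (auto simp: dist_norm intro: power2_less_imp_less)
    then show "\<exists>M. \<forall>i\<ge>M. \<forall>j\<ge>M. dist (X i) (X j) < e" by auto
  qed
  then obtain z where z: "X \<longlonglongrightarrow> z" using Cauchy_convergent_iff convergent_def by blast
  have "(\<lambda>n. q (X n)) \<longlonglongrightarrow> q z"
    unfolding q_def by (intro tendsto_intros z f.tendsto) auto
  moreover have "(\<lambda>n. m + inverse (real (Suc n))) \<longlonglongrightarrow> m + 0"
    by (intro tendsto_intros LIMSEQ_inverse_real_of_nat)
  ultimately have "q z \<le> m + 0"
    by (rule LIMSEQ_le) (use X less_imp_le in blast)
  then have min: "q z \<le> q x" for x using mle[of x] by simp
  have "f v = z \<bullet> v" for v
  proof (rule ccontr)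
    assume ne: "f v \<noteq> z \<bullet> v"
    define d where "d = f v - z \<bullet> v"
    have v: "v \<bullet> v > 0" using ne f.zero by auto
    \<comment> \<open>This step length minimizes \<open>q\<close> on the line through \<open>z\<close> with direction \<open>v\<close>.\<close>
    have "q z \<le> q (z + (d / (v \<bullet> v)) *\<^sub>R v)" by (rule min)
    also have "\<dots> = q z - d\<^sup>2 / (2 * (v \<bullet> v))"
      
    proof -
      define c where "c = d / (v \<bullet> v)"
      have "q (z + c *\<^sub>R v) = q z - c * d + c * c * (v \<bullet> v) / 2"
        by (simp add: q_def d_def f.scaleR f.add inner_add_left inner_add_right inner_commute[of v z])
          (simp add: algebra_simps)
      also have "\<dots> = q z - d\<^sup>2 / (2 * (v \<bullet> v))"
        using v by (simp add: c_def power2_eq_square field_simps)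
      finally show ?thesis by (simp add: c_def)
    qed
    finally have "d\<^sup>2 / (2 * (v \<bullet> v)) \<le> 0" by simp
    moreover have "0 < d\<^sup>2 / (2 * (v \<bullet> v))" using v ne by (simp add: d_def)
    ultimately show False by simp
  qed
  then show ?thesis by blast
qed

text \<open>
  The constant \<open>adjoint\<close> chooses some function with this property; the Riesz representation shows that
  there is one to choose, in any dimension.
\<close>

lemma bounded_linear_adjoint:
  fixes B :: "'a::{real_inner, complete_space} \<Rightarrow> 'b::real_inner"
  assumes "bounded_linear B"
  shows "B x \<bullet> y = x \<bullet> adjoint B y"
proof -
  have "\<exists>z. \<forall>x. B x \<bullet> y = z \<bullet> x" for y
    by (rule riesz_representation) (intro bounded_linear_inner_left_comp assms)
  then obtain g where "\<And>y x. B x \<bullet> y = g y \<bullet> x" by metis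
  then have "\<exists>g. \<forall>x y. B x \<bullet> y = x \<bullet> g y" by (metis inner_commute)
  then have "\<forall>x y. B x \<bullet> y = x \<bullet> adjoint B y" unfolding adjoint_def by (rule someI_ex)
  then show ?thesis by blast
qed

lemma norm_adjoint_le:
  fixes B :: "'a::{real_inner, complete_space} \<Rightarrow> 'b::real_inner"
  assumes B: "bounded_linear B"
  shows "norm (adjoint B y) \<le> onorm B * norm y"
proof -
  have "norm (adjoint B y) * norm (adjoint B y) = B (adjoint B y) \<bullet> y"
    using bounded_linear_adjoint[OF B, of "adjoint B y" y] by (simp add: dot_square_norm power2_eq_square)
  also have "\<dots> \<le> norm (B (adjoint B y)) * norm y" by (rule norm_cauchy_schwarz)
  also have "\<dots> \<le> onorm B * norm (adjoint B y) * norm y"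
    by (intro mult_right_mono onorm B) auto
  finally have "norm (adjoint B y) * norm (adjoint B y) \<le> (onorm B * norm y) * norm (adjoint B y)"
    by (simp add: mult_ac)
  moreover have "0 \<le> onorm B * norm y" by (intro mult_nonneg_nonneg onorm_pos_le B norm_ge_zero)
  ultimately show ?thesis
    using mult_right_le_imp_le[of "norm (adjoint B y)" "norm (adjoint B y)" "onorm B * norm y"]
      norm_ge_zero[of "adjoint B y"] by (cases "norm (adjoint B y) = 0") linarith+
qed

lemma linear_adjoint:
  fixes B :: "'a::{real_inner, complete_space} \<Rightarrow> 'b::real_inner"
  assumes B: "bounded_linear B"
  shows "linear (adjoint B)"
proof (rule linearI)
  fix x y c
  show "adjoint B (x + y) = adjoint B x + adjoint B y"
    by (rule vector_eq_ldot[THEN iffD1]) (simp add: inner_add_left inner_add_right bounded_linear_adjoint[OF B,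
        symmetric])
  show "adjoint B (c *\<^sub>R x) = c *\<^sub>R adjoint B x"
    by (rule vector_eq_ldot[THEN iffD1]) (simp add: inner_add_left inner_add_right bounded_linear_adjoint[OF B,
        symmetric])
qed

section \<open>Exponentially decaying semigroups and the Duhamel integral\<close>

locale decaying_semigroup =
  fixes S :: "real \<Rightarrow> 'x \<Rightarrow> 'x::{banach, second_countable_topology}" and M \<omega> :: real
  assumes semigroup: "C0_semigroup S"
    and M: "0 < M" and \<omega>: "0 < \<omega>"
    and decay: "\<And>t x. 0 \<le> t \<Longrightarrow> norm (S t x) \<le> M * exp (- \<omega> * t) * norm x"
begin

lemma linear_S: "0 \<le> t \<Longrightarrow> bounded_linear (S t)"
  using semigroup by (simp add: C0_semigroup_def)

lemma S_zero [simp]: "S 0 x = x"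
  using semigroup by (simp add: C0_semigroup_def)

lemma S_plus: "0 \<le> s \<Longrightarrow> 0 \<le> t \<Longrightarrow> S (s + t) x = S s (S t x)"
  using semigroup by (simp add: C0_semigroup_def)

lemma S_bounded: "norm (S t x) \<le> M * norm x" if "0 \<le> t"
proof -
  have "M * exp (- \<omega> * t) * norm x \<le> M * 1 * norm x"
    using that M \<omega> by (intro mult_right_mono mult_left_mono) auto
  then show ?thesis using decay[OF that, of x] by simp
qed

text \<open>
  This reduces continuity of an orbit at an arbitrary time, from both sides, to right continuity at \<open>0\<close>.
\<close>

lemma S_diff_bound:
  assumes "0 \<le> s" "0 \<le> t"
  shows "norm (S t x - S s x) \<le> M * norm (S \<bar>t - s\<bar> x - x)"
proof -
  have *: "norm (S (a + h) x - S a x) \<le> M * norm (S h x - x)" if "0 \<le> a" "0 \<le> h" for a h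
    using S_bounded[OF \<open>0 \<le> a\<close>, of "S h x - x"] that
    by (simp add: S_plus linear_S bounded_linear.linear linear_diff)
  show ?thesis
    using *[of s "t - s"] *[of t "s - t"] assms
    by (cases "s \<le> t") (auto simp: norm_minus_commute abs_if)
qed

lemma S_continuous: "continuous_on {0..} (\<lambda>t. S t x)"
  unfolding continuous_on_iff
proof safe
  fix s e :: real assume s: "0 \<le> s" and e: "0 < e"
  have "((\<lambda>h. S h x) \<longlongrightarrow> x) (at_right 0)"
    using semigroup by (simp add: C0_semigroup_def)
  then have "eventually (\<lambda>h. dist (S h x) x < e / M) (at_right 0)"
    using e M by (intro tendstoD) auto
  then obtain d where d: "0 < d" "\<And>h. 0 < h \<Longrightarrow> h < d \<Longrightarrow> dist (S h x) x < e / M"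
    unfolding eventually_at_right_field by auto
  have "dist (S t x) (S s x) < e" if t: "0 \<le> t" "dist t s < d" for t
  proof (cases "t = s")
    case False
    have "M * norm (S \<bar>t - s\<bar> x - x) < M * (e / M)"
      using d(2)[of "\<bar>t - s\<bar>"] t False M by (intro mult_strict_left_mono) (auto simp: dist_norm)
    then show ?thesis using S_diff_bound[OF s t(1), of x] M by (simp add: dist_norm)
  qed (use e in simp)
  then show "\<exists>d>0. \<forall>t\<in>{0..}. dist t s < d \<longrightarrow> dist (S t x) (S s x) < e"
    using d(1) by auto
qed

lemma S_continuous_compose:
  assumes "continuous_on A f" "\<And>t. t \<in> A \<Longrightarrow> 0 \<le> f t"
  shows "continuous_on A (\<lambda>t. S (f t) x)"
  by (rule continuous_on_compose2[OF S_continuous assms(1)]) (use assms(2) in auto)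

text \<open>
  Joint continuity is what makes \<open>s \<mapsto> S (t - s) (f s)\<close> measurable for every measurable \<open>f\<close>; the cut-off
  \<open>max 0 t\<close> extends the semigroup to negative times.
\<close>

lemma S_jointly_continuous: "continuous_on UNIV (\<lambda>(t, x). S (max 0 t) x)"
proof -
  have "isCont (\<lambda>(t, x). S (max 0 t) x) (t, x)" for t x
  proof -
    have "continuous_on UNIV (\<lambda>p. S (max 0 (fst p)) x)"
      by (rule S_continuous_compose) (intro continuous_on_max continuous_on_const continuous_on_fst
          continuous_on_id, simp)
    then have "isCont (\<lambda>p. S (max 0 (fst p)) x) (t, x)" using continuous_on_eq_continuous_at[OF open_UNIV] by blast
    then have "((\<lambda>p. S (max 0 (fst p)) x) \<longlongrightarrow> S (max 0 t) x) (at (t, x))" by (simp add: isCont_def)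
    moreover have "(snd \<longlongrightarrow> x) (at (t, x))"
      using tendsto_snd[OF tendsto_ident_at, of "(t, x)" UNIV] by simp
    ultimately have "((\<lambda>p. M * norm (snd p - x) + norm (S (max 0 (fst p)) x - S (max 0 t) x))
        \<longlongrightarrow> M * norm (x - x) + norm (S (max 0 t) x - S (max 0 t) x)) (at (t, x))"
      by (intro tendsto_intros)
    then have 1: "((\<lambda>p. M * norm (snd p - x) + norm (S (max 0 (fst p)) x - S (max 0 t) x)) \<longlongrightarrow> 0) (at (t, x))"
      by simp
    have 2: "norm (S (max 0 t') x' - S (max 0 t) x)
        \<le> M * norm (x' - x) + norm (S (max 0 t') x - S (max 0 t) x)" for t' x'
    proof -
      have "S (max 0 t') x' - S (max 0 t) x = S (max 0 t') (x' - x) + (S (max 0 t') x - S (max 0 t) x)"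
        by (simp add: linear_S bounded_linear.linear linear_diff)
      also have "norm \<dots> \<le> norm (S (max 0 t') (x' - x)) + norm (S (max 0 t') x - S (max 0 t) x)"
        by (rule norm_triangle_ineq)
      finally show ?thesis using S_bounded[of "max 0 t'" "x' - x"] by simp
    qed
    have "((\<lambda>p. S (max 0 (fst p)) (snd p) - S (max 0 t) x) \<longlongrightarrow> 0) (at (t, x))"
      by (rule Lim_null_comparison[OF always_eventually 1]) (use 2 in auto)
    then show ?thesis by (simp add: isCont_def LIM_zero_iff case_prod_unfold)
  qed
  then show ?thesis by (simp add: continuous_on_eq_continuous_at)
qed

lemma S_measurable:
  assumes "g \<in> borel_measurable N" "f \<in> borel_measurable N"
  shows "(\<lambda>s. S (max 0 (g s)) (f s)) \<in> borel_measurable N"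
proof -
  have "(\<lambda>s. (g s, f s)) \<in> borel_measurable N"
    by (rule borel_measurable_Pair[OF assms])
  from borel_measurable_continuous_on[OF S_jointly_continuous this] show ?thesis by simp
qed

definition duhamel :: "(real \<Rightarrow> 'x) \<Rightarrow> real \<Rightarrow> 'x" where
  "duhamel f t = (LBINT s:{0..t}. S (t - s) (f s))"

lemma duhamel_indicator:
  "indicator {0..t} s *\<^sub>R S (t - s) (f s) = S (max 0 (t - s)) (indicator {0..t} s *\<^sub>R f s)"
  by (auto simp: indicator_def linear_S bounded_linear.linear linear_0)

lemma duhamel_integrable:
  assumes "set_integrable lborel {0..t} f"
  shows "set_integrable lborel {0..t} (\<lambda>s. S (t - s) (f s))"
  unfolding set_integrable_def duhamel_indicator
proof (rule Bochner_Integration.integrable_bound)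
  show "integrable lborel (\<lambda>s. M * norm (indicator {0..t} s *\<^sub>R f s))"
    using assms by (simp add: set_integrable_def del: norm_scaleR)
  show "(\<lambda>s. S (max 0 (t - s)) (indicator {0..t} s *\<^sub>R f s)) \<in> borel_measurable lborel"
    by (rule S_measurable) (use assms in \<open>auto simp: set_integrable_def simp del: borel_measurable_scaleR\<close>)
  show "AE s in lborel. norm (S (max 0 (t - s)) (indicator {0..t} s *\<^sub>R f s))
      \<le> norm (M * norm (indicator {0..t} s *\<^sub>R f s))"
    using S_bounded M by (intro AE_I2) (simp add: abs_mult del: norm_scaleR)
qed

lemma duhamel_norm:
  assumes f: "set_integrable lborel {0..t} f" and g: "set_integrable lborel {0..t} g"
    and le: "\<And>s. s \<in> {0..t} \<Longrightarrow> M * exp (- \<omega> * (t - s)) * norm (f s) \<le> g s"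
  shows "norm (duhamel f t) \<le> (LBINT s:{0..t}. g s)"
  unfolding duhamel_def
  by (rule norm_set_integral_le[OF duhamel_integrable[OF f] g])
     (use order_trans[OF decay le] in auto)

lemma duhamel_diff:
  assumes f: "set_integrable lborel {0..t} f" and g: "set_integrable lborel {0..t} g"
  shows "duhamel f t - duhamel g t = duhamel (\<lambda>s. f s - g s) t"
  unfolding duhamel_def
  by (subst set_integral_diff(2)[symmetric, OF duhamel_integrable[OF f] duhamel_integrable[OF g]])
     (auto intro!: set_lebesgue_integral_cong simp: linear_S bounded_linear.linear linear_diff)

text \<open>
  Dominated convergence: for fixed \<open>s \<noteq> t\<close> the integrand, set to zero for \<open>s\<close> beyond the upper limit,
  depends continuously on that limit at \<open>t\<close>.
\<close>

lemma duhamel_continuous: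
  assumes f: "\<And>t. 0 \<le> t \<Longrightarrow> set_integrable lborel {0..t} f"
  shows "continuous_on {0..} (duhamel f)"
  unfolding continuous_on_sequentially comp_def
proof safe
  fix X :: "nat \<Rightarrow> real" and t
  assume X: "\<forall>n. X n \<in> {0..}" and t: "0 \<le> t" and lim: "X \<longlonglongrightarrow> t"
  obtain T where T: "\<And>n. X n \<le> T"
    using convergent_imp_bounded[OF lim] by (fastforce simp: bounded_iff dest: abs_le_D1)
  have tT: "t \<le> T" by (rule LIMSEQ_le_const2[OF lim]) (use T in auto)
  define F where "F s = indicator {0..T} s *\<^sub>R f s" for s
  have F: "integrable lborel F"
    using f[of T] t tT unfolding F_def set_integrable_def by auto
  have eq: "duhamel f r = (LBINT s. indicator {0..r} s *\<^sub>R S (max 0 (r - s)) (F s))" if "0 \<le> r" "r \<le> T" for r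
    unfolding duhamel_def set_lebesgue_integral_def
    by (rule Bochner_Integration.integral_cong) (use that in \<open>auto simp: F_def indicator_def\<close>)
  have "(\<lambda>n. LBINT s. indicator {0..X n} s *\<^sub>R S (max 0 (X n - s)) (F s))
      \<longlonglongrightarrow> (LBINT s. indicator {0..t} s *\<^sub>R S (max 0 (t - s)) (F s))"
  proof (rule integral_dominated_convergence)
    show "integrable lborel (\<lambda>s. M * norm (F s))" using F by auto
    show "(\<lambda>s. indicator {0..t} s *\<^sub>R S (max 0 (t - s)) (F s)) \<in> borel_measurable lborel"
      by (intro borel_measurable_scaleR S_measurable) (use F in auto)
    show "(\<lambda>s. indicator {0..X n} s *\<^sub>R S (max 0 (X n - s)) (F s)) \<in> borel_measurable lborel" for n
      by (intro borel_measurable_scaleR S_measurable) (use F in auto)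
    show "AE s in lborel. norm (indicator {0..X n} s *\<^sub>R S (max 0 (X n - s)) (F s)) \<le> M * norm (F s)" for n
      using S_bounded M by (intro AE_I2) (auto simp: indicator_def)
    show "AE s in lborel. (\<lambda>n. indicator {0..X n} s *\<^sub>R S (max 0 (X n - s)) (F s))
        \<longlonglongrightarrow> indicator {0..t} s *\<^sub>R S (max 0 (t - s)) (F s)"
    proof (rule AE_mp[OF AE_lborel_singleton[of t]], rule AE_I2, rule impI)
      fix s assume s: "s \<noteq> t"
      have "continuous_on UNIV (\<lambda>r. S (max 0 (r - s)) (F s))"
        by (rule S_continuous_compose) (auto intro!: continuous_intros)
      then have c: "(\<lambda>n. S (max 0 (X n - s)) (F s)) \<longlonglongrightarrow> S (max 0 (t - s)) (F s)"
        using lim isCont_tendsto_compose[of t "\<lambda>r. S (max 0 (r - s)) (F s)" X]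
        by (simp add: continuous_on_eq_continuous_at)
      have "(\<lambda>n. indicat_real {0..X n} s) \<longlonglongrightarrow> indicator {0..t} s"
      proof (rule tendsto_eventually)
        show "eventually (\<lambda>n. indicat_real {0..X n} s = indicator {0..t} s) sequentially"
          using order_tendstoD(1)[OF lim, of s] order_tendstoD(2)[OF lim, of s] s
          by (cases "s < t") (auto elim!: eventually_mono simp: indicator_def)
      qed
      then show "(\<lambda>n. indicator {0..X n} s *\<^sub>R S (max 0 (X n - s)) (F s))
        \<longlonglongrightarrow> indicator {0..t} s *\<^sub>R S (max 0 (t - s)) (F s)"
        using c by (rule tendsto_scaleR)
    qed
  qed
  then show "(\<lambda>n. duhamel f (X n)) \<longlonglongrightarrow> duhamel f t"
    using eq X T t tT by auto
qed

end

section \<open>Semilinear evolution equations with delay\<close>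

text \<open>
  The forcing of an evolution equation with delay: \<open>\<phi>\<close> is the prescribed value of the delayed term up to
  time \<open>\<tau>\<close>, \<open>C\<close> the delayed linear operator and \<open>N\<close> the nonlinearity.
\<close>

definition delayed_rhs ::
    "(real \<Rightarrow> real) \<Rightarrow> real \<Rightarrow> (real \<Rightarrow> 'x) \<Rightarrow> ('x \<Rightarrow> 'x) \<Rightarrow> ('x \<Rightarrow> 'x) \<Rightarrow> (real \<Rightarrow> 'x) \<Rightarrow> real \<Rightarrow> 'x::real_vector" where
  "delayed_rhs k \<tau> \<phi> C N U s = - k s *\<^sub>R (if s \<le> \<tau> then \<phi> s else C (U (s - \<tau>))) + N (U s)"

lemma set_integrable_delayed_rhs:
  fixes \<phi> U :: "real \<Rightarrow> 'x::{banach, second_countable_topology}"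
  assumes k: "set_integrable lborel {0..t} k" and U: "continuous_on {0..t} U"
    and \<phi>: "continuous_on {0..\<tau>} \<phi>" and "0 < \<tau>" "0 \<le> t"
    and C: "bounded_linear C" and N: "continuous_on (U ` {0..t}) N"
  shows "set_integrable lborel {0..t} (delayed_rhs k \<tau> \<phi> C N U)"
proof -
  have "set_integrable lborel {0..t} (\<lambda>s. - k s *\<^sub>R (if s \<le> \<tau> then \<phi> s else C (U (s - \<tau>))))"
    by (rule set_integrable_delayed[where y = "\<lambda>s. C (U s)"])
      (use assms set_integrable_mult_right[of "-1" lborel "{0..t}" k] in \<open>auto intro: bounded_linear.continuous_on\<close>)
  moreover have "set_integrable lborel {0..t} (\<lambda>s. N (U s))"
    by (rule borel_integrable_atLeastAtMost') (rule continuous_on_compose2[OF N U], simp)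
  ultimately show ?thesis unfolding delayed_rhs_def by (rule set_integral_add)
qed

context decaying_semigroup
begin

text \<open>
  The estimate behind boundedness and contraction in the space with weight \<open>exp (- l t)\<close>. Against that
  weight, the part of \<open>f\<close> proportional to \<open>|k|\<close> costs \<open>2 K p\<close> by \<open>weighted_window_bound\<close>, and the bounded
  part costs \<open>q / l\<close>.
\<close>

lemma duhamel_weighted_bound:
  assumes k: "\<And>t. 0 \<le> t \<Longrightarrow> set_integrable lborel {0..t} k"
    and K: "\<And>t. 0 < t \<Longrightarrow> (LBINT s:{max 0 (t - \<tau>)..t}. \<bar>k s\<bar>) \<le> K"
    and "0 < \<tau>" "0 < l" "exp (- (l * \<tau>)) \<le> 1 / 2" "0 \<le> t"
    and "0 \<le> p" "0 \<le> q" and f: "set_integrable lborel {0..t} f"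
    and le: "\<And>s. s \<in> {0..t} \<Longrightarrow> norm (f s) \<le> exp (l * s) * (p * \<bar>k s\<bar> + q)"
  shows "exp (- (l * t)) * norm (duhamel f t) \<le> M * (2 * K * p + q / l)"
proof -
  define e where "e s = exp (- (l * (t - s)))" for s
  have i1: "set_integrable lborel {0..t} (\<lambda>s. e s * \<bar>k s\<bar>)"
    using set_integrable_scaleR_continuous[OF set_integrable_abs[OF k[OF \<open>0 \<le> t\<close>]], of e]
    by (simp add: e_def mult.commute continuous_on_exp continuous_on_mult continuous_on_minus continuous_on_diff)
  have i2: "set_integrable lborel {0..t} e"
    unfolding e_def by (intro borel_integrable_atLeastAtMost' continuous_on_exp continuous_intros)
  have le1: "(LBINT s:{0..t}. e s * \<bar>k s\<bar>) \<le> 2 * K"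
    unfolding e_def by (rule weighted_window_bound[OF k K]) (use assms in auto)
  have "(e has_integral (e t / l - e 0 / l)) {0..t}"
    using \<open>0 \<le> t\<close> \<open>0 < l\<close> unfolding e_def
    by (intro fundamental_theorem_of_calculus)
      (auto intro!: derivative_eq_intros simp: has_real_derivative_iff_has_vector_derivative[symmetric])
  then have "(LBINT s:{0..t}. e s) = e t / l - e 0 / l"
    using set_borel_integral_eq_integral(2)[OF i2] by (simp add: integral_unique)
  then have le2: "(LBINT s:{0..t}. e s) \<le> 1 / l"
    using \<open>0 < l\<close> by (simp add: e_def)
  define g where "g s = exp (l * t) * M * (p * (e s * \<bar>k s\<bar>) + q * e s)" for s
  have "norm (duhamel f t) \<le> (LBINT s:{0..t}. g s)"
  proof (rule duhamel_norm[OF f])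
    show "set_integrable lborel {0..t} g"
      unfolding g_def using i1 i2 by (intro set_integrable_mult_right set_integral_add(1))
    fix s assume s: "s \<in> {0..t}"
    have "M * exp (- \<omega> * (t - s)) * norm (f s) \<le> M * 1 * norm (f s)"
      using M \<omega> s by (intro mult_right_mono mult_left_mono) auto
    also have "\<dots> \<le> M * 1 * (exp (l * s) * (p * \<bar>k s\<bar> + q))"
      using M by (intro mult_left_mono le s) auto
    also have "\<dots> = g s"
      by (simp add: g_def e_def exp_minus exp_diff algebra_simps)
    finally show "M * exp (- \<omega> * (t - s)) * norm (f s) \<le> g s" .
  qed
  also have "\<dots> = exp (l * t) * M * (p * (LBINT s:{0..t}. e s * \<bar>k s\<bar>) + q * (LBINT s:{0..t}. e s))"
    unfolding g_def using i1 i2 by (simp add: set_integral_add(2))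
  also have "\<dots> \<le> exp (l * t) * M * (p * (2 * K) + q * (1 / l))"
    using M \<open>0 \<le> p\<close> \<open>0 \<le> q\<close> le1 le2 by (intro mult_left_mono add_mono) auto
  finally have "exp (- (l * t)) * norm (duhamel f t) \<le> exp (- (l * t)) * (exp (l * t) * M * (p * (2 * K)
      + q * (1 / l)))"
    by (intro mult_left_mono) auto
  also have "\<dots> = M * (2 * K * p + q / l)"
    by (simp add: exp_minus field_simps)
  finally show ?thesis .
qed

text \<open>
  After multiplication by \<open>exp (- l t)\<close> the equation is a fixed point problem in the Banach space of
  bounded continuous functions on the line. For large \<open>l\<close> both contributions to the contraction constant are
  small: the nonlinearity contributes \<open>L / l\<close>, and the delayed term contributes a multiple of
  \<open>exp (- l \<tau>)\<close>, because the integral of \<open>|k|\<close> over every window of length \<open>\<tau>\<close> is bounded.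
\<close>

lemma delayed_evolution_exists:
  assumes k: "\<And>t. 0 \<le> t \<Longrightarrow> set_integrable lborel {0..t} k"
    and K: "\<And>t. 0 < t \<Longrightarrow> (LBINT s:{max 0 (t - \<tau>)..t}. \<bar>k s\<bar>) \<le> K"
    and "0 < \<tau>" and \<phi>: "continuous_on {0..\<tau>} \<phi>"
    and C: "bounded_linear C"
    and N: "\<And>y z. norm (N y - N z) \<le> L * norm (y - z)" and N0: "N 0 = 0"
  shows "\<exists>U. continuous_on {0..} U \<and> (\<forall>t\<ge>0. U t = S t x + duhamel (delayed_rhs k \<tau> \<phi> C N U) t)"
proof -
  interpret C: bounded_linear C by fact
  obtain c where c: "0 < c" "\<And>y. norm (C y) \<le> norm y * c" using C.pos_bounded by blast
  \<comment> \<open>In the trivial space the hypothesis on \<open>N\<close> allows a negative \<open>L\<close>.\<close>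
  define L' where "L' = max L 0"
  have L'0: "0 \<le> L'" by (simp add: L'_def)
  have N': "norm (N y - N z) \<le> L' * norm (y - z)" for y z
    unfolding L'_def by (rule order_trans[OF N mult_right_mono[OF max.cobounded1]]) simp
  have "L'-lipschitz_on UNIV N"
    by (rule lipschitz_onI) (use N' L'0 in \<open>auto simp: dist_norm\<close>)
  then have Nc: "continuous_on UNIV N" by (rule lipschitz_on_continuous_on)
  have K0: "0 \<le> K" using order_trans[OF set_integral_nonneg K[of 1]] by auto
  have "filterlim (\<lambda>l. l * \<tau>) at_top at_top"
    by (rule filterlim_at_top_mult_tendsto_pos[OF tendsto_const \<open>0 < \<tau>\<close> filterlim_ident])
  then have e0: "((\<lambda>l. exp (- (l * \<tau>))) \<longlongrightarrow> 0) at_top"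
    by (intro filterlim_compose[OF exp_at_bot]) (simp add: filterlim_uminus_at_top)
  have "((\<lambda>l. L' / l) \<longlongrightarrow> 0) at_top"
    by (rule tendsto_divide_0[OF tendsto_const filterlim_at_top_imp_at_infinity[OF filterlim_ident]])
  then have "((\<lambda>l. M * (2 * K * (c * exp (- (l * \<tau>))) + L' / l)) \<longlongrightarrow> M * (2 * K * (c * 0) + 0)) at_top"
    by (intro tendsto_intros e0)
  then have "eventually (\<lambda>l. M * (2 * K * (c * exp (- (l * \<tau>))) + L' / l) < 1 / 2) at_top"
    by (rule order_tendstoD) simp
  moreover have "eventually (\<lambda>l. exp (- (l * \<tau>)) < 1 / 2) at_top"
    by (rule order_tendstoD[OF e0]) simp
  moreover have "eventually (\<lambda>l::real. 0 < l) at_top" by (rule eventually_gt_at_top)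
  ultimately have "eventually (\<lambda>l. 0 < l \<and> exp (- (l * \<tau>)) \<le> 1 / 2
      \<and> M * (2 * K * (c * exp (- (l * \<tau>))) + L' / l) \<le> 1 / 2) at_top"
    by eventually_elim auto
  then obtain l where l: "0 < l" "exp (- (l * \<tau>)) \<le> 1 / 2" "M * (2 * K * (c * exp (- (l * \<tau>))) + L' / l) \<le> 1 / 2"
    using eventually_happens'[OF trivial_limit_at_top_linorder] by blast
  have "bounded (\<phi> ` {0..\<tau>})"
    using compact_continuous_image[OF \<phi>] compact_imp_bounded by blast
  then obtain Q' where Q': "\<And>s. s \<in> {0..\<tau>} \<Longrightarrow> norm (\<phi> s) \<le> Q'" unfolding bounded_iff by fast
  define Q where "Q = max Q' 0"
  have Q: "0 \<le> Q" "\<And>s. s \<in> {0..\<tau>} \<Longrightarrow> norm (\<phi> s) \<le> Q"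
    unfolding Q_def using Q' by (auto intro: order_trans[OF _ max.cobounded1])
  \<comment> \<open>\<open>Z\<close> is the weighted unknown and \<open>W Z\<close> the unknown itself.\<close>
  define W where "W Z s = exp (l * s) *\<^sub>R apply_bcontfun Z s" for Z :: "real \<Rightarrow>\<^sub>C 'x" and s :: real
  define f where "f Z = delayed_rhs k \<tau> \<phi> C N (W Z)" for Z
  have Wc: "continuous_on A (W Z)" for A Z
    unfolding W_def by (intro continuous_on_scaleR continuous_on_exp continuous_intros) (auto intro:
        continuous_on_subset[OF continuous_on_apply_bcontfun])
  have fi: "set_integrable lborel {0..t} (f Z)" if "0 \<le> t" for t Z
    unfolding f_def
    by (rule set_integrable_delayed_rhs[OF k[OF that] Wc \<phi> \<open>0 < \<tau>\<close> that C]) (rule continuous_on_subset[OF Nc], simp)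
  define \<Phi> where "\<Phi> Z t = exp (- (l * max 0 t)) *\<^sub>R (S (max 0 t) x + duhamel (f Z) (max 0 t))" for Z and t :: real
  have \<Phi>_contr: "dist (\<Phi> Z t) (\<Phi> Z' t) \<le> 1 / 2 * dist Z Z'" for Z Z' t
  proof -
    define r where "r = max 0 t"
    have r: "0 \<le> r" by (simp add: r_def)
    have Wd: "norm (W Z s - W Z' s) \<le> exp (l * s) * dist Z Z'" for s
      unfolding W_def using dist_bounded[of Z s Z']
      by (simp add: scaleR_diff_right[symmetric] dist_norm[symmetric])
    have "exp (- (l * r)) * norm (duhamel (\<lambda>s. f Z s - f Z' s) r)
        \<le> M * (2 * K * (c * exp (- (l * \<tau>)) * dist Z Z') + (L' * dist Z Z') / l)"
    proof (rule duhamel_weighted_bound[OF k K \<open>0 < \<tau>\<close> l(1,2) r _ _ set_integral_diff(1)[OF fi[OF r] fi[OF r]]])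
      fix s assume s: "s \<in> {0..r}"
      have "norm (if s \<le> \<tau> then 0 else C (W Z (s - \<tau>) - W Z' (s - \<tau>)))
          \<le> exp (l * s) * (c * exp (- (l * \<tau>)) * dist Z Z')"
      proof (cases "s \<le> \<tau>")
        case False
        have "norm (C (W Z (s - \<tau>) - W Z' (s - \<tau>))) \<le> (exp (l * (s - \<tau>)) * dist Z Z') * c"
          using order_trans[OF c(2) mult_right_mono[OF Wd]] c(1) by simp
        also have "\<dots> = exp (l * s) * (c * exp (- (l * \<tau>)) * dist Z Z')"
          by (simp add: right_diff_distrib exp_diff exp_minus field_simps)
        finally show ?thesis using False by simp
      qed (use c in auto)
      then have "\<bar>k s\<bar> * norm (if s \<le> \<tau> then 0 else C (W Z (s - \<tau>) - W Z' (s - \<tau>)))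
          \<le> \<bar>k s\<bar> * (exp (l * s) * (c * exp (- (l * \<tau>)) * dist Z Z'))"
        by (intro mult_left_mono) auto
      moreover have "norm (N (W Z s) - N (W Z' s)) \<le> L' * (exp (l * s) * dist Z Z')"
        using order_trans[OF N' mult_left_mono[OF Wd L'0]] by simp
      moreover have "f Z s - f Z' s = - k s *\<^sub>R (if s \<le> \<tau> then 0 else C (W Z (s - \<tau>) - W Z' (s - \<tau>)))
          + (N (W Z s) - N (W Z' s))"
        unfolding f_def delayed_rhs_def by (simp add: C.diff scaleR_diff_right)
      then have "norm (f Z s - f Z' s) \<le> \<bar>k s\<bar> * norm (if s \<le> \<tau> then 0 else C (W Z (s - \<tau>) - W Z' (s - \<tau>)))
          + norm (N (W Z s) - N (W Z' s))"
        by (metis norm_triangle_ineq norm_scaleR abs_minus_cancel)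
      ultimately show "norm (f Z s - f Z' s) \<le> exp (l * s) * (c * exp (- (l * \<tau>)) * dist Z Z' * \<bar>k s\<bar>
          + L' * dist Z Z')"
        by (simp add: algebra_simps)
    qed (use c L'0 in auto)
    also have "\<dots> = M * (2 * K * (c * exp (- (l * \<tau>))) + L' / l) * dist Z Z'"
      by (simp add: algebra_simps)
    also have "\<dots> \<le> 1 / 2 * dist Z Z'" by (rule mult_right_mono[OF l(3)]) simp
    finally show ?thesis
      unfolding \<Phi>_def r_def[symmetric]
      by (simp add: dist_norm scaleR_diff_right[symmetric] duhamel_diff[OF fi[OF r] fi[OF r]])
  qed
  have \<Phi>_zero: "norm (\<Phi> 0 t) \<le> M * norm x + M * (2 * K * Q + 0 / l)" for t
  proof -
    define r where "r = max 0 t"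
    have r: "0 \<le> r" by (simp add: r_def)
    have "exp (- (l * r)) * norm (duhamel (f 0) r) \<le> M * (2 * K * Q + 0 / l)"
    proof (rule duhamel_weighted_bound[OF k K \<open>0 < \<tau>\<close> l(1,2) r _ _ fi[OF r]])
      fix s assume s: "s \<in> {0..r}"
      have "norm (f 0 s) \<le> \<bar>k s\<bar> * Q"
        using Q s by (auto simp: f_def delayed_rhs_def W_def C.zero N0 intro: mult_left_mono)
      also have "\<dots> \<le> exp (l * s) * (\<bar>k s\<bar> * Q)"
        using mult_right_mono[of 1 "exp (l * s)" "\<bar>k s\<bar> * Q"] s l(1) Q(1) by simp
      finally show "norm (f 0 s) \<le> exp (l * s) * (Q * \<bar>k s\<bar> + 0)" by (simp add: mult.commute)
    qed (use Q in auto)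
    moreover have "exp (- (l * r)) * norm (S r x) \<le> 1 * (M * norm x)"
      using S_bounded[OF r] r l(1) by (intro mult_mono) auto
    moreover have "norm (\<Phi> 0 t) \<le> exp (- (l * r)) * norm (S r x) + exp (- (l * r)) * norm (duhamel (f 0) r)"
      unfolding \<Phi>_def r_def[symmetric] by (simp add: distrib_left[symmetric] norm_triangle_ineq)
    ultimately show ?thesis by simp
  qed
  have \<Phi>_bound: "norm (\<Phi> Z t) \<le> 1 / 2 * dist Z 0 + (M * norm x + M * (2 * K * Q + 0 / l))" for Z t
    using \<Phi>_contr[of Z t 0] \<Phi>_zero[of t] norm_triangle_sub[of "\<Phi> Z t" "\<Phi> 0 t"] by (simp add: dist_norm)
  have \<Phi>_cont: "continuous_on UNIV (\<Phi> Z)" for Z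
  proof -
    have "continuous_on UNIV (\<lambda>t::real. max 0 t)" by (intro continuous_on_max continuous_on_const continuous_on_id)
    then show ?thesis
      unfolding \<Phi>_def
      by (intro continuous_on_scaleR continuous_on_add S_continuous_compose continuous_on_exp continuous_on_minus
            continuous_on_mult continuous_on_const continuous_on_compose2[OF duhamel_continuous[OF fi]]
                subset_UNIV) (auto simp: max_def)
  qed
  define \<Psi> where "\<Psi> Z = Bcontfun (\<Phi> Z)" for Z
  have \<Psi>: "apply_bcontfun (\<Psi> Z) = \<Phi> Z" for Z
    unfolding \<Psi>_def
    by (rule Bcontfun_inverse) (use \<Phi>_cont \<Phi>_bound in \<open>auto simp: bcontfun_def bounded_iff\<close>)
  have contr: "dist (\<Psi> Z) (\<Psi> Z') \<le> 1 / 2 * dist Z Z'" for Z Z'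
    by (rule dist_bound) (use \<Phi>_contr in \<open>simp add: \<Psi>\<close>)
  obtain Z where Z: "\<Psi> Z = Z"
    using banach_fix_type[of "1/2" \<Psi>] contr by auto
  have "W Z t = S t x + duhamel (delayed_rhs k \<tau> \<phi> C N (W Z)) t" if "0 \<le> t" for t
  proof -
    have "apply_bcontfun Z t = \<Phi> Z t" using \<Psi>[of Z] Z by simp
    then show ?thesis using that by (simp add: W_def[of Z t] \<Phi>_def f_def exp_minus)
  qed
  then show ?thesis using Wc by blast
qed

text \<open>
  The function \<open>y s = exp (\<omega> s) * norm (W s)\<close> satisfies the delayed Gronwall inequality: the factor
  \<open>exp (\<omega> t)\<close> cancels the decay of the semigroup in the Duhamel integral, and in the delayed term
  \<open>exp (\<omega> s) * norm (W (s - \<tau>))\<close> equals \<open>exp (\<omega> \<tau>) * y (s - \<tau>)\<close>. The delayed data on \<open>[0, \<tau>]\<close> only enter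
  the constant \<open>D\<close>. Applied to a solution the estimate gives decay, applied to a difference of two
  solutions it gives uniqueness.
\<close>

lemma delayed_duhamel_decay:
  assumes T: "0 \<le> T" and k: "\<And>t. 0 \<le> t \<Longrightarrow> set_integrable lborel {0..t} k"
    and "0 < \<tau>" and p: "continuous_on {0..\<tau>} p" "\<And>s. s \<in> {0..\<tau>} \<Longrightarrow> 0 \<le> p s"
    and c: "0 \<le> c" and e: "0 \<le> e"
    and W: "continuous_on {0..T} W" and f: "set_integrable lborel {0..T} f"
    and eq: "\<And>t. t \<in> {0..T} \<Longrightarrow> W t = S t x + duhamel f t"
    and le: "\<And>s. s \<in> {0..T} \<Longrightarrow>
      norm (f s) \<le> \<bar>k s\<bar> * (if s \<le> \<tau> then p s else c * norm (W (s - \<tau>))) + e * norm (W s)"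
  shows "norm (W T) \<le> M * (norm x + exp (\<omega> * \<tau>) * (LBINT s:{0..\<tau>}. \<bar>k s\<bar> * p s))
      * exp (c * M * exp (\<omega> * \<tau>) * (LBINT s:{0..T}. \<bar>k (s + \<tau>)\<bar>)) * exp (- (\<omega> - M * e) * T)"
proof -
  define y where "y s = exp (\<omega> * s) * norm (W s)" for s
  define P where "P s = M * c * exp (\<omega> * \<tau>) * \<bar>k s\<bar>" for s
  define d where "d s = \<bar>k s\<bar> *\<^sub>R (if s \<le> \<tau> then exp (\<omega> * s) * p s else 0)" for s
  define h where "h s = P s *\<^sub>R (if s \<le> \<tau> then 0 else y (s - \<tau>))" for s
  define D where "D = (LBINT s:{0..\<tau>}. \<bar>k s\<bar> * p s)"
  have yc: "continuous_on {0..r} y" if "r \<le> T" for r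
    unfolding y_def using that
    by (intro continuous_on_mult continuous_on_exp continuous_on_norm continuous_on_subset[OF W]
        continuous_on_const continuous_on_id) auto
  have y0: "0 \<le> y s" for s by (simp add: y_def)
  have ki: "set_integrable lborel {0..r} (\<lambda>s. \<bar>k s\<bar>)" if "0 \<le> r" for r
    by (rule set_integrable_abs[OF k[OF that]])
  have Pi: "set_integrable lborel {0..r} P" if "0 \<le> r" for r
    unfolding P_def by (intro set_integrable_mult_right ki that)
  have di: "set_integrable lborel {0..r} d" if "0 \<le> r" for r
    unfolding d_def
    by (rule set_integrable_delayed[where y = "\<lambda>_. 0"])
      (use that \<open>0 < \<tau>\<close> in \<open>auto intro!: ki continuous_on_mult continuous_on_exp p continuous_on_const
          continuous_on_id\<close>)
  have hi: "set_integrable lborel {0..r} h" if "0 \<le> r" "r \<le> T" for r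
    unfolding h_def
    by (rule set_integrable_delayed[where \<phi> = "\<lambda>_. 0"]) (use that \<open>0 < \<tau>\<close> Pi yc in auto)
  have Di: "set_integrable lborel {0..\<tau>} (\<lambda>s. \<bar>k s\<bar> * p s)"
    using set_integrable_scaleR_continuous[OF ki p(1)] \<open>0 < \<tau>\<close> by simp
  have "(LBINT s:{0..r}. d s) \<le> (LBINT s:{0..\<tau>}. exp (\<omega> * \<tau>) * (\<bar>k s\<bar> * p s))" for r
    unfolding set_lebesgue_integral_def
  proof (rule integral_mono')
    show "integrable lborel (\<lambda>s. indicat_real {0..\<tau>} s *\<^sub>R (exp (\<omega> * \<tau>) * (\<bar>k s\<bar> * p s)))"
      using set_integrable_mult_right[OF Di] by (simp add: set_integrable_def)
    fix s
    show "0 \<le> indicat_real {0..\<tau>} s *\<^sub>R (exp (\<omega> * \<tau>) * (\<bar>k s\<bar> * p s))"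
      using p(2)[of s] by (auto simp: indicator_def)
    show "indicat_real {0..r} s *\<^sub>R d s \<le> indicat_real {0..\<tau>} s *\<^sub>R (exp (\<omega> * \<tau>) * (\<bar>k s\<bar> * p s))"
    proof (cases "s \<in> {0..\<tau>}")
      case True
      have "indicat_real {0..r} s *\<^sub>R d s \<le> d s" using True p(2)[of s] by (auto simp: indicator_def d_def)
      also have "d s = exp (\<omega> * s) * (\<bar>k s\<bar> * p s)" using True by (simp add: d_def)
      also have "\<dots> \<le> exp (\<omega> * \<tau>) * (\<bar>k s\<bar> * p s)"
        using True \<omega> p(2)[of s] by (intro mult_right_mono mult_nonneg_nonneg) auto
      finally show ?thesis using True by simp
    qed (auto simp: indicator_def d_def)
  qed
  then have dle: "(LBINT s:{0..r}. d s) \<le> exp (\<omega> * \<tau>) * D" for r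
    by (simp add: D_def)
  have D0: "0 \<le> D" unfolding D_def by (rule set_integral_nonneg) (use p in auto)
  have ineq: "y r \<le> M * (norm x + exp (\<omega> * \<tau>) * D) + (LBINT s:{0..r}. P s * (if s \<le> \<tau> then 0 else y (s - \<tau>)))
      + (LBINT s:{0..r}. (M * e) * y s)" if r: "r \<in> {0..T}" for r
  proof -
    have r0: "0 \<le> r" and rT: "r \<le> T" using r by auto
    have fr: "set_integrable lborel {0..r} f" by (rule set_integrable_subset[OF f]) (use rT in auto)
    have yi: "set_integrable lborel {0..r} (\<lambda>s. (M * e) * y s)"
      by (intro borel_integrable_atLeastAtMost' continuous_on_mult continuous_on_const yc rT)
    have "norm (duhamel f r) \<le> (LBINT s:{0..r}. exp (- (\<omega> * r)) * ((M * d s + h s) + (M * e) * y s))"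
    proof (rule duhamel_norm[OF fr])
      show "set_integrable lborel {0..r} (\<lambda>s. exp (- (\<omega> * r)) * ((M * d s + h s) + (M * e) * y s))"
        by (intro set_integrable_mult_right set_integral_add(1) di hi yi r0 rT)
      fix s assume s: "s \<in> {0..r}"
      have sT: "s \<in> {0..T}" using s rT by auto
      have "exp (\<omega> * s) * norm (f s) \<le> exp (\<omega> * s) * (\<bar>k s\<bar> * (if s
          \<le> \<tau> then p s else c * norm (W (s - \<tau>))) + e * norm (W s))"
        by (intro mult_left_mono le[OF sT]) auto
      also have "\<dots> = d s + (c * exp (\<omega> * \<tau>) * \<bar>k s\<bar>) * (if s \<le> \<tau> then 0 else y (s - \<tau>)) + e * y s"
        by (simp add: d_def y_def right_diff_distrib exp_diff algebra_simps)
      finally have "M * (exp (\<omega> * s) * norm (f s)) \<le> M * (d s + (c * exp (\<omega> * \<tau>) * \<bar>k s\<bar>) * (if s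
          \<le> \<tau> then 0 else y (s - \<tau>)) + e * y s)"
        using M by (intro mult_left_mono) auto
      also have "\<dots> = M * d s + h s + (M * e) * y s" by (simp add: h_def P_def algebra_simps)
      finally have "exp (- (\<omega> * r)) * (M * (exp (\<omega> * s) * norm (f s)))
          \<le> exp (- (\<omega> * r)) * (M * d s + h s + (M * e) * y s)"
        by (intro mult_left_mono) auto
      moreover have "exp (- (\<omega> * r)) * (M * (exp (\<omega> * s) * norm (f s))) = M * exp (- \<omega> * (r - s)) * norm (f s)"
        by (simp add: mult_exp_exp[symmetric] right_diff_distrib exp_diff exp_minus field_simps)
      ultimately show "M * exp (- \<omega> * (r - s)) * norm (f s) \<le> exp (- (\<omega> * r)) * (M * d s + h s + (M * e) * y s)"
        by simp
    qed
    also have "\<dots> = exp (- (\<omega> * r)) * (M * (LBINT s:{0..r}. d s) + (LBINT s:{0..r}. h s)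
        + (LBINT s:{0..r}. (M * e) * y s))"
      using set_integral_add(2)[OF set_integral_add(1)[OF set_integrable_mult_right[OF di[OF r0], of M] hi[OF r0
          rT]] yi]
        set_integral_add(2)[OF set_integrable_mult_right[OF di[OF r0], of M] hi[OF r0 rT]]
      by (simp only: set_integral_mult_right)
    finally have cv: "exp (\<omega> * r) * norm (duhamel f r)
        \<le> M * (LBINT s:{0..r}. d s) + (LBINT s:{0..r}. h s) + (LBINT s:{0..r}. (M * e) * y s)"
      by (simp add: exp_minus field_simps)
    have "exp (\<omega> * r) * norm (S r x) \<le> exp (\<omega> * r) * (M * exp (- \<omega> * r) * norm x)"
      by (intro mult_left_mono decay r0) auto
    also have "\<dots> = M * norm x" by (simp add: exp_minus)
    finally have sx: "exp (\<omega> * r) * norm (S r x) \<le> M * norm x" .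
    have "y r \<le> exp (\<omega> * r) * (norm (S r x) + norm (duhamel f r))"
      unfolding y_def eq[OF r] by (intro mult_left_mono norm_triangle_ineq) auto
    moreover have "M * (LBINT s:{0..r}. d s) \<le> M * (exp (\<omega> * \<tau>) * D)"
      using M by (intro mult_left_mono dle) auto
    ultimately have "y r \<le> M * norm x + (M * (exp (\<omega> * \<tau>) * D) + (LBINT s:{0..r}. h s)
        + (LBINT s:{0..r}. (M * e) * y s))"
      using sx cv unfolding distrib_left by linarith
    then show ?thesis by (simp add: h_def distrib_left)
  qed
  have "y T \<le> M * (norm x + exp (\<omega> * \<tau>) * D) * exp ((LBINT s:{0..T}. P (s + \<tau>)) + (M * e) * T)"
    by (rule delayed_gronwall[OF T \<open>0 < \<tau>\<close> Pi _ _ yc[OF order_refl] y0 ineq])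
       (use T \<open>0 < \<tau>\<close> M c e in \<open>auto simp: P_def\<close>)
  then have "exp (- (\<omega> * T)) * y T
      \<le> exp (- (\<omega> * T)) * (M * (norm x + exp (\<omega> * \<tau>) * D) * exp ((LBINT s:{0..T}. P (s + \<tau>)) + (M * e) * T))"
    by (intro mult_left_mono) auto
  moreover have "(LBINT s:{0..T}. P (s + \<tau>)) = c * M * exp (\<omega> * \<tau>) * (LBINT s:{0..T}. \<bar>k (s + \<tau>)\<bar>)"
    by (simp add: P_def mult_ac)
  moreover have "exp (- (\<omega> * T)) * y T = norm (W T)" by (simp add: y_def exp_minus)
  moreover have "exp (- (\<omega> * T)) * (z * exp (q + (M * e) * T)) = z * exp q * exp (- (\<omega> - M * e) * T)" for z q
    by (simp add: mult_exp_exp algebra_simps)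
  ultimately show ?thesis unfolding D_def by simp
qed

lemma delayed_evolution_decay:
  assumes k: "\<And>t. 0 \<le> t \<Longrightarrow> set_integrable lborel {0..t} k"
    and "0 < \<tau>" and \<phi>: "continuous_on {0..\<tau>} \<phi>"
    and C: "bounded_linear C" and c: "0 \<le> c" "\<And>y. norm (C y) \<le> c * norm y"
    and N: "continuous_on UNIV N" and e: "0 \<le> e" "\<And>y. norm (N y) \<le> e * norm y"
    and U: "continuous_on {0..} U"
    and eq: "\<And>t. 0 \<le> t \<Longrightarrow> U t = S t x + duhamel (delayed_rhs k \<tau> \<phi> C N U) t"
    and growth: "\<And>t. 0 \<le> t \<Longrightarrow> c * M * exp (\<omega> * \<tau>) * (LBINT s:{0..t}. \<bar>k (s + \<tau>)\<bar>) \<le> \<gamma> + \<omega>' * t"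
    and t: "0 \<le> t"
  shows "norm (U t) \<le> M * (norm x + exp (\<omega> * \<tau>) * (LBINT s:{0..\<tau>}. \<bar>k s\<bar> * norm (\<phi> s)))
      * exp \<gamma> * exp (- (\<omega> - \<omega>' - M * e) * t)"
proof -
  define f where "f = delayed_rhs k \<tau> \<phi> C N U"
  define D where "D = (LBINT s:{0..\<tau>}. \<bar>k s\<bar> * norm (\<phi> s))"
  have Uc: "continuous_on {0..t} U" by (rule continuous_on_subset[OF U]) auto
  have fi: "set_integrable lborel {0..t} f"
    unfolding f_def
    by (rule set_integrable_delayed_rhs[OF k[OF t] Uc \<phi> \<open>0 < \<tau>\<close> t C continuous_on_subset[OF N subset_UNIV]])
  have "norm (U t) \<le> M * (norm x + exp (\<omega> * \<tau>) * D)
      * exp (c * M * exp (\<omega> * \<tau>) * (LBINT s:{0..t}. \<bar>k (s + \<tau>)\<bar>)) * exp (- (\<omega> - M * e) * t)"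
    unfolding D_def
  proof (rule delayed_duhamel_decay[OF t k \<open>0 < \<tau>\<close> continuous_on_norm[OF \<phi>] norm_ge_zero c(1) e(1) Uc fi])
    show "U s = S s x + duhamel f s" if "s \<in> {0..t}" for s
      unfolding f_def by (rule eq) (use that in simp)
    show "norm (f s) \<le> \<bar>k s\<bar> * (if s \<le> \<tau> then norm (\<phi> s) else c * norm (U (s - \<tau>))) + e * norm (U s)" for s
    proof -
      have "norm (f s) \<le> \<bar>k s\<bar> * norm (if s \<le> \<tau> then \<phi> s else C (U (s - \<tau>))) + norm (N (U s))"
        unfolding f_def delayed_rhs_def by (rule order_trans[OF norm_triangle_ineq]) simp
      also have "\<dots> \<le> \<bar>k s\<bar> * (if s \<le> \<tau> then norm (\<phi> s) else c * norm (U (s - \<tau>))) + e * norm (U s)"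
        using c(2)[of "U (s - \<tau>)"] by (intro add_mono mult_left_mono e) auto
      finally show ?thesis .
    qed
  qed
  also have "\<dots> \<le> M * (norm x + exp (\<omega> * \<tau>) * D) * exp (\<gamma> + \<omega>' * t) * exp (- (\<omega> - M * e) * t)"
  proof (intro mult_right_mono mult_left_mono)
    have "0 \<le> D" unfolding D_def by (rule set_integral_nonneg) simp
    then show "0 \<le> M * (norm x + exp (\<omega> * \<tau>) * D)" using M by simp
  qed (use growth[OF t] in auto)
  also have "\<dots> = M * (norm x + exp (\<omega> * \<tau>) * D) * exp \<gamma> * exp (- (\<omega> - \<omega>' - M * e) * t)"
    by (simp add: mult.assoc mult_exp_exp algebra_simps)
  finally show ?thesis by (simp add: D_def)
qed

text \<open>
  The Lipschitz condition is only required on a set \<open>Y\<close> that contains both solutions, since a source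
  that is Lipschitz on bounded sets is compared along two given continuous solutions.
\<close>

lemma delayed_evolution_unique:
  assumes "0 \<le> T" and k: "\<And>t. 0 \<le> t \<Longrightarrow> set_integrable lborel {0..t} k"
    and "0 < \<tau>" and \<phi>: "continuous_on {0..\<tau>} \<phi>"
    and C: "bounded_linear C"
    and N: "\<And>y z. y \<in> Y \<Longrightarrow> z \<in> Y \<Longrightarrow> norm (N y - N z) \<le> L * norm (y - z)" and "0 \<le> L"
    and U: "continuous_on {0..T} U" "U ` {0..T} \<subseteq> Y"
    and V: "continuous_on {0..T} V" "V ` {0..T} \<subseteq> Y"
    and eqU: "\<And>t. t \<in> {0..T} \<Longrightarrow> U t = S t x + duhamel (delayed_rhs k \<tau> \<phi> C N U) t"
    and eqV: "\<And>t. t \<in> {0..T} \<Longrightarrow> V t = S t x + duhamel (delayed_rhs k \<tau> \<phi> C N V) t"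
  shows "U T = V T"
proof -
  interpret C: bounded_linear C by fact
  obtain c where c: "0 < c" "\<And>y. norm (C y) \<le> norm y * c" using C.pos_bounded by blast
  define F where "F = delayed_rhs k \<tau> \<phi> C N"
  have "L-lipschitz_on Y N"
    by (rule lipschitz_onI) (use N \<open>0 \<le> L\<close> in \<open>auto simp: dist_norm\<close>)
  then have Nc: "continuous_on Y N" by (rule lipschitz_on_continuous_on)
  have Fi: "set_integrable lborel {0..r} (F W)"
    if r: "r \<in> {0..T}" and W: "continuous_on {0..T} W" "W ` {0..T} \<subseteq> Y" for r W
  proof -
    have "W ` {0..r} \<subseteq> Y" using r W(2) by auto
    moreover have "continuous_on {0..r} W" by (rule continuous_on_subset[OF W(1)]) (use r in auto)
    ultimately show ?thesis
      unfolding F_def using r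
      by (intro set_integrable_delayed_rhs k \<phi> \<open>0 < \<tau>\<close> C continuous_on_subset[OF Nc]) auto
  qed
  have "norm (U T - V T) \<le> M * (norm (0 :: 'x) + exp (\<omega> * \<tau>) * (LBINT s:{0..\<tau>}. \<bar>k s\<bar> * 0))
      * exp (c * M * exp (\<omega> * \<tau>) * (LBINT s:{0..T}. \<bar>k (s + \<tau>)\<bar>)) * exp (- (\<omega> - M * L) * T)"
  proof (rule delayed_duhamel_decay[where W = "\<lambda>s. U s - V s" and f = "\<lambda>s. F U s - F V s",
        OF \<open>0 \<le> T\<close> k \<open>0 < \<tau>\<close> continuous_on_const order_refl less_imp_le[OF c(1)] \<open>0 \<le> L\<close>])
    show "set_integrable lborel {0..T} (\<lambda>s. F U s - F V s)"
      using \<open>0 \<le> T\<close> by (intro set_integral_diff(1) Fi U V) auto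
    show "U r - V r = S r 0 + duhamel (\<lambda>s. F U s - F V s) r" if "r \<in> {0..T}" for r
      using eqU[OF that] eqV[OF that] duhamel_diff[OF Fi[OF that U] Fi[OF that V]] that linear_S[of r]
      by (simp add: F_def bounded_linear.linear linear_0)
    fix s assume s: "s \<in> {0..T}"
    have "F U s - F V s = - k s *\<^sub>R (if s \<le> \<tau> then 0 else C (U (s - \<tau>) - V (s - \<tau>))) + (N (U s) - N (V s))"
      unfolding F_def delayed_rhs_def by (simp add: C.diff scaleR_diff_right)
    then have "norm (F U s - F V s) \<le> \<bar>k s\<bar> * norm (if s
        \<le> \<tau> then 0 else C (U (s - \<tau>) - V (s - \<tau>))) + norm (N (U s) - N (V s))"
      by (metis norm_triangle_ineq norm_scaleR abs_minus_cancel)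
    also have "\<dots> \<le> \<bar>k s\<bar> * (if s \<le> \<tau> then 0 else c * norm (U (s - \<tau>) - V (s - \<tau>))) + L * norm (U s - V s)"
      using c(2)[of "U (s - \<tau>) - V (s - \<tau>)"] U(2) V(2) s
      by (intro add_mono mult_left_mono N) (auto simp: mult.commute)
    finally show "norm (F U s - F V s) \<le> \<bar>k s\<bar> * (if s \<le> \<tau> then 0 else c * norm (U (s - \<tau>) - V (s - \<tau>)))
        + L * norm (U s - V s)" .
  qed (auto intro: continuous_on_diff U V)
  then show ?thesis by simp
qed

end

section \<open>Integrated mild solutions and the generator\<close>

context decaying_semigroup
begin

text \<open>
  The integral of an orbit over \<open>[0, a]\<close>. The averages \<open>orbit_integral h y / h\<close> tend to \<open>y\<close>, commute with
  the semigroup, and are the standard means to reach the domain of the generator.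
\<close>

definition orbit_integral :: "real \<Rightarrow> 'x \<Rightarrow> 'x" where
  "orbit_integral a y = (LBINT r:{0..a}. S r y)"

lemma S_set_integrable: "0 \<le> a \<Longrightarrow> set_integrable lborel {a..b} (\<lambda>r. S r y)"
  by (rule borel_integrable_atLeastAtMost') (rule continuous_on_subset[OF S_continuous], auto)

lemma orbit_integral_bounded: "0 \<le> h \<Longrightarrow> norm (orbit_integral h y) \<le> M * h * norm y"
  unfolding orbit_integral_def
  by (rule order_trans[OF norm_set_integral_le[OF S_set_integrable, where g = "\<lambda>_. M * norm y"]])
     (auto intro: S_bounded borel_integrable_atLeastAtMost' simp: set_integral_const)

lemma bounded_linear_orbit_integral: "0 \<le> h \<Longrightarrow> bounded_linear (orbit_integral h)"
proof (rule bounded_linear_intro)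
  assume h: "0 \<le> h"
  fix y z c
  show "orbit_integral h (y + z) = orbit_integral h y + orbit_integral h z"
    unfolding orbit_integral_def set_integral_add(2)[OF S_set_integrable S_set_integrable, OF order_refl
        order_refl, symmetric]
    by (rule set_lebesgue_integral_cong) (auto simp: linear_S bounded_linear.linear linear_add)
  show "orbit_integral h (c *\<^sub>R y) = c *\<^sub>R orbit_integral h y"
    unfolding orbit_integral_def set_integral_scaleR_right[symmetric]
    by (rule set_lebesgue_integral_cong) (auto simp: linear_S bounded_linear.linear linear_scale)
  show "norm (orbit_integral h y) \<le> norm y * (M * h)"
    using orbit_integral_bounded[OF h] by (simp add: mult_ac)
qed

lemma orbit_integral_average_tendsto: "((\<lambda>h. (1 / h) *\<^sub>R orbit_integral h y) \<longlongrightarrow> y) (at_right 0)"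
proof (rule tendstoI)
  fix e :: real assume e: "0 < e"
  have "((\<lambda>h. S h y) \<longlongrightarrow> y) (at_right 0)" using semigroup by (simp add: C0_semigroup_def)
  then have "eventually (\<lambda>h. dist (S h y) y < e / 2) (at_right 0)" using e by (intro tendstoD) auto
  then obtain d where d: "0 < d" "\<And>h. 0 < h \<Longrightarrow> h < d \<Longrightarrow> dist (S h y) y < e / 2"
    unfolding eventually_at_right_field by auto
  have "dist ((1 / h) *\<^sub>R orbit_integral h y) y < e" if h: "0 < h" "h < d" for h
  proof -
    have i: "set_integrable lborel {0..h} (\<lambda>r. y)" by (rule borel_integrable_atLeastAtMost') auto
    have "norm (orbit_integral h y - h *\<^sub>R y) = norm (LBINT r:{0..h}. S r y - y)"
      using h set_integral_diff(2)[OF S_set_integrable i] by (simp add: orbit_integral_def set_integral_const)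
    also have "\<dots> \<le> (LBINT r:{0..h}. e / 2)"
    proof (rule norm_set_integral_le)
      show "set_integrable lborel {0..h} (\<lambda>r. S r y - y)"
        by (rule set_integral_diff(1)[OF S_set_integrable i]) simp
      show "set_integrable lborel {0..h} (\<lambda>r. e / 2)"
        by (rule borel_integrable_atLeastAtMost') auto
      show "norm (S s y - y) \<le> e / 2" if "s \<in> {0..h}" for s
        using d(2)[of s] that h e by (cases "s = 0") (auto simp: dist_norm)
    qed
    also have "\<dots> = h * (e / 2)" using h by (simp add: set_integral_const)
    finally have "norm ((1 / h) *\<^sub>R (orbit_integral h y - h *\<^sub>R y)) \<le> (1 / h) * (h * (e / 2))"
      unfolding norm_scaleR using h by (intro mult_mono) auto
    then show ?thesis using h e by (simp add: dist_norm scaleR_diff_right)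
  qed
  then show "eventually (\<lambda>h. dist ((1 / h) *\<^sub>R orbit_integral h y) y < e) (at_right 0)"
    unfolding eventually_at_right_field using d(1) by auto
qed

text \<open>
  Both sides are the integral of the orbit over \<open>[a, a + h]\<close> minus the integral over \<open>[0, h]\<close>. The identity
  moves the difference quotient of the generator from the long orbit integral to a short one.
\<close>

lemma orbit_integral_commute:
  assumes "0 \<le> h" "0 \<le> a"
  shows "S h (orbit_integral a y) - orbit_integral a y = S a (orbit_integral h y) - orbit_integral h y"
proof -
  have Sorbit_integral: "S h (orbit_integral a y) = (LBINT r:{h..a + h}. S r y)" if "0 \<le> h" "0 \<le> a" for h a
  proof -
    have "S h (orbit_integral a y) = (LBINT r:{0..a}. S h (S r y))"
      unfolding orbit_integral_def
      by (rule set_integral_bounded_linear(2)[OF linear_S[OF that(1)] S_set_integrable, symmetric]) simp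
    also have "\<dots> = (LBINT r:{0..a}. S (r + h) y)"
      by (rule set_lebesgue_integral_cong) (use that S_plus[of h] in \<open>auto simp: add.commute\<close>)
    also have "\<dots> = (LBINT r:{0 + h..a + h}. S r y)" by (rule set_integral_shift[symmetric])
    finally show ?thesis by simp
  qed
  have "orbit_integral h y + S h (orbit_integral a y) = (LBINT r:{0..a + h}. S r y)"
    unfolding Sorbit_integral[OF assms] unfolding orbit_integral_def
    by (rule set_integral_split[symmetric, OF S_set_integrable]) (use assms in auto)
  also have "\<dots> = orbit_integral a y + S a (orbit_integral h y)"
    unfolding Sorbit_integral[OF assms(2,1)] unfolding orbit_integral_def add.commute[of h a]
    by (rule set_integral_split[OF S_set_integrable]) (use assms in auto)
  finally show ?thesis by (simp add: algebra_simps)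
qed

text \<open>
  Fubini on the triangle \<open>0 \<le> s \<le> r \<le> t\<close>.
\<close>

lemma integral_duhamel:
  assumes "0 \<le> t" and f: "set_integrable lborel {0..t} f"
  shows "set_integrable lborel {0..t} (\<lambda>s. orbit_integral (t - s) (f s))"
    and "(LBINT r:{0..t}. duhamel f r) = (LBINT s:{0..t}. orbit_integral (t - s) (f s))"
proof -
  define F where "F s = indicator {0..t} s *\<^sub>R f s" for s
  have F: "integrable lborel F" using f unfolding set_integrable_def F_def .
  define H where "H s r = indicator {(s, r). 0 \<le> s \<and> s \<le> r \<and> r \<le> t} (s, r) *\<^sub>R S (max 0 (r - s)) (F s)" for s r
  have set: "{(s, r). 0 \<le> s \<and> s \<le> r \<and> r \<le> t} \<in> sets (borel \<Otimes>\<^sub>M borel)"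
    unfolding borel_prod
    by (intro borel_closed) (simp add: case_prod_unfold closed_Collect_conj closed_Collect_le continuous_intros)
  have Fm: "(\<lambda>p. F (fst p)) \<in> borel_measurable (lborel \<Otimes>\<^sub>M lborel)"
    using F by (intro measurable_compose[OF measurable_fst]) auto
  have Hm: "case_prod H \<in> borel_measurable (lborel \<Otimes>\<^sub>M lborel)"
  proof -
    have "(\<lambda>p. indicator {(s, r). 0 \<le> s \<and> s \<le> r \<and> r \<le> t} p *\<^sub>R S (max 0 (snd p - fst p)) (F (fst p)))
        \<in> borel_measurable (lborel \<Otimes>\<^sub>M lborel)"
      by (intro borel_measurable_scaleR borel_measurable_indicator S_measurable Fm borel_measurable_diff)
         (use set in \<open>auto cong: sets_pair_measure_cong\<close>)
    then show ?thesis by (simp add: H_def case_prod_unfold)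
  qed
  have Hint: "integrable (lborel \<Otimes>\<^sub>M lborel) (case_prod H)"
  proof (rule Bochner_Integration.integrable_bound)
    show "integrable (lborel \<Otimes>\<^sub>M lborel) (\<lambda>p. norm (F (fst p)) * (M * indicator {0..t} (snd p)))"
    proof (rule lborel_pair.Fubini_integrable)
      show "(\<lambda>p. norm (F (fst p)) * (M * indicator {0..t} (snd p))) \<in> borel_measurable (lborel \<Otimes>\<^sub>M lborel)"
        using measurable_compose[OF Fm, of norm borel]
        by (intro borel_measurable_times borel_measurable_const measurable_compose[OF measurable_snd]) auto
      show "integrable lborel (\<lambda>x. LBINT y. norm (norm (F (fst (x, y))) * (M * indicator {0..t} (snd (x, y)))))"
        using F by (simp add: abs_mult)
    next
      have "integrable lborel (indicat_real {0..t})"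
        by (intro integrable_real_indicator) (auto simp: emeasure_lborel_Icc_eq)
      then show "AE x in lborel. integrable lborel (\<lambda>y. norm (F (fst (x, y))) * (M * indicator {0..t} (snd (x, y))))"
        by (intro AE_I2) simp
    qed
    show "AE p in lborel \<Otimes>\<^sub>M lborel. norm (case_prod H p) \<le> norm (norm (F (fst p)) * (M * indicator {0..t} (snd p)))"
      using S_bounded M by (intro AE_I2) (auto simp: H_def abs_mult indicator_def mult.commute)
  qed (rule Hm)
  have duhamel: "(LBINT s. H s r) = indicator {0..t} r *\<^sub>R duhamel f r" for r
    unfolding duhamel_def set_lebesgue_integral_def integral_scaleR_right[symmetric]
    by (rule Bochner_Integration.integral_cong) (auto simp: H_def F_def indicator_def)
  have theta: "(LBINT r. H s r) = indicator {0..t} s *\<^sub>R orbit_integral (t - s) (f s)" for s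
  proof (cases "s \<in> {0..t}")
    case True
    have "(LBINT r. H s r) = (LBINT r:{0 + s..(t - s) + s}. S (r - s) (f s))"
      unfolding set_lebesgue_integral_def
      by (rule Bochner_Integration.integral_cong) (use True in \<open>auto simp: H_def F_def indicator_def\<close>)
    also have "\<dots> = orbit_integral (t - s) (f s)" unfolding set_integral_shift by (simp add: orbit_integral_def)
    finally show ?thesis using True by simp
  next
    case False
    then have "H s = (\<lambda>r. 0)" by (intro ext) (auto simp: H_def)
    then show ?thesis using False by simp
  qed
  show "set_integrable lborel {0..t} (\<lambda>s. orbit_integral (t - s) (f s))"
    unfolding set_integrable_def theta[symmetric]
    using lborel_pair.integrable_fst'[OF Hint] by simp
  show "(LBINT r:{0..t}. duhamel f r) = (LBINT s:{0..t}. orbit_integral (t - s) (f s))"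
    using lborel_pair.Fubini_integral[OF Hint]
    unfolding set_lebesgue_integral_def duhamel[symmetric] theta[symmetric] .
qed

text \<open>
  By \<open>integral_duhamel\<close>, \<open>\<integral>\<^sub>0\<^sup>t U\<close> is an orbit integral of \<open>x\<close> plus a superposition of orbit integrals of the
  values \<open>f s\<close>. By \<open>orbit_integral_commute\<close> its difference quotient is the mild solution formula with
  \<open>x\<close> and \<open>f\<close> replaced by their averages over \<open>[0, h]\<close>, minus the averages of \<open>x\<close> and of \<open>f\<close> themselves.
  Dominated convergence gives the limit \<open>U t - x - \<integral>\<^sub>0\<^sup>t f\<close>.
\<close>

lemma mild_solution_integral_in_generator:
  assumes t: "0 \<le> t" and f: "\<And>t. 0 \<le> t \<Longrightarrow> set_integrable lborel {0..t} f"
    and U: "\<And>r. 0 \<le> r \<Longrightarrow> U r = S r x + duhamel f r"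
  shows "(LBINT r:{0..t}. U r, U t - x - (LBINT s:{0..t}. f s)) \<in> generator_graph S"
proof -
  define W where "W = (LBINT r:{0..t}. U r)"
  define A where "A h = (\<lambda>y. (1 / h) *\<^sub>R orbit_integral h y)" for h
  note ft = f[OF t]
  have Alin: "bounded_linear (A h)" if "0 < h" for h
    unfolding A_def using that
        by (intro bounded_linear_scaleR_right[THEN bounded_linear_compose] bounded_linear_orbit_integral) auto
  have Abd: "norm (A h y) \<le> M * norm y" if "0 < h" for h y
    unfolding A_def using orbit_integral_bounded[of h y] that by (simp add: field_simps)
  have W: "W = orbit_integral t x + (LBINT s:{0..t}. orbit_integral (t - s) (f s))"
  proof -
    have "W = (LBINT r:{0..t}. S r x + duhamel f r)"
      unfolding W_def by (rule set_lebesgue_integral_cong) (use U in auto)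
    also have "\<dots> = orbit_integral t x + (LBINT r:{0..t}. duhamel f r)"
      unfolding orbit_integral_def
      by (rule set_integral_add(2)[OF S_set_integrable borel_integrable_atLeastAtMost'[OF continuous_on_subset[OF
          duhamel_continuous[OF f]]]]) auto
    finally show ?thesis by (simp add: integral_duhamel(2)[OF t ft])
  qed
  have quot: "(S h W - W) /\<^sub>R h = (S t (A h x) - A h x) + (LBINT s:{0..t}. S (t - s) (A h (f s)) - A h (f s))"
    if h: "0 < h" for h
  proof -
    have h0: "0 \<le> h" using h by simp
    interpret Sh: bounded_linear "S h" by (rule linear_S[OF h0])
    have "S h W - W = (S h (orbit_integral t x) - orbit_integral t x)
        + (LBINT s:{0..t}. S h (orbit_integral (t - s) (f s)) - orbit_integral (t - s) (f s))"
      unfolding W Sh.add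
      using set_integral_diff(2)[OF set_integral_bounded_linear(1)[OF linear_S[OF h0] integral_duhamel(1)[OF t
          ft]] integral_duhamel(1)[OF t ft]]
        set_integral_bounded_linear(2)[OF linear_S[OF h0] integral_duhamel(1)[OF t ft]]
      by simp
    also have "(LBINT s:{0..t}. S h (orbit_integral (t - s) (f s)) - orbit_integral (t - s) (f s))
        = (LBINT s:{0..t}. S (t - s) (orbit_integral h (f s)) - orbit_integral h (f s))"
      by (rule set_lebesgue_integral_cong) (use orbit_integral_commute[OF h0] in auto)
    also have "S h (orbit_integral t x) - orbit_integral t x = S t (orbit_integral h x) - orbit_integral h x"
        by (rule orbit_integral_commute[OF h0 t])
    finally have "(S h W - W) /\<^sub>R h = (1 / h) *\<^sub>R (S t (orbit_integral h x) - orbit_integral h x)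
        + (LBINT s:{0..t}. (1 / h) *\<^sub>R (S (t - s) (orbit_integral h (f s)) - orbit_integral h (f s)))"
      by (simp add: scaleR_add_right inverse_eq_divide)
    also have "(1 / h) *\<^sub>R (S t (orbit_integral h x) - orbit_integral h x) = S t (A h x) - A h x"
      using linear_S[OF t] by (simp add: A_def scaleR_diff_right bounded_linear.linear linear_scale)
    also have "(LBINT s:{0..t}. (1 / h) *\<^sub>R (S (t - s) (orbit_integral h (f s)) - orbit_integral h (f s)))
        = (LBINT s:{0..t}. S (t - s) (A h (f s)) - A h (f s))"
      by (rule set_lebesgue_integral_cong)
         (auto simp: A_def scaleR_diff_right linear_S bounded_linear.linear linear_scale)
    finally show ?thesis .
  qed
  have "((\<lambda>h. (S h W - W) /\<^sub>R h) \<longlongrightarrow> (S t x - x) + (LBINT s:{0..t}. S (t - s) (f s) - f s)) (at_right 0)"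
    unfolding tendsto_at_iff_sequentially
  proof safe
    fix X :: "nat \<Rightarrow> real" assume X: "\<forall>i. X i \<in> {0<..} - {0}" "X \<longlonglongrightarrow> 0"
    have Xp: "0 < X i" for i using X by auto
    have AX: "(\<lambda>i. A (X i) y) \<longlonglongrightarrow> y" for y
      using orbit_integral_average_tendsto[of y, unfolded tendsto_at_iff_sequentially] X
          by (auto simp: A_def comp_def)
    have SAX: "(\<lambda>i. S r (A (X i) y)) \<longlonglongrightarrow> S r y" if "0 \<le> r" for r y
      by (rule bounded_linear.tendsto[OF linear_S[OF that] AX])
    have "(\<lambda>i. LBINT s:{0..t}. S (t - s) (A (X i) (f s)) - A (X i) (f s))
        \<longlonglongrightarrow> (LBINT s:{0..t}. S (t - s) (f s) - f s)"
      unfolding set_lebesgue_integral_def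
    proof (rule integral_dominated_convergence)
      show "integrable lborel (\<lambda>s. (M * M + M) * norm (indicator {0..t} s *\<^sub>R f s))"
        using ft by (simp add: set_integrable_def del: norm_scaleR)
      show "(\<lambda>s. indicator {0..t} s *\<^sub>R (S (t - s) (f s) - f s)) \<in> borel_measurable lborel"
        using set_integral_diff(1)[OF duhamel_integrable[OF ft] ft] unfolding set_integrable_def
        by (rule borel_measurable_integrable)
      show "(\<lambda>s. indicator {0..t} s *\<^sub>R (S (t - s) (A (X i) (f s)) - A (X i) (f s))) \<in> borel_measurable lborel" for i
      proof -
        note Af = set_integral_bounded_linear(1)[OF Alin[OF Xp] ft]
        show ?thesis
          using set_integral_diff(1)[OF duhamel_integrable[OF Af] Af] unfolding set_integrable_def
          by (rule borel_measurable_integrable)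
      qed
      show "AE s in lborel. norm (indicator {0..t} s *\<^sub>R (S (t - s) (A (X i) (f s)) - A (X i) (f s)))
          \<le> (M * M + M) * norm (indicator {0..t} s *\<^sub>R f s)" for i
      proof (rule AE_I2)
        fix s
        have "norm (S (t - s) (A (X i) (f s)) - A (X i) (f s)) \<le> (M * M + M) * norm (f s)" if "s \<in> {0..t}"
        proof -
          have "norm (S (t - s) (A (X i) (f s))) \<le> M * (M * norm (f s))"
            using order_trans[OF S_bounded mult_left_mono[OF Abd[OF Xp]]] that M by auto
          then show ?thesis
            using norm_triangle_ineq4[of "S (t - s) (A (X i) (f s))" "A (X i) (f s)"] Abd[OF Xp, of i "f s"]
            by (simp add: algebra_simps)
        qed
        then show "norm (indicator {0..t} s *\<^sub>R (S (t - s) (A (X i) (f s)) - A (X i) (f s)))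
          \<le> (M * M + M) * norm (indicator {0..t} s *\<^sub>R f s)" by (auto simp: indicator_def)
      qed
      show "AE s in lborel. (\<lambda>i. indicator {0..t} s *\<^sub>R (S (t - s) (A (X i) (f s)) - A (X i) (f s)))
          \<longlonglongrightarrow> indicator {0..t} s *\<^sub>R (S (t - s) (f s) - f s)"
      proof (rule AE_I2)
        fix s
        show "(\<lambda>i. indicator {0..t} s *\<^sub>R (S (t - s) (A (X i) (f s)) - A (X i) (f s)))
          \<longlonglongrightarrow> indicator {0..t} s *\<^sub>R (S (t - s) (f s) - f s)"
          by (cases "s \<in> {0..t}") (auto intro!: tendsto_diff SAX AX)
      qed
    qed
    then have "(\<lambda>i. (S t (A (X i) x) - A (X i) x) + (LBINT s:{0..t}. S (t - s) (A (X i) (f s)) - A (X i) (f s)))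
        \<longlonglongrightarrow> (S t x - x) + (LBINT s:{0..t}. S (t - s) (f s) - f s)"
      by (intro tendsto_add tendsto_diff SAX AX t)
    then show "((\<lambda>h. (S h W - W) /\<^sub>R h) \<circ> X) \<longlonglongrightarrow> (S t x - x) + (LBINT s:{0..t}. S (t - s) (f s) - f s)"
      by (simp add: comp_def quot[OF Xp])
  qed
  also have "(LBINT s:{0..t}. S (t - s) (f s) - f s) = duhamel f t - (LBINT s:{0..t}. f s)"
    unfolding duhamel_def by (rule set_integral_diff(2)[OF duhamel_integrable[OF ft] ft])
  finally show ?thesis
    by (simp add: generator_graph_def W_def[symmetric] U[OF t] algebra_simps)
qed

end

section \<open>The phase space with memory\<close>

lemma linear_operator_zero: "linear_operator_on D A \<Longrightarrow> A 0 = 0"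
  unfolding linear_operator_on_def by (metis scaleR_zero_left subspace_0)

locale memory_phase_space =
  fixes D V :: "'h::{real_inner, banach, second_countable_topology} set" and A R :: "'h \<Rightarrow> 'h"
    and \<mu> :: "real \<Rightarrow> real"
    and J :: "'h \<times> 'h \<times> (real \<Rightarrow> 'h) \<Rightarrow> 'x::{real_inner, banach, second_countable_topology}"
  assumes A: "positive_self_adjoint D A" and A_inv: "compact_inverse D A"
    and root: "square_root_operator D A V R"
    and kernel: "memory_kernel \<mu>"
    and phase: "phase_space V R \<mu> J"
begin

lemma linear_R: "linear_operator_on V R"
  using root by (simp add: square_root_operator_def positive_self_adjoint_def self_adjoint_operator_def)

lemma subspace_V: "subspace V" using linear_R by (simp add: linear_operator_on_def)

lemma R_simps:
  "x \<in> V \<Longrightarrow> y \<in> V \<Longrightarrow> R (x + y) = R x + R y"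
  "x \<in> V \<Longrightarrow> R (c *\<^sub>R x) = c *\<^sub>R R x"
  "R 0 = 0"
  "x \<in> V \<Longrightarrow> R (- x) = - R x"
  "x \<in> V \<Longrightarrow> y \<in> V \<Longrightarrow> R (x - y) = R x - R y"
proof -
  have add: "R (x + y) = R x + R y" if "x \<in> V" "y \<in> V" for x y
    using linear_R that by (simp add: linear_operator_on_def)
  have sc: "R (c *\<^sub>R x) = c *\<^sub>R R x" if "x \<in> V" for x c
    using linear_R that by (simp add: linear_operator_on_def)
  show "x \<in> V \<Longrightarrow> y \<in> V \<Longrightarrow> R (x + y) = R x + R y" "x \<in> V \<Longrightarrow> R (c *\<^sub>R x) = c *\<^sub>R R x" "R 0 = 0"
    using add sc linear_operator_zero[OF linear_R] by auto
  have neg: "R (- x) = - R x" if "x \<in> V" for x using sc[OF that, of "-1"] by simp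
  then show "x \<in> V \<Longrightarrow> R (- x) = - R x" .
  show "x \<in> V \<Longrightarrow> y \<in> V \<Longrightarrow> R (x - y) = R x - R y"
    using add[of x "- y"] neg[of y] subspace_neg[OF subspace_V] by simp
qed

lemma R_symmetric:
  assumes "x \<in> V" "y \<in> V" shows "R x \<bullet> y = x \<bullet> R y"
  using root assms unfolding square_root_operator_def positive_self_adjoint_def self_adjoint_operator_def by blast

definition A_inverse :: "'h \<Rightarrow> 'h" where "A_inverse = inv_into D A"

lemma A_inverse: "A_inverse x \<in> D" "A (A_inverse x) = x"
proof -
  have "A ` D = UNIV" using A_inv by (simp add: compact_inverse_def bij_betw_def)
  then show "A_inverse x \<in> D" "A (A_inverse x) = x"
    unfolding A_inverse_def by (auto intro: inv_into_into f_inv_into_f)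
qed

lemma A_inverse_bounded: "\<exists>K\<ge>0. \<forall>x. norm (A_inverse x) \<le> K * norm x"
proof -
  have "bounded (inv_into D A ` cball 0 1)"
    using A_inv unfolding compact_inverse_def
    by (meson bounded_cball bounded_subset closure_subset compact_imp_bounded)
  then obtain K where K: "\<And>x. norm x \<le> 1 \<Longrightarrow> norm (A_inverse x) \<le> K"
    unfolding bounded_iff A_inverse_def by fastforce
  have lin: "linear_operator_on D A" using A by (simp add: positive_self_adjoint_def self_adjoint_operator_def)
  have inj: "inj_on A D" using A_inv by (simp add: compact_inverse_def bij_betw_def)
  have scale: "A_inverse (c *\<^sub>R x) = c *\<^sub>R A_inverse x" for c x
  proof (rule inj_onD[OF inj])
    show "A (A_inverse (c *\<^sub>R x)) = A (c *\<^sub>R A_inverse x)"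
      using lin A_inverse by (simp add: linear_operator_on_def)
    show "A_inverse (c *\<^sub>R x) \<in> D" by (rule A_inverse)
    show "c *\<^sub>R A_inverse x \<in> D" using lin A_inverse(1)[of x] by (simp add: linear_operator_on_def subspace_scale)
  qed
  have "norm (A_inverse x) \<le> K * norm x" for x
  proof (cases "x = 0")
    case True
    then show ?thesis using scale[of 0 0] by simp
  next
    case False
    have "norm (A_inverse ((1 / norm x) *\<^sub>R x)) \<le> K" by (rule K) (use False in simp)
    then show ?thesis using False unfolding scale by (simp add: field_simps)
  qed
  moreover have "0 \<le> K" using order_trans[OF norm_ge_zero K[of 0]] by simp
  ultimately show ?thesis by blast
qed

lemma D_subset: "D = {x \<in> V. R x \<in> V}" and A_eq: "x \<in> D \<Longrightarrow> A x = R (R x)"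
  using root by (auto simp: square_root_operator_def)

text \<open>
  The inverse of the square root \<open>R\<close>, written as \<open>A\<^sup>1\<^sup>/\<^sup>2 A\<^sup>-\<^sup>1\<close>.
\<close>

definition R_inv :: "'h \<Rightarrow> 'h" where "R_inv x = R (A_inverse x)"

lemma R_inv_in_V: "R_inv x \<in> V" and R_R_inv: "R (R_inv x) = x"
  using A_inverse[of x] A_eq[of "A_inverse x"] D_subset unfolding R_inv_def by auto

text \<open>
  \<open>R\<close> is symmetric and surjective, so its kernel is orthogonal to everything.
\<close>

lemma R_eq_zero: "v = 0" if "v \<in> V" "R v = 0"
proof -
  have "v \<bullet> v = v \<bullet> R (R_inv v)" by (simp add: R_R_inv)
  also have "\<dots> = R v \<bullet> R_inv v" by (rule R_symmetric[symmetric]) (use that R_inv_in_V in auto)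
  finally show ?thesis using that by simp
qed

lemma R_inject: "u = v" if "u \<in> V" "v \<in> V" "R u = R v"
proof -
  have "R (u - v) = 0" using that by (simp add: R_simps)
  moreover have "u - v \<in> V" using that subspace_diff[OF subspace_V] by blast
  ultimately show ?thesis using R_eq_zero[of "u - v"] by simp
qed

lemma R_inv_R: "v \<in> V \<Longrightarrow> R_inv (R v) = v"
  by (rule R_inject) (auto simp: R_inv_in_V R_R_inv)

text \<open>
  For \<open>y = R_inv x\<close> symmetry of \<open>R\<close> gives \<open>y \<bullet> y = A_inverse x \<bullet> x\<close>, and the inverse of \<open>A\<close> is bounded because
  it is compact. This is the Poincare inequality \<open>norm v \<le> const * norm (R v)\<close> on \<open>V\<close>.
\<close>

lemma bounded_linear_R_inv: "bounded_linear R_inv"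
proof -
  obtain K where K: "0 \<le> K" "\<And>x. norm (A_inverse x) \<le> K * norm x" using A_inverse_bounded by blast
  show ?thesis
  proof (rule bounded_linear_intro)
    show "R_inv (x + y) = R_inv x + R_inv y" for x y
      by (rule R_inject) (auto simp: R_inv_in_V R_R_inv R_simps subspace_add[OF subspace_V])
    show "R_inv (c *\<^sub>R x) = c *\<^sub>R R_inv x" for c x
      by (rule R_inject) (auto simp: R_inv_in_V R_R_inv R_simps subspace_scale[OF subspace_V])
    show "norm (R_inv x) \<le> norm x * sqrt K" for x
    proof -
      have "R_inv x \<bullet> R_inv x = R (A_inverse x) \<bullet> R_inv x" by (simp add: R_inv_def)
      also have "\<dots> = A_inverse x \<bullet> R (R_inv x)"
        using A_inverse(1)[of x] D_subset by (intro R_symmetric R_inv_in_V) auto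
      also have "\<dots> \<le> norm (A_inverse x) * norm x" unfolding R_R_inv by (rule norm_cauchy_schwarz)
      also have "\<dots> \<le> (K * norm x) * norm x" by (intro mult_right_mono K) auto
      finally have "(norm (R_inv x))\<^sup>2 \<le> (norm x * sqrt K)\<^sup>2"
        using K(1) by (simp add: dot_square_norm power_mult_distrib) (simp add: power2_eq_square mult_ac)
      then show ?thesis by (rule power2_le_imp_le) (use K(1) in simp)
    qed
  qed
qed

lemma \<mu>_nonneg: "0 \<le> s \<Longrightarrow> 0 \<le> \<mu> s"
  using kernel by (simp add: memory_kernel_def)

lemma \<mu>_continuous: "continuous_on {0..} \<mu>"
  using kernel by (simp add: memory_kernel_def)

lemma \<mu>_integrable: "set_integrable lborel {0<..} \<mu>"
  by (rule set_integrable_subset[of lborel "{0..}"]) (use kernel in \<open>auto simp: memory_kernel_def\<close>)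

lemma \<mu>_tilde: "0 < 1 - mu_tilde \<mu>"
  using kernel by (simp add: memory_kernel_def)

lemma \<mu>_decreasing: "\<mu> t \<le> \<mu> s" if "0 \<le> s" "s \<le> t"
proof (cases "s = t")
  case False
  obtain \<mu>' d where d: "0 < d" "\<And>s. 0 < s \<Longrightarrow> (\<mu> has_real_derivative \<mu>' s) (at s)" "\<And>s. 0 < s \<Longrightarrow> \<mu>' s \<le> - d * \<mu> s"
    using kernel unfolding memory_kernel_def by blast
  show ?thesis
  proof (rule DERIV_nonpos_imp_decreasing_open[of s t \<mu>])
    show "\<exists>y. (\<mu> has_real_derivative y) (at r) \<and> y \<le> 0" if "s < r" "r < t" for r
    proof (intro exI conjI)
      show "(\<mu> has_real_derivative \<mu>' r) (at r)" using d(2) that \<open>0 \<le> s\<close> by simp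
      have "- d * \<mu> r \<le> 0" using d(1) \<mu>_nonneg[of r] that \<open>0 \<le> s\<close> by simp
      then show "\<mu>' r \<le> 0" using d(3)[of r] that \<open>0 \<le> s\<close> by simp
    qed
    show "continuous_on {s..t} \<mu>" by (rule continuous_on_subset[OF \<mu>_continuous]) (use that in auto)
  qed (use that False in auto)
qed simp

text \<open>
  The points where \<open>\<mu>\<close> is positive form an interval that is open on the right, so that it is exhausted by
  intervals \<open>[0, s]\<close> on which \<open>\<mu>\<close> is bounded away from zero.
\<close>

lemma \<mu>_pos_room: "\<exists>r>s. 0 < \<mu> r" if "0 \<le> s" "0 < \<mu> s"
proof -
  have "(\<mu> \<longlongrightarrow> \<mu> s) (at s within {0..})" using \<mu>_continuous that by (simp add: continuous_on_def)
  then have "(\<mu> \<longlongrightarrow> \<mu> s) (at_right s)" by (rule tendsto_within_subset) (use that in auto)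
  then have "eventually (\<lambda>r. 0 < \<mu> r) (at_right s)" by (rule order_tendstoD) (use that in simp)
  then obtain b where "s < b" "\<And>r. s < r \<Longrightarrow> r < b \<Longrightarrow> 0 < \<mu> r"
    unfolding eventually_at_right_field by blast
  then show ?thesis using dense[of s b] by blast
qed

lemma L2muI:
  assumes "\<And>s. 0 < s \<Longrightarrow> w s \<in> V" "set_borel_measurable lborel {0<..} (\<lambda>s. R (w s))"
    and "set_integrable lborel {0<..} (\<lambda>s. \<mu> s * (norm (R (w s)))\<^sup>2)"
  shows "w \<in> L2mu V R \<mu>"
  using assms by (simp add: L2mu_def)

lemma L2mu_memory: "w \<in> L2mu V R \<mu> \<Longrightarrow> 0 < s \<Longrightarrow> w s \<in> V"
  and L2mu_measurable: "w \<in> L2mu V R \<mu> \<Longrightarrow> set_borel_measurable lborel {0<..} (\<lambda>s. R (w s))"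
  and L2mu_integrable: "w \<in> L2mu V R \<mu> \<Longrightarrow> set_integrable lborel {0<..} (\<lambda>s. \<mu> s * (norm (R (w s)))\<^sup>2)"
  by (auto simp: L2mu_def)

lemma weighted_square_integrable:
  fixes f g :: "real \<Rightarrow> 'h"
  assumes f: "set_borel_measurable lborel {0<..} f" "set_integrable lborel {0<..} (\<lambda>s. \<mu> s * (norm (f s))\<^sup>2)"
    and g: "set_borel_measurable lborel {0<..} g" "set_integrable lborel {0<..} (\<lambda>s. \<mu> s * (norm (g s))\<^sup>2)"
  shows "set_borel_measurable lborel {0<..} (\<lambda>s. f s + g s)"
    and "set_integrable lborel {0<..} (\<lambda>s. \<mu> s * (norm (f s + g s))\<^sup>2)"
proof -
  have m: "(\<lambda>s. indicator {0<..} s *\<^sub>R f s + indicator {0<..} s *\<^sub>R g s) \<in> borel_measurable lborel"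
    using f(1) g(1) unfolding set_borel_measurable_def by (rule borel_measurable_add)
  then show 1: "set_borel_measurable lborel {0<..} (\<lambda>s. f s + g s)"
    unfolding set_borel_measurable_def by (simp add: scaleR_add_right)
  have \<mu>m: "(\<lambda>s. indicator {0<..} s *\<^sub>R \<mu> s) \<in> borel_measurable lborel"
    using \<mu>_integrable unfolding set_integrable_def by (rule borel_measurable_integrable)
  show "set_integrable lborel {0<..} (\<lambda>s. \<mu> s * (norm (f s + g s))\<^sup>2)"
  proof (rule set_integrable_bound)
    show "set_integrable lborel {0<..} (\<lambda>s. 2 * (\<mu> s * (norm (f s))\<^sup>2) + 2 * (\<mu> s * (norm (g s))\<^sup>2))"
      by (intro set_integral_add(1) set_integrable_mult_right f g)
    have "(\<lambda>s. (indicator {0<..} s *\<^sub>R \<mu> s) * (norm (indicator {0<..} s *\<^sub>R f s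
        + indicator {0<..} s *\<^sub>R g s))\<^sup>2) \<in> borel_measurable lborel"
      by (intro borel_measurable_times \<mu>m borel_measurable_power measurable_compose[OF m borel_measurable_norm])
    then show "set_borel_measurable lborel {0<..} (\<lambda>s. \<mu> s * (norm (f s + g s))\<^sup>2)"
      unfolding set_borel_measurable_def
      by (rule measurable_cong[THEN iffD1, rotated]) (auto simp: indicator_def)
    show "AE s in lborel. s \<in> {0<..} \<longrightarrow> norm (\<mu> s * (norm (f s + g s))\<^sup>2)
        \<le> norm (2 * (\<mu> s * (norm (f s))\<^sup>2) + 2 * (\<mu> s * (norm (g s))\<^sup>2))"
    proof (intro AE_I2 impI)
      fix s :: real assume s: "s \<in> {0<..}"
      then have \<mu>s: "0 \<le> \<mu> s" using \<mu>_nonneg[of s] by simp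
      have "(norm (f s + g s))\<^sup>2 \<le> (norm (f s) + norm (g s))\<^sup>2"
        by (intro power_mono norm_triangle_ineq) auto
      also have "\<dots> \<le> 2 * (norm (f s))\<^sup>2 + 2 * (norm (g s))\<^sup>2"
        using sum_squares_bound[of "norm (f s)" "norm (g s)"] by (simp add: power2_sum)
      finally have "\<mu> s * (norm (f s + g s))\<^sup>2 \<le> \<mu> s * (2 * (norm (f s))\<^sup>2 + 2 * (norm (g s))\<^sup>2)"
        using \<mu>s by (rule mult_left_mono)
      then show "norm (\<mu> s * (norm (f s + g s))\<^sup>2)
        \<le> norm (2 * (\<mu> s * (norm (f s))\<^sup>2) + 2 * (\<mu> s * (norm (g s))\<^sup>2))"
        using \<mu>s by (simp add: algebra_simps)
    qed
  qed
qed

lemma L2mu_add: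
  assumes w: "w \<in> L2mu V R \<mu>" and z: "z \<in> L2mu V R \<mu>"
  shows "(\<lambda>s. w s + z s) \<in> L2mu V R \<mu>"
proof (rule L2muI)
  note sq = weighted_square_integrable[OF L2mu_measurable[OF w] L2mu_integrable[OF w] L2mu_measurable[OF z]
      L2mu_integrable[OF z]]
  have eq: "R (w s) + R (z s) = R (w s + z s)" if "s \<in> {0<..}" for s
    using that w z by (simp add: R_simps L2mu_memory)
  show "set_borel_measurable lborel {0<..} (\<lambda>s. R (w s + z s))"
    by (rule set_borel_measurable_cong_on[OF sq(1) eq])
  show "set_integrable lborel {0<..} (\<lambda>s. \<mu> s * (norm (R (w s + z s)))\<^sup>2)"
    using sq(2) by (rule set_integrable_cong[THEN iffD1, rotated -1]) (use eq in auto)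
qed (use w z in \<open>auto intro: subspace_add[OF subspace_V] L2mu_memory\<close>)

lemma L2mu_scale:
  assumes w: "w \<in> L2mu V R \<mu>" shows "(\<lambda>s. c *\<^sub>R w s) \<in> L2mu V R \<mu>"
proof (rule L2muI)
  have eq: "c *\<^sub>R R (w s) = R (c *\<^sub>R w s)" if "s \<in> {0<..}" for s
    using that w by (simp add: R_simps L2mu_memory)
  show "set_borel_measurable lborel {0<..} (\<lambda>s. R (c *\<^sub>R w s))"
    by (rule set_borel_measurable_cong_on[OF set_borel_measurable_scaleR[OF L2mu_measurable[OF w]] eq])
  show "set_integrable lborel {0<..} (\<lambda>s. \<mu> s * (norm (R (c *\<^sub>R w s)))\<^sup>2)"
    using set_integrable_mult_right[OF L2mu_integrable[OF w], of "c\<^sup>2"]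
    by (rule set_integrable_cong[THEN iffD1, rotated -1])
      (use w in \<open>auto simp: R_simps L2mu_memory power_mult_distrib\<close>)
qed (use w in \<open>auto intro: subspace_scale[OF subspace_V] L2mu_memory\<close>)

lemma L2mu_diff:
  assumes w: "w \<in> L2mu V R \<mu>" and z: "z \<in> L2mu V R \<mu>"
  shows "(\<lambda>s. w s - z s) \<in> L2mu V R \<mu>"
  using L2mu_add[OF w L2mu_scale[OF z, of "-1"]] by simp

lemma L2mu_const:
  assumes "v \<in> V" shows "(\<lambda>_. v) \<in> L2mu V R \<mu>"
proof (rule L2muI)
  show "set_borel_measurable lborel {0::real<..} (\<lambda>s. R v)"
    unfolding set_borel_measurable_def
        by (intro borel_measurable_scaleR borel_measurable_indicator) (auto simp: borel_open)
  show "set_integrable lborel {0<..} (\<lambda>s. \<mu> s * (norm (R v))\<^sup>2)"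
    by (rule set_integrable_mult_left) (use \<mu>_integrable in simp)
qed (use assms in auto)

lemma carrier_iff: "(u, v, w) \<in> phase_carrier V R \<mu> \<longleftrightarrow> u \<in> V \<and> w \<in> L2mu V R \<mu>"
  by (simp add: phase_carrier_def)

lemma J_add: "\<lbrakk>u \<in> V; w \<in> L2mu V R \<mu>; u' \<in> V; w' \<in> L2mu V R \<mu>\<rbrakk> \<Longrightarrow>
    J (u + u', v + v', \<lambda>s. w s + w' s) = J (u, v, w) + J (u', v', w')"
  using phase carrier_iff unfolding phase_space_def by blast

lemma J_scale: "\<lbrakk>u \<in> V; w \<in> L2mu V R \<mu>\<rbrakk> \<Longrightarrow> J (c *\<^sub>R u, c *\<^sub>R v, \<lambda>s. c *\<^sub>R w s) = c *\<^sub>R J (u, v, w)"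
  using phase carrier_iff unfolding phase_space_def by blast

lemma J_diff: 
  assumes "u \<in> V" "w \<in> L2mu V R \<mu>" "u' \<in> V" "w' \<in> L2mu V R \<mu>"
  shows "J (u - u', v - v', \<lambda>s. w s - w' s) = J (u, v, w) - J (u', v', w')"
  using J_add[OF assms(1,2) subspace_scale[OF subspace_V assms(3), of "-1"] L2mu_scale[OF assms(4), of "-1"], of
      v "- v'"]
    J_scale[OF assms(3,4), of "-1" v'] by simp

lemma J_norm:
  assumes "u \<in> V" "w \<in> L2mu V R \<mu>"
  shows "(norm (J (u, v, w)))\<^sup>2 = (1 - mu_tilde \<mu>) * (norm (R u))\<^sup>2 + (norm v)\<^sup>2
     + (LBINT s:{0<..}. \<mu> s * (norm (R (w s)))\<^sup>2)"
proof -
  have "J (u, v, w) \<bullet> J (u, v, w) = phase_inner R \<mu> (u, v, w) (u, v, w)"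
    using phase carrier_iff assms unfolding phase_space_def by blast
  then show ?thesis by (simp add: power2_norm_eq_inner)
qed

lemma memory_integral_nonneg: "0 \<le> (LBINT s:{0<..}. \<mu> s * (norm (R (w s)))\<^sup>2)"
  by (rule set_integral_nonneg) (simp add: \<mu>_nonneg)

lemma J_surj: obtains u v w where "u \<in> V" "w \<in> L2mu V R \<mu>" "x = J (u, v, w)"
proof -
  have "x \<in> J ` phase_carrier V R \<mu>" using phase by (simp add: phase_space_def)
  then show ?thesis using that by (auto simp: phase_carrier_def)
qed

text \<open>
  A triple of representatives is determined by its class in the first two components; in the third,
  the classes agree when the weighted distance is zero.
\<close>

lemma J_inject:
  assumes "u \<in> V" "w \<in> L2mu V R \<mu>" "u' \<in> V" "w' \<in> L2mu V R \<mu>" and eq: "J (u, v, w) = J (u', v', w')"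
  shows "u = u'" "v = v'" "(LBINT s:{0<..}. \<mu> s * (norm (R (w s - w' s)))\<^sup>2) = 0"
proof -
  have d: "u - u' \<in> V" "(\<lambda>s. w s - w' s) \<in> L2mu V R \<mu>"
    using assms L2mu_diff subspace_diff[OF subspace_V] by auto
  have "(1 - mu_tilde \<mu>) * (norm (R (u - u')))\<^sup>2 + (norm (v - v'))\<^sup>2
     + (LBINT s:{0<..}. \<mu> s * (norm (R (w s - w' s)))\<^sup>2) = 0"
    using J_norm[OF d, of "v - v'"] J_diff[OF assms(1-4), of v v'] eq by simp
  moreover have "0 \<le> (1 - mu_tilde \<mu>) * (norm (R (u - u')))\<^sup>2" using \<mu>_tilde by simp
  moreover note memory_integral_nonneg[of "\<lambda>s. w s - w' s"] zero_le_power2[of "norm (v - v')"]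
  ultimately have z: "(1 - mu_tilde \<mu>) * (norm (R (u - u')))\<^sup>2 = 0" "(norm (v - v'))\<^sup>2 = 0"
    "(LBINT s:{0<..}. \<mu> s * (norm (R (w s - w' s)))\<^sup>2) = 0"
    by linarith+
  then show "v = v'" "(LBINT s:{0<..}. \<mu> s * (norm (R (w s - w' s)))\<^sup>2) = 0" by auto
  have "R (u - u') = 0" using z(1) \<mu>_tilde by simp
  then show "u = u'" using R_eq_zero[OF d(1)] by simp
qed

text \<open>
  Chosen representatives. The maps \<open>position\<close> and \<open>velocity\<close> do not depend on the choice and are bounded
  linear; \<open>history\<close> is determined only up to the null functions of the weight.
\<close>

definition rep :: "'x \<Rightarrow> 'h \<times> 'h \<times> (real \<Rightarrow> 'h)" where
  "rep x = (SOME p. p \<in> phase_carrier V R \<mu> \<and> J p = x)"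

definition position :: "'x \<Rightarrow> 'h" where "position x = fst (rep x)"
definition velocity :: "'x \<Rightarrow> 'h" where "velocity x = fst (snd (rep x))"
definition history :: "'x \<Rightarrow> real \<Rightarrow> 'h" where "history x = snd (snd (rep x))"

lemma rep: "position x \<in> V" "history x \<in> L2mu V R \<mu>" "J (position x, velocity x, history x) = x"
proof -
  have "\<exists>p. p \<in> phase_carrier V R \<mu> \<and> J p = x"
    by (rule J_surj[of x]) (metis carrier_iff)
  then have "rep x \<in> phase_carrier V R \<mu> \<and> J (rep x) = x" unfolding rep_def by (rule someI_ex)
  then show "position x \<in> V" "history x \<in> L2mu V R \<mu>" "J (position x, velocity x, history x) = x"
    by (auto simp: phase_carrier_def position_def velocity_def history_def)
qed

lemma position_J: "u \<in> V \<Longrightarrow> w \<in> L2mu V R \<mu> \<Longrightarrow> position (J (u, v, w)) = u"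
  and velocity_J: "u \<in> V \<Longrightarrow> w \<in> L2mu V R \<mu> \<Longrightarrow> velocity (J (u, v, w)) = v"
  using J_inject[OF rep(1,2) _ _ rep(3)] by blast+

lemma norm_rep: "(norm x)\<^sup>2 = (1 - mu_tilde \<mu>) * (norm (R (position x)))\<^sup>2 + (norm (velocity x))\<^sup>2
     + (LBINT s:{0<..}. \<mu> s * (norm (R (history x s)))\<^sup>2)"
  using J_norm[OF rep(1,2), of x "velocity x" x] by (simp add: rep(3))

lemma linear_position: "position (x + y) = position x + position y" "position (c *\<^sub>R x) = c *\<^sub>R position x"
  and linear_velocity: "velocity (x + y) = velocity x + velocity y" "velocity (c *\<^sub>R x) = c *\<^sub>R velocity x"
proof -
  have a: "x + y = J (position x + position y, velocity x + velocity y, \<lambda>s. history x s + history y s)"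
    using J_add[OF rep(1,2) rep(1,2), of x y "velocity x" "velocity y"] by (simp add: rep(3))
  have s: "c *\<^sub>R x = J (c *\<^sub>R position x, c *\<^sub>R velocity x, \<lambda>s. c *\<^sub>R history x s)"
    using J_scale[OF rep(1,2), of c x "velocity x"] by (simp add: rep(3))
  note m = subspace_add[OF subspace_V rep(1) rep(1)] L2mu_add[OF rep(2) rep(2)]
    subspace_scale[OF subspace_V rep(1)] L2mu_scale[OF rep(2)]
  show "position (x + y) = position x + position y" "velocity (x + y) = velocity x + velocity y"
    using a position_J velocity_J m by metis+
  show "position (c *\<^sub>R x) = c *\<^sub>R position x" "velocity (c *\<^sub>R x) = c *\<^sub>R velocity x"
    using s position_J velocity_J m by metis+
qed

lemma velocity_bound: "norm (velocity x) \<le> norm x"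
proof (rule power2_le_imp_le)
  have "0 \<le> (1 - mu_tilde \<mu>) * (norm (R (position x)))\<^sup>2" using \<mu>_tilde by simp
  then show "(norm (velocity x))\<^sup>2 \<le> (norm x)\<^sup>2"
    using norm_rep[of x] memory_integral_nonneg[of "history x"] by linarith
qed simp

lemma R_position_bound: "norm (R (position x)) \<le> norm x / sqrt (1 - mu_tilde \<mu>)"
proof (rule power2_le_imp_le)
  have "(1 - mu_tilde \<mu>) * (norm (R (position x)))\<^sup>2 \<le> (norm x)\<^sup>2"
    using norm_rep[of x] memory_integral_nonneg[of "history x"] zero_le_power2[of "norm (velocity x)"] by linarith
  then show "(norm (R (position x)))\<^sup>2 \<le> (norm x / sqrt (1 - mu_tilde \<mu>))\<^sup>2"
    using \<mu>_tilde by (simp add: power_divide field_simps)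
qed (use \<mu>_tilde in simp)

lemma bounded_linear_velocity: "bounded_linear velocity"
  by (rule bounded_linear_intro[where K = 1]) (auto simp: linear_velocity velocity_bound)

lemma bounded_linear_R_position: "bounded_linear (\<lambda>x. R (position x))"
  by (rule bounded_linear_intro[where K = "1 / sqrt (1 - mu_tilde \<mu>)"])
     (use R_position_bound in \<open>auto simp: linear_position R_simps rep\<close>)

lemma bounded_linear_position: "bounded_linear position"
  using bounded_linear_compose[OF bounded_linear_R_inv bounded_linear_R_position]
  by (simp add: R_inv_R rep)

end

section \<open>Primitives of the memory component\<close>

context memory_phase_space
begin

text \<open>
  On \<open>(0, s]\<close> the weight is at least \<open>\<mu> s > 0\<close>, and \<open>2 a \<le> 1 + a\<^sup>2\<close> bounds the norm by its square, which
  is integrable against the weight.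
\<close>

lemma R_history_integrable:
  assumes w: "w \<in> L2mu V R \<mu>" and s: "0 < \<mu> s" "0 \<le> s"
  shows "set_integrable lborel {0<..s} (\<lambda>r. R (w r))"
    and "(LBINT r:{0<..s}. norm (R (w r))) \<le> (s + (LBINT r:{0<..}. \<mu> r * (norm (R (w r)))\<^sup>2) / \<mu> s) / 2"
proof -
  have i1: "set_integrable lborel {0<..s} (\<lambda>r. \<mu> r * (norm (R (w r)))\<^sup>2)"
    by (rule set_integrable_subset[OF L2mu_integrable[OF w]]) auto
  have ic: "set_integrable lborel {0<..s} (\<lambda>r. 1 :: real)"
    by (rule set_integrable_subset[of lborel "{0..s}"]) (auto intro: borel_integrable_atLeastAtMost')
  have i2: "set_integrable lborel {0<..s} (\<lambda>r. (1 + \<mu> r * (norm (R (w r)))\<^sup>2 / \<mu> s) / 2)"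
    by (intro set_integrable_divide set_integral_add(1) ic i1)
  have le: "norm (R (w r)) \<le> (1 + \<mu> r * (norm (R (w r)))\<^sup>2 / \<mu> s) / 2" if "r \<in> {0<..s}" for r
  proof -
    have "\<mu> s * (norm (R (w r)))\<^sup>2 \<le> \<mu> r * (norm (R (w r)))\<^sup>2"
      using \<mu>_decreasing[of r s] that by (intro mult_right_mono) auto
    then have "(norm (R (w r)))\<^sup>2 \<le> \<mu> r * (norm (R (w r)))\<^sup>2 / \<mu> s" using s by (simp add: field_simps)
    moreover have "2 * norm (R (w r)) \<le> 1 + (norm (R (w r)))\<^sup>2"
      using sum_squares_bound[of 1 "norm (R (w r))"] by simp
    ultimately show ?thesis by simp
  qed
  have "set_borel_measurable lborel {0<..s} (\<lambda>r. R (w r))"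
    by (rule set_borel_measurable_subset[OF L2mu_measurable[OF w]]) auto
  then show i: "set_integrable lborel {0<..s} (\<lambda>r. R (w r))"
    by (rule set_integrable_bound[OF i2]) (use order_trans[OF le abs_ge_self] in auto)
  have "(LBINT r:{0<..s}. norm (R (w r))) \<le> (LBINT r:{0<..s}. (1 + \<mu> r * (norm (R (w r)))\<^sup>2 / \<mu> s) / 2)"
    by (rule set_integral_mono[OF set_integrable_norm[OF i] i2 le])
  also have "\<dots> = (s + (LBINT r:{0<..s}. \<mu> r * (norm (R (w r)))\<^sup>2) / \<mu> s) / 2"
    using set_integral_add(2)[OF ic set_integrable_divide[OF i1]] s
    by (simp add: set_integral_const)
  also have "\<dots> \<le> (s + (LBINT r:{0<..}. \<mu> r * (norm (R (w r)))\<^sup>2) / \<mu> s) / 2"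
  proof -
    have "(LBINT r:{0<..s}. \<mu> r * (norm (R (w r)))\<^sup>2) \<le> (LBINT r:{0<..}. \<mu> r * (norm (R (w r)))\<^sup>2)"
      unfolding set_lebesgue_integral_def
      by (rule integral_mono')
        (use L2mu_integrable[OF w] in \<open>auto simp: set_integrable_def indicator_def \<mu>_nonneg\<close>)
    then show ?thesis using s by (simp add: divide_right_mono)
  qed
  finally show "(LBINT r:{0<..s}. norm (R (w r))) \<le> (s + (LBINT r:{0<..}. \<mu> r * (norm (R (w r)))\<^sup>2) / \<mu> s) / 2" .
qed

lemma history_integrable:
  assumes w: "w \<in> L2mu V R \<mu>" and s: "0 < \<mu> s" "0 \<le> s"
  shows "set_integrable lborel {0..s} w" "(LBINT r:{0..s}. w r) = R_inv (LBINT r:{0<..s}. R (w r))"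
proof -
  note TR = set_integral_bounded_linear[OF bounded_linear_R_inv R_history_integrable(1)[OF w s]]
  have eq: "R_inv (R (w r)) = w r" if "r \<in> {0<..s}" for r
    using that w by (simp add: R_inv_R L2mu_memory)
  have i: "set_integrable lborel {0<..s} w"
    using TR(1) by (rule set_integrable_cong[THEN iffD1, rotated -1]) (use eq in auto)
  then show "set_integrable lborel {0..s} w"
    by (rule set_integrable_discrete_difference[of "{0}" "{0<..s}" "{0..s}", THEN iffD1, rotated -1]) auto
  have "(LBINT r:{0..s}. w r) = (LBINT r:{0<..s}. w r)"
    by (rule set_integral_discrete_difference[of "{0}"]) auto
  also have "\<dots> = (LBINT r:{0<..s}. R_inv (R (w r)))"
    by (rule set_lebesgue_integral_cong) (use eq in auto)
  finally show "(LBINT r:{0..s}. w r) = R_inv (LBINT r:{0<..s}. R (w r))"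
    using TR(2) by simp
qed

lemma history_AE:
  assumes w: "w \<in> L2mu V R \<mu>" and z: "z \<in> L2mu V R \<mu>"
  shows "(LBINT r:{0<..}. \<mu> r * (norm (R (w r - z r)))\<^sup>2) = 0 \<longleftrightarrow>
     (AE r in lborel. 0 < r \<longrightarrow> 0 < \<mu> r \<longrightarrow> w r = z r)"
proof -
  have i: "integrable lborel (\<lambda>r. indicator {0<..} r *\<^sub>R (\<mu> r * (norm (R (w r - z r)))\<^sup>2))"
    using L2mu_integrable[OF L2mu_diff[OF w z]] by (simp add: set_integrable_def)
  have "(LBINT r:{0<..}. \<mu> r * (norm (R (w r - z r)))\<^sup>2) = 0 \<longleftrightarrow>
     (AE r in lborel. indicator {0<..} r *\<^sub>R (\<mu> r * (norm (R (w r - z r)))\<^sup>2) = 0)"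
    unfolding set_lebesgue_integral_def
    by (rule integral_nonneg_eq_0_iff_AE[OF i]) (auto simp: indicator_def \<mu>_nonneg)
  also have "\<dots> \<longleftrightarrow> (AE r in lborel. 0 < r \<longrightarrow> 0 < \<mu> r \<longrightarrow> w r = z r)"
  proof (rule AE_cong)
    fix r :: real
    have "w r - z r \<in> V" if "0 < r" using L2mu_memory[OF L2mu_diff[OF w z] that] .
    then show "indicator {0<..} r *\<^sub>R (\<mu> r * (norm (R (w r - z r)))\<^sup>2) = 0 \<longleftrightarrow> (0 < r \<longrightarrow> 0 < \<mu> r \<longrightarrow> w r = z r)"
      using R_eq_zero[of "w r - z r"] \<mu>_nonneg[of r] by (auto simp: indicator_def R_simps(3))
  qed
  finally show ?thesis .
qed

text \<open>
  The values of a memory component at single points have no meaning for its class, but its integrals over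
  \<open>[0, s]\<close> do, as long as \<open>\<mu> s > 0\<close>. These integrals determine the class and depend linearly and
  continuously on it.
\<close>

definition history_primitive :: "real \<Rightarrow> 'x \<Rightarrow> 'h" where
  "history_primitive s x = (LBINT r:{0..s}. history x r)"

lemma history_primitive_J:
  assumes "u \<in> V" "w \<in> L2mu V R \<mu>" "0 < \<mu> s" "0 \<le> s"
  shows "history_primitive s (J (u, v, w)) = (LBINT r:{0..s}. w r)"
proof -
  let ?x = "J (u, v, w)"
  have "(LBINT r:{0<..}. \<mu> r * (norm (R (history ?x r - w r)))\<^sup>2) = 0"
    by (rule J_inject(3)[OF rep(1,2) assms(1,2) rep(3)])
  then have ae: "AE r in lborel. 0 < r \<longrightarrow> 0 < \<mu> r \<longrightarrow> history ?x r = w r"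
    using history_AE[OF rep(2) assms(2)] by blast
  have pos: "0 < \<mu> r" if "0 \<le> r" "r \<le> s" for r using \<mu>_decreasing[OF that] assms(3) by simp
  show ?thesis
    unfolding history_primitive_def set_lebesgue_integral_def
  proof (rule integral_cong_AE)
    show "AE r in lborel. indicat_real {0..s} r *\<^sub>R history ?x r = indicat_real {0..s} r *\<^sub>R w r"
      using ae AE_lborel_singleton[of 0] by eventually_elim (use pos in \<open>auto simp: indicator_def\<close>)
    show "(\<lambda>r. indicat_real {0..s} r *\<^sub>R history ?x r) \<in> borel_measurable lborel"
      using history_integrable(1)[OF rep(2) assms(3,4)] unfolding set_integrable_def
          by (rule borel_measurable_integrable)
    show "(\<lambda>r. indicat_real {0..s} r *\<^sub>R w r) \<in> borel_measurable lborel"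
      using history_integrable(1)[OF assms(2-4)] unfolding set_integrable_def by (rule borel_measurable_integrable)
  qed
qed

lemma history_primitive_linear:
  assumes "0 < \<mu> s" "0 \<le> s"
  shows "history_primitive s (x + y) = history_primitive s x + history_primitive s y"
    and "history_primitive s (c *\<^sub>R x) = c *\<^sub>R history_primitive s x"
proof -
  have a: "x + y = J (position x + position y, velocity x + velocity y, \<lambda>s. history x s + history y s)"
    using J_add[OF rep(1,2) rep(1,2), of x y "velocity x" "velocity y"] by (simp add: rep(3))
  have s: "c *\<^sub>R x = J (c *\<^sub>R position x, c *\<^sub>R velocity x, \<lambda>s. c *\<^sub>R history x s)"
    using J_scale[OF rep(1,2), of c x "velocity x"] by (simp add: rep(3))
  show "history_primitive s (x + y) = history_primitive s x + history_primitive s y"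
    by (subst a, subst history_primitive_J[OF subspace_add[OF subspace_V rep(1) rep(1)] L2mu_add[OF rep(2) rep(2)]
        assms])
      (simp add: history_primitive_def set_integral_add(2)[OF history_integrable(1)[OF rep(2) assms]
          history_integrable(1)[OF rep(2) assms]])
  show "history_primitive s (c *\<^sub>R x) = c *\<^sub>R history_primitive s x"
    by (subst s, subst history_primitive_J[OF subspace_scale[OF subspace_V rep(1)] L2mu_scale[OF rep(2)] assms])
      (simp add: history_primitive_def)
qed

text \<open>
  The bound is uniform for upper limits in \<open>[0, s]\<close>, which the joint continuity in time and upper limit
  requires. On the unit ball it follows from \<open>R_history_integrable\<close>, elsewhere from linearity.
\<close>

lemma history_primitive_bound:
  assumes s: "0 < \<mu> s" "0 \<le> s"
  shows "\<exists>K. \<forall>r\<in>{0..s}. \<forall>x. norm (history_primitive r x) \<le> K * norm x"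
proof -
  obtain c where c: "0 < c" "\<And>y. norm (R_inv y) \<le> norm y * c"
    using bounded_linear.pos_bounded[OF bounded_linear_R_inv] by blast
  define K where "K = (s + 1 / \<mu> s) / 2 * c"
  have "norm (history_primitive r x) \<le> K * norm x" if r: "r \<in> {0..s}" for r x
  proof -
    have \<mu>r: "0 < \<mu> r" "0 \<le> r" using \<mu>_decreasing[of r s] r s by auto
    have unit: "norm (history_primitive r y) \<le> K" if y: "norm y \<le> 1" for y
    proof -
      note w = rep(2)[of y]
      have "norm (LBINT q:{0<..r}. R (history y q)) \<le> (LBINT q:{0<..r}. norm (R (history y q)))"
        by (rule norm_set_integral_le[OF R_history_integrable(1)[OF w \<mu>r] set_integrable_norm[OF
            R_history_integrable(1)[OF w \<mu>r]]]) simp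
      also have "\<dots> \<le> (r + (LBINT q:{0<..}. \<mu> q * (norm (R (history y q)))\<^sup>2) / \<mu> r) / 2"
        by (rule R_history_integrable(2)[OF w \<mu>r])
      also have "\<dots> \<le> (s + 1 / \<mu> s) / 2"
      proof -
        have "(LBINT q:{0<..}. \<mu> q * (norm (R (history y q)))\<^sup>2) \<le> (norm y)\<^sup>2"
          using norm_rep[of y] \<mu>_tilde zero_le_power2[of "norm (velocity y)"]
            mult_nonneg_nonneg[of "1 - mu_tilde \<mu>" "(norm (R (position y)))\<^sup>2"] by simp
        also have "\<dots> \<le> 1" using power_le_one[OF norm_ge_zero y] by simp
        finally have "(LBINT q:{0<..}. \<mu> q * (norm (R (history y q)))\<^sup>2) / \<mu> r \<le> 1 / \<mu> s"
          using \<mu>_decreasing[of r s] r s memory_integral_nonneg[of "history y"] by (intro frac_le) auto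
        then show ?thesis using r by (intro divide_right_mono add_mono) auto
      qed
      finally have "norm (LBINT q:{0<..r}. R (history y q)) * c \<le> K"
        unfolding K_def using c(1) by (intro mult_right_mono) auto
      then show ?thesis
        using c(2)[of "LBINT q:{0<..r}. R (history y q)"]
        unfolding history_primitive_def history_integrable(2)[OF w \<mu>r] by simp
    qed
    show ?thesis
    proof (cases "x = 0")
      case True
      then show ?thesis using history_primitive_linear(2)[OF \<mu>r, of 0 x] by simp
    next
      case False
      have "norm (history_primitive r ((1 / norm x) *\<^sub>R x)) \<le> K" by (rule unit) (use False in simp)
      then show ?thesis using False unfolding history_primitive_linear(2)[OF \<mu>r] by (simp add: field_simps)
    qed
  qed
  then show ?thesis by blast
qed

lemma bounded_linear_history_primitive:
  assumes s: "0 < \<mu> s" "0 \<le> s" shows "bounded_linear (history_primitive s)"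
proof -
  obtain K where "\<forall>r\<in>{0..s}. \<forall>x. norm (history_primitive r x) \<le> K * norm x"
    using history_primitive_bound[OF s] by blast
  then have "norm (history_primitive s x) \<le> K * norm x" for x using s(2) by auto
  then show ?thesis
    by (intro bounded_linear_intro[where K = K]) (auto simp: history_primitive_linear[OF s] mult.commute)
qed

lemma history_primitive_continuous:
  assumes s: "0 < \<mu> s" "0 \<le> s" and U: "continuous_on {0..a} U"
  shows "continuous_on ({0..a} \<times> {0..s}) (\<lambda>(t, r). history_primitive r (U t) \<bullet> e)"
proof -
  obtain K where K: "\<And>r x. r \<in> {0..s} \<Longrightarrow> norm (history_primitive r x) \<le> K * norm x"
    using history_primitive_bound[OF s] by blast
  have pos: "0 < \<mu> r" if "r \<in> {0..s}" for r using \<mu>_decreasing[of r s] that s by simp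
  have cs: "continuous_on {0..s} (\<lambda>r. history_primitive r x \<bullet> e)" for x
  proof -
    have i: "set_integrable lborel {0..s} (history x)" by (rule history_integrable(1)[OF rep(2) s])
    have "continuous_on {0..s} (\<lambda>r. LBINT q:{0..r}. history x q \<bullet> e)"
      by (rule continuous_on_set_integral[OF set_integral_bounded_linear(1)[OF bounded_linear_inner_left i]])
    moreover have "(LBINT q:{0..r}. history x q \<bullet> e) = history_primitive r x \<bullet> e" if "r \<in> {0..s}" for r
      unfolding history_primitive_def
      by (rule set_integral_bounded_linear(2)[OF bounded_linear_inner_left history_integrable(1)[OF rep(2) pos]])
          (use that in auto)
    ultimately show ?thesis by (subst continuous_on_cong[OF refl]) auto
  qed
  show ?thesis
    unfolding continuous_on_def
  proof
    fix z assume "z \<in> {0..a} \<times> {0..s}"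
    then obtain t r where z: "z = (t, r)" and t: "t \<in> {0..a}" and r: "r \<in> {0..s}" by blast
    let ?F = "at (t, r) within {0..a} \<times> {0..s}"
    have fst: "(fst \<longlongrightarrow> t) ?F" and snd: "(snd \<longlongrightarrow> r) ?F"
      using tendsto_fst[OF tendsto_ident_at, of "(t, r)"] tendsto_snd[OF tendsto_ident_at, of "(t, r)"] by auto
    have "continuous_on ({0..a} \<times> {0..s}) (\<lambda>p. U (fst p))"
      by (rule continuous_on_compose2[OF U]) (auto intro: continuous_on_fst continuous_on_id)
    then have 1: "((\<lambda>p. U (fst p)) \<longlongrightarrow> U t) ?F" using t r by (force simp: continuous_on_def)
    have "continuous_on ({0..a} \<times> {0..s}) (\<lambda>p. history_primitive (snd p) (U t) \<bullet> e)"
      by (rule continuous_on_compose2[OF cs]) (auto intro: continuous_on_snd continuous_on_id)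
    then have 2: "((\<lambda>p. history_primitive (snd p) (U t) \<bullet> e) \<longlongrightarrow> history_primitive r (U t) \<bullet> e) ?F"
      using t r by (force simp: continuous_on_def)
    have "((\<lambda>p. K * norm (U (fst p) - U t) * norm e
        + \<bar>history_primitive (snd p) (U t) \<bullet> e - history_primitive r (U t) \<bullet> e\<bar>)
      \<longlongrightarrow> K * norm (U t - U t) * norm e + \<bar>history_primitive r (U t) \<bullet> e - history_primitive r (U t) \<bullet> e\<bar>) ?F"
      by (intro tendsto_intros 1 2)
    then have lim: "((\<lambda>p. K * norm (U (fst p) - U t) * norm e
        + \<bar>history_primitive (snd p) (U t) \<bullet> e - history_primitive r (U t) \<bullet> e\<bar>)
      \<longlongrightarrow> 0) ?F" by simp
    have "((\<lambda>p. history_primitive (snd p) (U (fst p)) \<bullet> e - history_primitive r (U t) \<bullet> e) \<longlongrightarrow> 0) ?F"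
    proof (rule Lim_null_comparison[OF _ lim])
      show "eventually (\<lambda>p. norm (history_primitive (snd p) (U (fst p)) \<bullet> e - history_primitive r (U t) \<bullet> e)
         \<le> K * norm (U (fst p) - U t) * norm e
             + \<bar>history_primitive (snd p) (U t) \<bullet> e - history_primitive r (U t) \<bullet> e\<bar>) ?F"
        unfolding eventually_at_filter
      proof (intro always_eventually allI impI)
        fix p assume "p \<noteq> (t, r)" and p: "p \<in> {0..a} \<times> {0..s}"
        have sp: "snd p \<in> {0..s}" using p by auto
        interpret P: bounded_linear "history_primitive (snd p)"
          by (rule bounded_linear_history_primitive[OF pos[OF sp]]) (use sp in auto)
        have "\<bar>history_primitive (snd p) (U (fst p) - U t) \<bullet> e\<bar>
            \<le> norm (history_primitive (snd p) (U (fst p) - U t)) * norm e"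
          by (rule Cauchy_Schwarz_ineq2)
        also have "\<dots> \<le> K * norm (U (fst p) - U t) * norm e"
          by (intro mult_right_mono K[OF sp]) auto
        finally show "norm (history_primitive (snd p) (U (fst p)) \<bullet> e - history_primitive r (U t) \<bullet> e)
         \<le> K * norm (U (fst p) - U t) * norm e
             + \<bar>history_primitive (snd p) (U t) \<bullet> e - history_primitive r (U t) \<bullet> e\<bar>"
          by (simp add: P.diff inner_diff_left)
      qed
    qed
    then show "((\<lambda>(t, r). history_primitive r (U t) \<bullet> e) \<longlongrightarrow> (case z of (t, r) \<Rightarrow> history_primitive r (U t) \<bullet> e))
        (at z within {0..a} \<times> {0..s})"
      unfolding z by (simp add: LIM_zero_iff case_prod_unfold)
  qed
qed

text \<open>
  The operator in terms of the continuous coordinates: with \<open>(y, z)\<close> in the graph, the third component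
  \<open>w\<close> of \<open>y\<close> has the derivative \<open>w' = position z - history z\<close> and vanishes at \<open>0\<close>, so that it is the
  integrand below.
\<close>

lemma evolution_graph_components:
  assumes "(y, z) \<in> evolution_graph D A V R \<mu> J"
  shows "velocity y = position z"
    and "0 < \<mu> s \<Longrightarrow> 0 \<le> s \<Longrightarrow> history_primitive s y = (LBINT r:{0..s}. r *\<^sub>R position z - history_primitive r z)"
    and "0 < \<mu> s \<Longrightarrow> 0 \<le> s \<Longrightarrow> set_integrable lborel {0..s} (\<lambda>r. r *\<^sub>R position z - history_primitive r z)"
proof -
  obtain u v w w' where y: "y = J (u, v, w)"
    and z: "z = J (v, - A ((1 - mu_tilde \<mu>) *\<^sub>R u + (LBINT s:{0<..}. \<mu> s *\<^sub>R w s)), \<lambda>s. - w' s + v)"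
    and m: "u \<in> V" "v \<in> V" "w \<in> L2mu V R \<mu>" "w' \<in> L2mu V R \<mu>" and d: "s_derivative \<mu> w w'" and w0: "w 0 = 0"
    using assms unfolding evolution_graph_def by blast
  have m': "(\<lambda>s. - w' s + v) \<in> L2mu V R \<mu>"
    using L2mu_diff[OF L2mu_const[OF m(2)] m(4)] by simp
  have pz: "position z = v" unfolding z by (rule position_J[OF m(2) m'])
  show "velocity y = position z" unfolding pz unfolding y by (rule velocity_J[OF m(1,3)])
  assume s: "0 < \<mu> s" "0 \<le> s"
  have eq: "w r = r *\<^sub>R v - history_primitive r z" if r: "r \<in> {0..s}" for r
  proof -
    have \<mu>r: "0 < \<mu> r" "0 \<le> r" using \<mu>_decreasing[of r s] r s by auto
    have c: "set_integrable lborel {0..r} (\<lambda>_. v)" by (rule borel_integrable_atLeastAtMost') auto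
    have "history_primitive r z = (LBINT q:{0..r}. v - w' q)"
      unfolding z using history_primitive_J[OF m(2) m' \<mu>r] by simp
    also have "\<dots> = r *\<^sub>R v - (LBINT q:{0..r}. w' q)"
      using set_integral_diff(2)[OF c history_integrable(1)[OF m(4) \<mu>r]] \<mu>r by (simp add: set_integral_const)
    also have "(LBINT q:{0..r}. w' q) = w r"
      using d w0 \<mu>r set_integral_singleton_zero[of 0 w'] by (cases "r = 0") (auto simp: s_derivative_def)
    finally show ?thesis by simp
  qed
  show "set_integrable lborel {0..s} (\<lambda>r. r *\<^sub>R position z - history_primitive r z)"
    unfolding pz using history_integrable(1)[OF m(3) s]
    by (rule set_integrable_cong[THEN iffD1, rotated -1]) (use eq in auto)
  show "history_primitive s y = (LBINT r:{0..s}. r *\<^sub>R position z - history_primitive r z)"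
    unfolding pz unfolding y history_primitive_J[OF m(1,3) s]
    by (rule set_lebesgue_integral_cong) (use eq in auto)
qed

end

section \<open>Uniqueness for the transport equation\<close>

text \<open>
  The primitive \<open>Y\<close> of \<open>X\<close> in \<open>t\<close> has \<open>\<partial>\<^sub>t Y = X\<close>, and by hypothesis \<open>\<partial>\<^sub>s Y = - X\<close>. Hence \<open>Y\<close> is constant along
  the lines parallel to the diagonal. Each of them starts on a coordinate axis, where \<open>Y\<close> vanishes; so
  \<open>Y = 0\<close> and \<open>X = \<partial>\<^sub>t Y = 0\<close>.
\<close>

lemma transport_zero:
  fixes X :: "real \<Rightarrow> real \<Rightarrow> real"
  assumes cont: "continuous_on ({0..a} \<times> {0..b}) (\<lambda>(t, s). X t s)" and "0 < a"
    and eq: "\<And>t s. t \<in> {0..a} \<Longrightarrow> s \<in> {0..b} \<Longrightarrow> integral {0..t} (\<lambda>r. X r s) + integral {0..s} (X t) = 0"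
    and ts: "t \<in> {0..a}" "s \<in> {0..b}"
  shows "X t s = 0"
proof -
  define Y where "Y t s = integral {0..t} (\<lambda>r. X r s)" for t s
  have Xt: "continuous_on {0..a} (\<lambda>r. X r s)" if "s \<in> {0..b}" for s
    by (rule continuous_on_compose2[OF cont, of _ "\<lambda>r. (r, s)", simplified])
      (use that in \<open>auto intro!: continuous_on_Pair continuous_on_id continuous_on_const\<close>)
  have Xs: "continuous_on {0..b} (X t)" if "t \<in> {0..a}" for t
    by (rule continuous_on_compose2[OF cont, of _ "\<lambda>s. (t, s)", simplified])
      (use that in \<open>auto intro!: continuous_on_Pair continuous_on_id continuous_on_const\<close>)
  have Y': "Y t s = - integral {0..s} (X t)" if "t \<in> {0..a}" "s \<in> {0..b}" for t s
    using eq[OF that] by (simp add: Y_def)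
  have uc: "uniformly_continuous_on ({0..a} \<times> {0..b}) (\<lambda>(t, s). X t s)"
    by (rule compact_uniformly_continuous[OF cont]) (intro compact_Times compact_Icc)
  have mean: "\<bar>integral {p..q} g - (q - p) * c\<bar> \<le> (q - p) * e"
    if "p \<le> q" "continuous_on {p..q} g" "\<And>r. r \<in> {p..q} \<Longrightarrow> \<bar>g r - c\<bar> \<le> e" for p q c e and g :: "real \<Rightarrow> real"
  proof -
    have "norm (integral {p..q} (\<lambda>r. g r - c)) \<le> e * (q - p)"
      by (rule integral_bound) (use that in \<open>auto intro: continuous_on_diff continuous_on_const\<close>)
    moreover have "integral {p..q} (\<lambda>r. g r - c) = integral {p..q} g - (q - p) * c"
      using that by (subst integral_diff) (auto intro: integrable_continuous_interval)
    ultimately show ?thesis by (simp add: mult.commute)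
  qed
  \<comment> \<open>An increment of \<open>Y\<close> along the diagonal is the difference of two integrals of \<open>X\<close> over intervals of
    length \<open>h\<close>; by uniform continuity both are \<open>h * X t s\<close> up to a small multiple of \<open>h\<close>.\<close>
  have step: "\<exists>d>0. \<forall>t\<in>{0..a}. \<forall>s\<in>{0..b}. \<forall>h. 0 \<le> h \<longrightarrow> h < d \<longrightarrow> t + h \<le> a \<longrightarrow> s + h \<le> b \<longrightarrow>
      \<bar>Y (t + h) (s + h) - Y t s\<bar> \<le> e * h" if e: "0 < e" for e
  proof -
    from uc e obtain d where d: "0 < d"
      "\<And>z z'. z \<in> {0..a} \<times> {0..b} \<Longrightarrow> z' \<in> {0..a} \<times> {0..b} \<Longrightarrow> dist z' z < d
        \<Longrightarrow> dist (case z' of (t, s) \<Rightarrow> X t s) (case z of (t, s) \<Rightarrow> X t s) < e / 2"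
      unfolding uniformly_continuous_on_def by (metis half_gt_zero)
    have "\<bar>Y (t + h) (s + h) - Y t s\<bar> \<le> e * h"
      if t: "t \<in> {0..a}" and s: "s \<in> {0..b}" and h: "0 \<le> h" "h < d / 2" "t + h \<le> a" "s + h \<le> b" for t s h
    proof -
      have near: "\<bar>X t' s' - X t s\<bar> \<le> e / 2" if "t' \<in> {t..t + h}" "s' \<in> {s..s + h}" for t' s'
      proof -
        have "dist (t', s') (t, s) \<le> \<bar>t' - t\<bar> + \<bar>s' - s\<bar>"
          unfolding dist_Pair_Pair dist_real_def by (rule sqrt_sum_squares_le_sum) auto
        also have "\<dots> < d" using that h by auto
        finally show ?thesis using d(2)[of "(t, s)" "(t', s')"] that t s h by (auto simp: dist_real_def)
      qed
      have "Y (t + h) (s + h) - Y t (s + h) = integral {t..t + h} (\<lambda>r. X r (s + h))"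
        unfolding Y_def
        using Henstock_Kurzweil_Integration.integral_combine[of 0 t "t + h" "\<lambda>r. X r (s + h)"] t s h
          integrable_continuous_interval[OF continuous_on_subset[OF Xt[of "s + h"]], of 0 "t + h"] by auto
      moreover have "Y t (s + h) - Y t s = - integral {s..s + h} (X t)"
        using Y'[of t s] Y'[of t "s + h"] Henstock_Kurzweil_Integration.integral_combine[of 0 s "s + h" "X t"] t s h
          integrable_continuous_interval[OF continuous_on_subset[OF Xs[of t]], of 0 "s + h"] by auto
      moreover have "\<bar>integral {t..t + h} (\<lambda>r. X r (s + h)) - (t + h - t) * X t s\<bar> \<le> (t + h - t) * (e / 2)"
        by (rule mean) (use t s h near in \<open>auto intro!: continuous_on_subset[OF Xt[of "s + h"]]\<close>)
      moreover have "\<bar>integral {s..s + h} (X t) - (s + h - s) * X t s\<bar> \<le> (s + h - s) * (e / 2)"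
        by (rule mean) (use t s h near in \<open>auto intro!: continuous_on_subset[OF Xs[of t]]\<close>)
      moreover have "h * (e / 2) + h * (e / 2) = e * h" by simp
      ultimately show ?thesis unfolding add_diff_cancel_left' by linarith
    qed
    then show ?thesis using d(1) by (intro exI[of _ "d / 2"]) auto
  qed
  have Y0: "Y t s = 0" if ts: "t \<in> {0..a}" "s \<in> {0..b}" for t s
  proof -
    define m where "m = min t s"
    define F where "F x = Y (t - m + x) (s - m + x)" for x
    have "(F has_derivative (\<lambda>h. 0)) (at x within {0..m})" if x: "x \<in> {0..m}" for x
      unfolding has_derivative_within_alt
    proof (intro conjI allI impI)
      fix e :: real assume e: "0 < e"
      obtain d where d: "0 < d" "\<And>t s h. t \<in> {0..a} \<Longrightarrow> s \<in> {0..b} \<Longrightarrow> 0 \<le> h \<Longrightarrow> h < d \<Longrightarrow> t + h \<le> a \<Longrightarrow> s + h \<le> b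
         \<Longrightarrow> \<bar>Y (t + h) (s + h) - Y t s\<bar> \<le> e * h" using step[OF e] by blast
      have *: "\<bar>F z - F y\<bar> \<le> e * (z - y)" if "0 \<le> y" "y \<le> z" "z \<le> m" "z - y < d" for y z
      proof -
        have m: "m \<le> t" "m \<le> s" by (auto simp: m_def)
        have eqs: "t - m + y + (z - y) = t - m + z" "s - m + y + (z - y) = s - m + z" by auto
        have "\<bar>Y (t - m + y + (z - y)) (s - m + y + (z - y)) - Y (t - m + y) (s - m + y)\<bar> \<le> e * (z - y)"
          by (rule d(2)) (use that ts m in auto)
        then show ?thesis unfolding eqs F_def .
      qed
      have "norm (F y - F x - 0) \<le> e * norm (y - x)" if "y \<in> {0..m}" "norm (y - x) < d" for y
        using *[of x y] *[of y x] that x by (cases "x \<le> y") (auto simp: abs_minus_commute)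
      then show "\<exists>d>0. \<forall>y\<in>{0..m}. norm (y - x) < d \<longrightarrow> norm (F y - F x - 0) \<le> e * norm (y - x)"
        using d(1) by blast
    qed simp
    then obtain c where c: "\<And>x. x \<in> {0..m} \<Longrightarrow> F x = c"
      using has_derivative_zero_constant[of "{0..m}" F] by auto
    have "Y t s = F m" by (simp add: F_def)
    also have "\<dots> = F 0" using c ts by (simp add: m_def)
    also have "\<dots> = 0" using Y'[of "t - s" 0] ts by (auto simp: F_def m_def min_def Y_def)
    finally show ?thesis .
  qed
  have "((\<lambda>t. Y t s) has_vector_derivative X t s) (at t within {0..a})"
    unfolding Y_def by (rule integral_has_vector_derivative[OF Xt[OF ts(2)] ts(1)])
  moreover have "((\<lambda>t. Y t s) has_vector_derivative 0) (at t within {0..a})"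
    by (rule has_vector_derivative_transform[OF ts(1) _ has_vector_derivative_const]) (use Y0 ts in auto)
  ultimately show ?thesis
    by (intro vector_derivative_unique_within_closed_interval[of 0 a t "\<lambda>t. Y t s"])
      (use ts \<open>0 < a\<close> in \<open>simp_all add: box_real\<close>)
qed

section \<open>Mild solutions are generated by a trajectory\<close>

context memory_phase_space
begin

text \<open>
  For \<open>s \<le> t\<close> the memory is a difference of values of a continuous curve. For \<open>s > t\<close> it is a constant plus
  the initial memory shifted by \<open>t\<close>, and the shift does not increase weighted norms since \<open>\<mu>\<close> decreases.
\<close>

lemma memory_of_trajectory_in_L2mu:
  assumes U: "continuous_on {0..} U" and ini: "initial_state u0 u1 \<in> phase_carrier V R \<mu>"
    and U0: "position (U 0) = u0 0"
    and u: "\<And>t. u t = (if t \<le> 0 then u0 t else position (U t))" and t: "0 \<le> t"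
  shows "(\<lambda>s. u t - u (t - s)) \<in> L2mu V R \<mu>"
proof -
  define \<eta> where "\<eta> s = u0 0 - u0 (- s)" for s
  have \<eta>: "\<eta> \<in> L2mu V R \<mu>" and u00: "u0 0 \<in> V"
    using ini unfolding initial_state_def carrier_iff \<eta>_def by auto
  have upos: "u r = position (U r)" if "0 \<le> r" for r using u[of r] U0 that by auto
  define y where "y s = R (u t) - R (position (U (max 0 (t - s))))" for s
  define z where "z s = indicator {0<..} (s - t) *\<^sub>R R (\<eta> (s - t))" for s
  have eq: "y s + z s = R (u t - u (t - s))" if "s \<in> {0<..}" for s
  proof (cases "s \<le> t")
    case True
    then show ?thesis using upos[OF t] upos[of "t - s"] by (simp add: y_def z_def R_simps rep)
  next
    case False
    have "R (u t - u (t - s)) = R ((u t - u0 0) + \<eta> (s - t))"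
      using False u[of "t - s"] by (simp add: \<eta>_def)
    also have "\<dots> = (R (u t) - R (u0 0)) + R (\<eta> (s - t))"
      using False upos[OF t] u00 L2mu_memory[OF \<eta>, of "s - t"] subspace_diff[OF subspace_V]
      by (simp add: R_simps rep)
    finally show ?thesis using False U0 by (simp add: y_def z_def)
  qed
  have yc: "continuous_on UNIV y"
  proof -
    have "continuous_on UNIV (\<lambda>s. U (max 0 (t - s)))"
      by (rule continuous_on_compose2[OF U])
        (intro continuous_on_max continuous_on_diff continuous_on_const continuous_on_id, auto)
    then show ?thesis
      unfolding y_def
      by (intro continuous_on_diff continuous_on_const bounded_linear.continuous_on[OF bounded_linear_R_position])
  qed
  have "\<exists>Q. \<forall>s\<ge>0. norm (y s) \<le> Q"
  proof -
    have "bounded (y ` {0..t})"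
      using compact_continuous_image[OF continuous_on_subset[OF yc]] compact_imp_bounded by blast
    then obtain Q where Q: "\<forall>s\<in>{0..t}. norm (y s) \<le> Q" unfolding bounded_iff by fast
    have "norm (y s) \<le> Q" if "0 \<le> s" for s
    proof (cases "s \<le> t")
      case False
      then have "y s = y t" by (simp add: y_def)
      then show ?thesis using Q t by simp
    qed (use Q that in auto)
    then show ?thesis by blast
  qed
  then obtain Q where Q: "\<And>s. 0 \<le> s \<Longrightarrow> norm (y s) \<le> Q" by blast
  have ym: "y \<in> borel_measurable borel" using yc by (rule borel_measurable_continuous_onI)
  have y1: "set_borel_measurable lborel {0<..} y"
    unfolding set_borel_measurable_def using ym by (intro borel_measurable_scaleR) (auto simp: borel_open)
  have y2: "set_integrable lborel {0<..} (\<lambda>s. \<mu> s * (norm (y s))\<^sup>2)"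
  proof -
    have "(\<lambda>s. (norm (y s))\<^sup>2) \<in> borel_measurable lborel"
      using measurable_compose[OF ym borel_measurable_norm] by simp
    then have "set_borel_measurable lborel {0<..} (\<lambda>s. (norm (y s))\<^sup>2)"
      unfolding set_borel_measurable_def by (intro borel_measurable_scaleR) (auto simp: borel_open)
    moreover have "norm ((norm (y s))\<^sup>2) \<le> Q\<^sup>2" if "s \<in> {0<..}" for s
      using Q[of s] that by (simp add: power_mono)
    ultimately have "set_integrable lborel {0<..} (\<lambda>s. \<mu> s *\<^sub>R (norm (y s))\<^sup>2)"
      by (rule set_integrable_scaleR_bounded[OF \<mu>_integrable])
    then show ?thesis by simp
  qed
  have zm: "z \<in> borel_measurable lborel"
  proof -
    have "(\<lambda>s. s - t) \<in> borel_measurable lborel" by simp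
    then show ?thesis
      using measurable_compose[of "\<lambda>s. s - t" lborel borel "\<lambda>s. indicator {0<..} s *\<^sub>R R (\<eta> s)" borel]
          L2mu_measurable[OF \<eta>]
      unfolding z_def set_borel_measurable_def by simp
  qed
  have z1: "set_borel_measurable lborel {0<..} z"
    unfolding set_borel_measurable_def using zm by (intro borel_measurable_scaleR) (auto simp: borel_open)
  have z2: "set_integrable lborel {0<..} (\<lambda>s. \<mu> s * (norm (z s))\<^sup>2)"
  proof -
    define Z where "Z s = indicator {0<..} (s - t) *\<^sub>R (\<mu> (s - t) * (norm (R (\<eta> (s - t))))\<^sup>2)" for s
    have "integrable lborel (\<lambda>s. indicator {0<..} (- t + 1 * s) *\<^sub>R (\<mu> (- t + 1 * s) * (norm (R (\<eta> (- t
        + 1 * s))))\<^sup>2))"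
      using L2mu_integrable[OF \<eta>] unfolding set_integrable_def by (intro lborel_integrable_real_affine) auto
    then have Z: "integrable lborel Z"
      by (rule Bochner_Integration.integrable_cong[THEN iffD1, rotated -1]) (auto simp: Z_def)
    show ?thesis
      unfolding set_integrable_def
    proof (rule Bochner_Integration.integrable_bound[OF Z])
      have "(\<lambda>s. (indicator {0<..} s *\<^sub>R \<mu> s) * (norm (z s))\<^sup>2) \<in> borel_measurable lborel"
        using \<mu>_integrable measurable_compose[OF zm borel_measurable_norm] unfolding set_integrable_def
        by (intro borel_measurable_times borel_measurable_power) (auto dest: borel_measurable_integrable)
      then show "(\<lambda>s. indicator {0<..} s *\<^sub>R (\<mu> s * (norm (z s))\<^sup>2)) \<in> borel_measurable lborel"
        by (simp add: mult.assoc)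
      show "AE s in lborel. norm (indicator {0<..} s *\<^sub>R (\<mu> s * (norm (z s))\<^sup>2)) \<le> norm (Z s)"
      proof (rule AE_I2)
        fix s
        show "norm (indicator {0<..} s *\<^sub>R (\<mu> s * (norm (z s))\<^sup>2)) \<le> norm (Z s)"
        proof (cases "t < s")
          case True
          have "\<mu> s * (norm (z s))\<^sup>2 \<le> \<mu> (s - t) * (norm (z s))\<^sup>2"
            using \<mu>_decreasing[of "s - t" s] True t by (intro mult_right_mono) auto
          then show ?thesis using True t \<mu>_nonneg[of s] \<mu>_nonneg[of "s - t"] by (simp add: Z_def z_def)
        qed (simp add: Z_def z_def)
      qed
    qed
  qed
  show ?thesis
  proof (rule L2muI)
    show "u t - u (t - s) \<in> V" if s: "0 < s" for s
    proof (cases "s \<le> t")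
      case True
      then show ?thesis using upos[OF t] upos[of "t - s"] subspace_diff[OF subspace_V rep(1) rep(1)] by simp
    next
      case False
      have "u t - u (t - s) = (position (U t) - u0 0) + \<eta> (s - t)"
        using False u[of "t - s"] upos[OF t] by (simp add: \<eta>_def)
      then show ?thesis
        using False subspace_add[OF subspace_V subspace_diff[OF subspace_V rep(1) u00] L2mu_memory[OF \<eta>]] by simp
    qed
    show "set_borel_measurable lborel {0<..} (\<lambda>s. R (u t - u (t - s)))"
      by (rule set_borel_measurable_cong_on[OF weighted_square_integrable(1)[OF y1 y2 z1 z2] eq])
    show "set_integrable lborel {0<..} (\<lambda>s. \<mu> s * (norm (R (u t - u (t - s))))\<^sup>2)"
      using weighted_square_integrable(2)[OF y1 y2 z1 z2]
      by (rule set_integrable_cong[THEN iffD1, rotated -1]) (use eq in auto)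
  qed
qed

end

locale memory_evolution = memory_phase_space D V A R \<mu> J + decaying_semigroup S M \<omega>
  for D V :: "'h::{real_inner, banach, second_countable_topology} set" and A R :: "'h \<Rightarrow> 'h"
    and \<mu> :: "real \<Rightarrow> real"
    and J :: "'h \<times> 'h \<times> (real \<Rightarrow> 'h) \<Rightarrow> 'x::{real_inner, banach, second_countable_topology}"
    and S :: "real \<Rightarrow> 'x \<Rightarrow> 'x" and M \<omega> :: real +
  assumes generator: "generator_graph S \<subseteq> evolution_graph D A V R \<mu> J"
begin

context
  fixes u0 :: "real \<Rightarrow> 'h" and u1 :: 'h and f :: "real \<Rightarrow> 'x" and U :: "real \<Rightarrow> 'x" and u :: "real \<Rightarrow> 'h"
  assumes ini: "initial_state u0 u1 \<in> phase_carrier V R \<mu>"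
    and f: "\<And>t. 0 \<le> t \<Longrightarrow> set_integrable lborel {0..t} f"
    and forcing: "\<And>s. 0 \<le> s \<Longrightarrow> \<exists>y. f s = J (0, y, \<lambda>_. 0)"
    and Uc: "continuous_on {0..} U"
    and U: "\<And>r. 0 \<le> r \<Longrightarrow> U r = S r (J (initial_state u0 u1)) + duhamel f r"
    and u: "\<And>t. u t = (if t \<le> 0 then u0 t else position (U t))"
begin

lemma initial_memory: "u0 0 \<in> V" "(\<lambda>s. u0 0 - u0 (- s)) \<in> L2mu V R \<mu>"
  using ini unfolding initial_state_def carrier_iff by auto

lemma U_zero: "U 0 = J (initial_state u0 u1)"
  using U[of 0] set_integral_singleton_zero[of 0 "\<lambda>s. S (0 - s) (f s)"] by (simp add: duhamel_def)

lemma position_U: "0 \<le> t \<Longrightarrow> u t = position (U t)"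
  using u[of t] U_zero position_J[OF initial_memory] by (auto simp: initial_state_def)

lemma velocity_U_zero: "velocity (U 0) = u1"
  using U_zero velocity_J[OF initial_memory] by (simp add: initial_state_def)

lemma forcing_components:
  assumes "0 \<le> t"
  shows "position (LBINT s:{0..t}. f s) = 0"
    and "0 < \<mu> s \<Longrightarrow> 0 \<le> s \<Longrightarrow> history_primitive s (LBINT s:{0..t}. f s) = 0"
proof -
  have m: "0 \<in> V" "(\<lambda>_. 0) \<in> L2mu V R \<mu>" using subspace_0[OF subspace_V] L2mu_const by auto
  have "position (LBINT s:{0..t}. f s) = (LBINT s:{0..t}. position (f s))"
    by (rule set_integral_bounded_linear(2)[OF bounded_linear_position f[OF assms], symmetric])
  also have "\<dots> = (LBINT s:{0..t}. 0)"
    by (rule set_lebesgue_integral_cong) (use forcing position_J[OF m] in fastforce)+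
  finally show "position (LBINT s:{0..t}. f s) = 0" by simp
  assume s: "0 < \<mu> s" "0 \<le> s"
  have "history_primitive s (LBINT r:{0..t}. f r) = (LBINT r:{0..t}. history_primitive s (f r))"
    by (rule set_integral_bounded_linear(2)[OF bounded_linear_history_primitive[OF s] f[OF assms], symmetric])
  also have "\<dots> = (LBINT r:{0..t}. 0)"
    by (rule set_lebesgue_integral_cong) (use forcing history_primitive_J[OF m s] in fastforce)+
  finally show "history_primitive s (LBINT s:{0..t}. f s) = 0" by simp
qed

text \<open>
  The components of the relation of \<open>mild_solution_integral_in_generator\<close>; the forcing drops out
  because its first and third components vanish.
\<close>

lemma integrated_evolution:
  assumes t: "0 \<le> t"
  shows "u t = u0 0 + (LBINT r:{0..t}. velocity (U r))"
    and "0 < \<mu> s \<Longrightarrow> 0 \<le> s \<Longrightarrow> (LBINT r:{0..t}. history_primitive s (U r))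
      = (LBINT r:{0..s}. r *\<^sub>R (u t - u0 0) - (history_primitive r (U t) - history_primitive r (U 0)))"
    and "0 < \<mu> s \<Longrightarrow> 0 \<le> s \<Longrightarrow>
      set_integrable lborel {0..s} (\<lambda>r. r *\<^sub>R (u t - u0 0) - (history_primitive r (U t) - history_primitive r (U 0)))"
proof -
  define W where "W = (LBINT r:{0..t}. U r)"
  define z where "z = U t - U 0 - (LBINT s:{0..t}. f s)"
  have Ui: "set_integrable lborel {0..t} U"
    by (rule borel_integrable_atLeastAtMost'[OF continuous_on_subset[OF Uc]]) auto
  have "(W, z) \<in> evolution_graph D A V R \<mu> J"
    using mild_solution_integral_in_generator[OF t f U] generator U_zero by (auto simp: W_def z_def)
  note c = evolution_graph_components[OF this]
  interpret P: bounded_linear position by (rule bounded_linear_position)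
  have z: "position z = u t - u0 0"
    using position_U[OF t] position_U[of 0] u[of 0] forcing_components(1)[OF t] by (simp add: z_def P.diff)
  have "(LBINT r:{0..t}. velocity (U r)) = velocity W"
    unfolding W_def by (rule set_integral_bounded_linear(2)[OF bounded_linear_velocity Ui])
  then show "u t = u0 0 + (LBINT r:{0..t}. velocity (U r))" using c(1) z by simp
  assume s: "0 < \<mu> s" "0 \<le> s"
  have eq: "r *\<^sub>R position z - history_primitive r z
        = r *\<^sub>R (u t - u0 0) - (history_primitive r (U t) - history_primitive r (U 0))" if r: "r \<in> {0..s}" for r
  proof -
    have \<mu>r: "0 < \<mu> r" "0 \<le> r" using \<mu>_decreasing[of r s] r s by auto
    interpret H: bounded_linear "history_primitive r" by (rule bounded_linear_history_primitive[OF \<mu>r])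
    show ?thesis
      unfolding z by (simp add: z_def H.diff forcing_components(2)[OF t \<mu>r])
  qed
  have "(LBINT r:{0..t}. history_primitive s (U r)) = history_primitive s W"
    unfolding W_def by (rule set_integral_bounded_linear(2)[OF bounded_linear_history_primitive[OF s] Ui])
  also have "\<dots> = (LBINT r:{0..s}. r *\<^sub>R position z - history_primitive r z)" by (rule c(2)[OF s])
  also have "\<dots> = (LBINT r:{0..s}. r *\<^sub>R (u t - u0 0) - (history_primitive r (U t) - history_primitive r (U 0)))"
    by (rule set_lebesgue_integral_cong) (use eq in auto)
  finally show "(LBINT r:{0..t}. history_primitive s (U r))
      = (LBINT r:{0..s}. r *\<^sub>R (u t - u0 0) - (history_primitive r (U t) - history_primitive r (U 0)))" .
  show "set_integrable lborel {0..s} (\<lambda>r. r *\<^sub>R (u t - u0 0) - (history_primitive r (U t) - history_primitive r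
      (U 0)))"
    using c(3)[OF s] by (rule set_integrable_cong[THEN iffD1, rotated -1]) (use eq in auto)
qed

lemma trajectory_has_velocity:
  assumes t: "0 \<le> t"
  shows "(u has_vector_derivative velocity (U t)) (at t within {0..})"
proof -
  have "continuous_on {0..} (\<lambda>t. velocity (U t))"
    by (rule bounded_linear.continuous_on[OF bounded_linear_velocity Uc])
  from primitive_has_vector_derivative[OF this t]
  have "((\<lambda>t. u0 0 + (LBINT r:{0..t}. velocity (U r))) has_vector_derivative velocity (U t)) (at t within {0..})"
    using has_vector_derivative_add[OF has_vector_derivative_const] by fastforce
  then show ?thesis
    by (rule has_vector_derivative_transform[rotated -1]) (use integrated_evolution(1) t in auto)
qed

lemma trajectory_memory_in_L2mu: "0 \<le> t \<Longrightarrow> (\<lambda>s. u t - u (t - s)) \<in> L2mu V R \<mu>"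
  by (rule memory_of_trajectory_in_L2mu[OF Uc ini _ u]) (use position_U[of 0] u[of 0] in auto)

lemma trajectory_integrable:
  assumes s: "0 < \<mu> s" "0 \<le> s" and t: "0 \<le> t"
  shows "set_integrable lborel {- s..t} u"
proof -
  have "set_integrable lborel {0..s} (\<lambda>r. u0 0 - u0 (- r))"
    by (rule history_integrable(1)[OF initial_memory(2) s])
  then have "set_integrable lborel {- s..0} (\<lambda>r. u0 0 - u0 r)"
    using set_integrable_reflect[of 0 0 "- s" "\<lambda>r. u0 0 - u0 (- r)"] by simp
  moreover have c: "set_integrable lborel {- s..0} (\<lambda>r. u0 0)" by (rule borel_integrable_atLeastAtMost') auto
  ultimately have "set_integrable lborel {- s..0} (\<lambda>r. u0 0 - (u0 0 - u0 r))"
    using set_integral_diff(1) by blast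
  then have "set_integrable lborel {- s..0} u"
    by (rule set_integrable_cong[THEN iffD1, rotated -1]) (use u in auto)
  moreover have "set_integrable lborel {0..t} (\<lambda>r. position (U r))"
    by (rule borel_integrable_atLeastAtMost')
      (intro bounded_linear.continuous_on[OF bounded_linear_position] continuous_on_subset[OF Uc], auto)
  then have "set_integrable lborel {0..t} u"
    by (rule set_integrable_cong[THEN iffD1, rotated -1]) (use position_U in auto)
  ultimately have "set_integrable lborel ({- s..0} \<union> {0..t}) u"
    by (rule set_integrable_Un) auto
  then show ?thesis using s t by (simp add: ivl_disj_un_two_touch)
qed

text \<open>
  Both sides, as functions of \<open>t\<close> and \<open>s\<close>, satisfy the integrated transport equation with the same data
  at \<open>t = 0\<close> and at \<open>s = 0\<close>, so their difference is zero by \<open>transport_zero\<close>. For the left-hand side the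
  equation is \<open>integrated_evolution\<close>; for the right-hand side it is an identity between integrals of the
  primitive \<open>Ia\<close> of the scalar function \<open>a\<close>. Everything is tested with a fixed vector \<open>e\<close>, because the
  past of the trajectory is only locally integrable.
\<close>

lemma history_primitive_trajectory:
  assumes s: "0 < \<mu> s" "0 \<le> s" and t: "0 \<le> t"
  shows "history_primitive s (U t) = (LBINT r:{0..s}. u t - u (t - r))"
proof (rule vector_eq_rdot[THEN iffD1], rule allI)
  fix e
  \<comment> \<open>Any time interval of positive length that contains \<open>t\<close> would do.\<close>
  define c where "c = t + 1"
  have c: "0 < c" "t \<in> {0..c}" using t by (auto simp: c_def)
  define a where "a r = u r \<bullet> e" for r
  define p where "p r x = history_primitive r x \<bullet> e" for r x
  have pos: "0 < \<mu> r" "0 \<le> r" if "r \<in> {0..s}" for r using \<mu>_decreasing[of r s] that s by auto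
  have ai: "set_integrable lborel {- s..c} a"
    unfolding a_def using c
        by (intro set_integral_bounded_linear(1)[OF bounded_linear_inner_left] trajectory_integrable s) auto
  have ai': "set_integrable lborel {q..r} a" if "- s \<le> q" "r \<le> c" for q r
    by (rule set_integrable_subset[OF ai]) (use that in auto)
  define Ia where "Ia r = (LBINT q:{- s..r}. a q)" for r
  have Iac: "continuous_on {- s..c} Ia"
    unfolding Ia_def by (rule continuous_on_set_integral[OF ai])
  have Iadiff: "(LBINT r:{q..q'}. a r) = Ia q' - Ia q" if "- s \<le> q" "q \<le> q'" "q' \<le> c" for q q'
    using set_integral_split[OF ai', of "- s" q' q] that by (simp add: Ia_def)
  have ac: "continuous_on {0..c} a"
  proof -
    have "continuous_on {0..c} (\<lambda>r. position (U r) \<bullet> e)"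
      by (intro continuous_on_inner continuous_on_const bounded_linear.continuous_on[OF bounded_linear_position]
          continuous_on_subset[OF Uc]) auto
    then show ?thesis by (rule continuous_on_cong[THEN iffD1, rotated -1]) (use position_U in \<open>auto simp: a_def\<close>)
  qed
  have memory: "(LBINT q:{0..r}. u q' - u (q' - q)) \<bullet> e = r * a q' - (Ia q' - Ia (q' - r))"
    if q': "q' \<in> {0..c}" and r: "r \<in> {0..s}" for q' r
  proof -
    have i: "set_integrable lborel {0..r} (\<lambda>q. u q' - u (q' - q))"
      by (rule history_integrable(1)[OF trajectory_memory_in_L2mu pos[OF r]]) (use q' in simp)
    have ic: "set_integrable lborel {0..r} (\<lambda>q. a q')" by (rule borel_integrable_atLeastAtMost') auto
    have ir: "set_integrable lborel {0..r} (\<lambda>q. a (q' - q))"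
      by (rule set_integrable_reflect, rule ai') (use q' r in auto)
    have "(LBINT q:{0..r}. u q' - u (q' - q)) \<bullet> e = (LBINT q:{0..r}. a q' - a (q' - q))"
      using set_integral_bounded_linear(2)[OF bounded_linear_inner_left i, of e] by (simp add: a_def inner_diff_left)
    also have "\<dots> = r * a q' - (LBINT q:{0..r}. a (q' - q))"
      using set_integral_diff(2)[OF ic ir] r by (simp add: set_integral_const)
    also have "(LBINT q:{0..r}. a (q' - q)) = Ia q' - Ia (q' - r)"
      using q' r by (simp add: set_integral_reflect Iadiff)
    finally show ?thesis .
  qed
  define X where "X t r = p r (U t) - r * a t + (Ia t - Ia (t - r))" for t r
  have pc: "continuous_on ({0..c} \<times> {0..s}) (\<lambda>(t, r). p r (U t))"
    unfolding p_def by (rule history_primitive_continuous[OF s continuous_on_subset[OF Uc]]) auto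
  have Xc: "continuous_on ({0..c} \<times> {0..s}) (\<lambda>(t, r). X t r)"
  proof -
    have "continuous_on ({0..c} \<times> {0..s}) (\<lambda>z. a (fst z))"
      by (rule continuous_on_compose2[OF ac]) (auto intro: continuous_on_fst continuous_on_id)
    moreover have "continuous_on ({0..c} \<times> {0..s}) (\<lambda>z. Ia (fst z))"
      by (rule continuous_on_compose2[OF Iac]) (use s in \<open>auto intro: continuous_on_fst continuous_on_id\<close>)
    moreover have "continuous_on ({0..c} \<times> {0..s}) (\<lambda>z. Ia (fst z - snd z))"
      by (rule continuous_on_compose2[OF Iac])
        (intro continuous_on_diff continuous_on_fst continuous_on_snd continuous_on_id, auto)
    ultimately show ?thesis
      using pc unfolding X_def case_prod_unfold
      by (intro continuous_on_add continuous_on_diff continuous_on_mult continuous_on_snd continuous_on_id)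
  qed
  have p0: "p r (U 0) = r * a 0 - (Ia 0 - Ia (- r))" if r: "r \<in> {0..s}" for r
  proof -
    have "history_primitive r (U 0) = (LBINT q:{0..r}. u0 0 - u0 (- q))"
      unfolding U_zero initial_state_def by (rule history_primitive_J[OF initial_memory pos[OF r]])
    also have "\<dots> = (LBINT q:{0..r}. u 0 - u (0 - q))"
      by (rule set_lebesgue_integral_cong) (auto simp: u)
    finally show ?thesis unfolding p_def using memory[of 0 r] r c by simp
  qed
  have Ii: "Ia integrable_on {q..r}" if "- s \<le> q" "r \<le> c" for q r
    by (rule integrable_continuous_interval[OF continuous_on_subset[OF Iac]]) (use that in auto)
  have balance: "integral {0..t} (\<lambda>r. X r q) + integral {0..q} (X t)
      = 0" if t: "t \<in> {0..c}" and q: "q \<in> {0..s}" for t q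
  proof -
    have sub: "{0..q} \<subseteq> {0..s}" "{0..t} \<subseteq> {0..c}" using t q by auto
    have Ic: "continuous_on {q'..r} Ia" if "- s \<le> q'" "r \<le> c" for q' r
      by (rule continuous_on_subset[OF Iac]) (use that in auto)
    have pcq: "continuous_on {0..t} (\<lambda>r. p q (U r))"
      by (rule continuous_on_compose2[OF pc, of _ "\<lambda>r. (r, q)", simplified])
        (use t q in \<open>auto intro!: continuous_on_Pair continuous_on_id continuous_on_const\<close>)
    have pct: "continuous_on {0..q} (\<lambda>r. p r (U t))"
      by (rule continuous_on_compose2[OF pc, of _ "\<lambda>r. (t, r)", simplified])
        (use t q in \<open>auto intro!: continuous_on_Pair continuous_on_id continuous_on_const\<close>)
    have Im: "continuous_on {0..q} (\<lambda>r. Ia (- r))" and It: "continuous_on {0..q} (\<lambda>r. Ia (t - r))"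
      and Iq: "continuous_on {0..t} (\<lambda>r. Ia (r - q))"
      using t q c(1) by (auto intro!: continuous_on_compose2[OF Iac] continuous_on_minus continuous_on_diff
          continuous_on_const continuous_on_id)
    note HI = integrable_integral[OF integrable_continuous_interval]
    define P where "P = integral {0..q} (\<lambda>r. p r (U t))"
    define l where "l = integral {0..q} (\<lambda>r::real. r)"
    define m where "m = integral {0..q} (\<lambda>r. Ia (- r))"
    define n where "n = integral {0..q} (\<lambda>r. Ia (t - r))"
    define m' where "m' = integral {0..t} Ia"
    define n' where "n' = integral {0..t} (\<lambda>r. Ia (r - q))"
    define I1 where "I1 = integral {0..t} (\<lambda>r. p q (U r))"
    have hP: "((\<lambda>r. p r (U t)) has_integral P) {0..q}" unfolding P_def by (rule HI[OF pct])
    have hl: "((\<lambda>r::real. r) has_integral l) {0..q}" unfolding l_def by (rule HI[OF continuous_on_id])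
    have hm: "((\<lambda>r. Ia (- r)) has_integral m) {0..q}" unfolding m_def by (rule HI[OF Im])
    have hn: "((\<lambda>r. Ia (t - r)) has_integral n) {0..q}" unfolding n_def by (rule HI[OF It])
    have hm': "(Ia has_integral m') {0..t}" unfolding m'_def by (rule HI[OF Ic]) (use t s in auto)
    have hn': "((\<lambda>r. Ia (r - q)) has_integral n') {0..t}" unfolding n'_def by (rule HI[OF Iq])
    have hI: "((\<lambda>r. p q (U r)) has_integral I1) {0..t}" unfolding I1_def by (rule HI[OF pcq])
    have hk: "(a has_integral (Ia t - Ia 0)) {0..t}"
      using HI[OF continuous_on_subset[OF ac sub(2)]] set_integral_eq_integral[OF continuous_on_subset[OF ac sub(2)]]
        Iadiff[of 0 t] t s by simp
    have hc: "((\<lambda>r. z) has_integral q * z) {0..q}" for z :: real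
      using has_integral_const_real[of z 0 q] q by simp
    have A1: "integral {0..q} (X t) = P - l * a t + (q * Ia t - n)"
      unfolding X_def
      by (rule integral_unique) (intro has_integral_add has_integral_diff hP has_integral_mult_left hl hc hn)
    have B1: "integral {0..t} (\<lambda>r. X r q) = I1 - q * (Ia t - Ia 0) + (m' - n')"
      unfolding X_def
      by (rule integral_unique) (intro has_integral_add has_integral_diff hI has_integral_mult_right hk hm' hn')
    have I1: "I1 = (l * a t - P) - (q * Ia 0 - m)"
    proof -
      have Uq: "set_integrable lborel {0..t} (\<lambda>r. history_primitive q (U r))"
        by (rule borel_integrable_atLeastAtMost')
          (intro bounded_linear.continuous_on[OF bounded_linear_history_primitive[OF pos[OF q]]]
              continuous_on_subset[OF Uc], auto)
      have intq: "set_integrable lborel {0..q} (\<lambda>r. r *\<^sub>R (u t - u0 0) - (history_primitive r (U t) -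
          history_primitive r (U 0)))"
        by (rule integrated_evolution(3)[OF _ pos[OF q]]) (use t in simp)
      have "I1 = (LBINT r:{0..t}. p q (U r))"
        unfolding I1_def by (rule set_integral_eq_integral[OF pcq, symmetric])
      also have "\<dots> = (LBINT r:{0..t}. history_primitive q (U r)) \<bullet> e"
        unfolding p_def by (rule set_integral_bounded_linear(2)[OF bounded_linear_inner_left Uq])
      also have "\<dots> = (LBINT r:{0..q}. r *\<^sub>R (u t - u0 0) - (history_primitive r (U t) - history_primitive r
          (U 0))) \<bullet> e"
        using integrated_evolution(2)[OF _ pos[OF q]] t by simp
      also have "\<dots> = (LBINT r:{0..q}. (r *\<^sub>R (u t - u0 0) - (history_primitive r (U t) - history_primitive r
          (U 0))) \<bullet> e)"
        by (rule set_integral_bounded_linear(2)[OF bounded_linear_inner_left intq, symmetric])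
      also have "\<dots> = (LBINT r:{0..q}. (r * a t - p r (U t)) - (Ia 0 - Ia (- r)))"
      proof (rule set_lebesgue_integral_cong)
        show "\<forall>r. r \<in> {0..q} \<longrightarrow> (r *\<^sub>R (u t - u0 0) - (history_primitive r (U t) - history_primitive r (U 0))) \<bullet> e
           = (r * a t - p r (U t)) - (Ia 0 - Ia (- r))"
          using p0 sub(1) u[of 0] by (auto simp: p_def a_def inner_diff_left algebra_simps)
      qed simp
      also have "\<dots> = integral {0..q} (\<lambda>r. (r * a t - p r (U t)) - (Ia 0 - Ia (- r)))"
        by (rule set_integral_eq_integral)
          (intro continuous_on_diff continuous_on_mult continuous_on_id continuous_on_const pct Im)
      also have "\<dots> = (l * a t - P) - (q * Ia 0 - m)"
        by (rule integral_unique) (intro has_integral_diff hP has_integral_mult_left hl hc hm)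
      finally show ?thesis .
    qed
    \<comment> \<open>Two ways to split the integral of \<open>Ia\<close> over \<open>[- q, t]\<close>: at \<open>0\<close> and at \<open>t - q\<close>.\<close>
    have "m + m' = n' + n"
    proof -
      have Ib: "set_integrable lborel {- q..t} Ia"
        by (rule borel_integrable_atLeastAtMost'[OF Ic]) (use t q in auto)
      have "m = (LBINT r:{- q..0}. Ia r)"
        unfolding m_def set_integral_eq_integral[OF Im, symmetric]
        using set_integral_reflect[of 0 q Ia 0] by simp
      moreover have "m' = (LBINT r:{0..t}. Ia r)"
        unfolding m'_def by (rule set_integral_eq_integral[symmetric, OF Ic]) (use t s in auto)
      moreover have "n = (LBINT r:{t - q..t}. Ia r)"
        unfolding n_def set_integral_eq_integral[OF It, symmetric]
        using set_integral_reflect[of 0 q Ia t] by simp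
      moreover have "n' = (LBINT r:{- q..t - q}. Ia r)"
        unfolding n'_def set_integral_eq_integral[OF Iq, symmetric]
        using set_integral_shift[of 0 "- q" t Ia] by simp
      ultimately show ?thesis
        using set_integral_split[OF Ib, of 0] set_integral_split[OF Ib, of "t - q"] t q by simp
    qed
    then show ?thesis unfolding A1 B1 I1 by (simp add: algebra_simps)
  qed
  have "X t s = 0"
    by (rule transport_zero[OF Xc c(1) balance c(2)]) (use s in auto)
  then show "history_primitive s (U t) \<bullet> e = (LBINT r:{0..s}. u t - u (t - r)) \<bullet> e"
    using memory[OF c(2), of s] s by (simp add: X_def p_def)
qed

text \<open>
  The primitives of the two memory functions agree wherever \<open>\<mu>\<close> is positive, so the functions agree almost
  everywhere there, and then they have the same class.
\<close>

lemma trajectory_state: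
  assumes t: "0 \<le> t"
  shows "state u (\<lambda>t. velocity (U t)) t \<in> phase_carrier V R \<mu>" "J (state u (\<lambda>t. velocity (U t)) t) = U t"
proof -
  define \<eta> where "\<eta> s = u t - u (t - s)" for s
  have \<eta>: "\<eta> \<in> L2mu V R \<mu>" unfolding \<eta>_def by (rule trajectory_memory_in_L2mu[OF t])
  have uV: "u t \<in> V" using position_U[OF t] rep(1) by simp
  have st: "state u (\<lambda>t. velocity (U t)) t = (position (U t), velocity (U t), \<eta>)"
    using position_U[OF t] by (simp add: state_def \<eta>_def[abs_def])
  show "state u (\<lambda>t. velocity (U t)) t \<in> phase_carrier V R \<mu>"
    unfolding st carrier_iff using \<eta> rep(1) by simp
  have ae1: "AE r in lborel. r \<in> {0..s} \<longrightarrow> history (U t) r - \<eta> r = 0" if s: "0 < \<mu> s" "0 \<le> s" for s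
  proof (rule AE_zero_if_primitive_zero)
    show "set_integrable lborel {0..s} (\<lambda>r. history (U t) r - \<eta> r)"
      by (intro set_integral_diff(1) history_integrable(1) rep \<eta> s)
    fix q assume q: "q \<in> {0..s}"
    have \<mu>q: "0 < \<mu> q" "0 \<le> q" using \<mu>_decreasing[of q s] q s by auto
    have "(LBINT r:{0..q}. history (U t) r - \<eta> r) = history_primitive q (U t) - (LBINT r:{0..q}. \<eta> r)"
      unfolding history_primitive_def
      by (rule set_integral_diff(2)[OF history_integrable(1)[OF rep(2) \<mu>q] history_integrable(1)[OF \<eta> \<mu>q]])
    then show "(LBINT r:{0..q}. history (U t) r - \<eta> r) = 0"
      using history_primitive_trajectory[OF \<mu>q t] by (simp add: \<eta>_def)
  qed (use s in auto)
  \<comment> \<open>Rational upper limits suffice, because \<open>\<mu>\<close> stays positive a little to the right of each point.\<close>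
  have "AE r in lborel. \<forall>s\<in>\<rat>. 0 < \<mu> s \<longrightarrow> 0 \<le> s \<longrightarrow> r \<in> {0..s} \<longrightarrow> history (U t) r - \<eta> r = 0"
    using ae1 by (intro AE_ball_countable[THEN iffD2] countable_rat) auto
  then have "AE r in lborel. 0 < r \<longrightarrow> 0 < \<mu> r \<longrightarrow> history (U t) r = \<eta> r"
  proof eventually_elim
    case (elim r)
    show ?case
    proof (intro impI)
      assume r: "0 < r" "0 < \<mu> r"
      obtain s where s: "r < s" "0 < \<mu> s" using \<mu>_pos_room[of r] r by auto
      obtain q where q: "q \<in> \<rat>" "r < q" "q < s" using Rats_dense_in_real[OF s(1)] by blast
      have "0 < \<mu> q" using \<mu>_decreasing[of q s] q r s by auto
      then show "history (U t) r = \<eta> r" using elim q r by auto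
    qed
  qed
  then have z: "(LBINT r:{0<..}. \<mu> r * (norm (R (history (U t) r - \<eta> r)))\<^sup>2) = 0"
    using history_AE[OF rep(2) \<eta>] by blast
  have "J (position (U t) - position (U t), velocity (U t) - velocity (U t), \<lambda>s. history (U t) s - \<eta> s)
      = U t - J (position (U t), velocity (U t), \<eta>)"
    using J_diff[OF rep(1)[of "U t"] rep(2)[of "U t"] rep(1)[of "U t"] \<eta>, where v = "velocity (U t)" and v'
        = "velocity (U t)"] by (simp add: rep(3))
  moreover have "(norm (J (0, 0, \<lambda>s. history (U t) s - \<eta> s)))\<^sup>2 = 0"
    using J_norm[OF subspace_0[OF subspace_V] L2mu_diff[OF rep(2) \<eta>], of 0] z by (simp add: R_simps(3))
  ultimately show "J (state u (\<lambda>t. velocity (U t)) t) = U t"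
    unfolding st by simp
qed

end
end

section \<open>Small data\<close>

text \<open>
  The radial retraction onto the ball of radius \<open>r\<close>.
\<close>

definition truncate :: "real \<Rightarrow> 'a::real_normed_vector \<Rightarrow> 'a" where
  "truncate r x = (r / max r (norm x)) *\<^sub>R x"

lemma truncate_id: "0 < r \<Longrightarrow> norm x \<le> r \<Longrightarrow> truncate r x = x"
  by (simp add: truncate_def)

lemma norm_truncate_le:
  assumes "0 < r" shows "norm (truncate r x) \<le> r" "norm (truncate r x) \<le> norm x"
proof -
  have m: "0 < max r (norm x)" using assms by simp
  have "r * norm x \<le> r * max r (norm x)" using assms by (intro mult_left_mono) auto
  then show "norm (truncate r x) \<le> r"
    using assms m by (simp add: truncate_def divide_le_eq)
  have "r * norm x \<le> max r (norm x) * norm x" by (intro mult_right_mono) auto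
  then show "norm (truncate r x) \<le> norm x"
    using assms m by (simp add: truncate_def divide_le_eq mult.commute)
qed

lemma truncate_lipschitz:
  assumes r: "0 < r" shows "norm (truncate r x - truncate r y) \<le> 2 * norm (x - y)"
proof -
  define p where "p = max r (norm x)"
  define q where "q = max r (norm y)"
  have p: "0 < p" "r \<le> p" and q: "0 < q" "norm y \<le> q" using r by (auto simp: p_def q_def)
  have pq: "\<bar>q - p\<bar> \<le> norm (x - y)"
    using norm_triangle_ineq3[of x y] by (auto simp: p_def q_def)
  have "truncate r x - truncate r y = (r / p) *\<^sub>R (x - y) + (r / p - r / q) *\<^sub>R y"
    by (simp add: truncate_def p_def[symmetric] q_def[symmetric] scaleR_diff_right scaleR_diff_left)
  then have "norm (truncate r x - truncate r y) \<le> (r / p) * norm (x - y) + \<bar>r / p - r / q\<bar> * norm y"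
    using norm_triangle_ineq[of "(r / p) *\<^sub>R (x - y)" "(r / p - r / q) *\<^sub>R y"] p r by simp
  also have "\<bar>r / p - r / q\<bar> = (r / p) * (\<bar>q - p\<bar> / q)"
  proof -
    have "r / p - r / q = (r / p) * ((q - p) / q)" using p q by (simp add: field_simps)
    then show ?thesis using p q r by (simp add: abs_mult)
  qed
  also have "(r / p) * norm (x - y) + (r / p) * (\<bar>q - p\<bar> / q) * norm y \<le> 1 * norm (x - y) + 1 * norm (x - y)"
  proof (rule add_mono)
    show "(r / p) * norm (x - y) \<le> 1 * norm (x - y)"
      using p r by (intro mult_right_mono) auto
    have "\<bar>q - p\<bar> / q * norm y \<le> \<bar>q - p\<bar>"
      using q mult_left_mono[of "norm y" q "\<bar>q - p\<bar>"] by (simp add: divide_le_eq)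
    then have "(r / p) * (\<bar>q - p\<bar> / q * norm y) \<le> 1 * norm (x - y)"
      using p r q pq by (intro mult_mono) auto
    then show "(r / p) * (\<bar>q - p\<bar> / q) * norm y \<le> 1 * norm (x - y)" by (simp add: mult.assoc)
  qed
  finally show ?thesis by simp
qed

text \<open>
  The mean value theorem along the segment from \<open>0\<close> to \<open>u\<close>.
\<close>

lemma potential_bound:
  assumes der: "\<And>u. u \<in> V \<Longrightarrow> gateaux_derivative_on V \<psi> u (D\<psi> u)"
    and grad: "\<And>u v. u \<in> V \<Longrightarrow> v \<in> V \<Longrightarrow> G u \<bullet> v = D\<psi> u v"
    and V: "subspace V" and "\<psi> 0 = 0" and u: "u \<in> V"
    and G: "\<And>z. 0 \<le> z \<Longrightarrow> z \<le> 1 \<Longrightarrow> norm (G (z *\<^sub>R u)) \<le> K"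
  shows "\<bar>\<psi> u\<bar> \<le> K * norm u"
proof -
  have zu: "z *\<^sub>R u \<in> V" for z using subspace_scale[OF V u] .
  have "((\<lambda>z. \<psi> (z *\<^sub>R u)) has_real_derivative D\<psi> (z *\<^sub>R u) u) (at z)" for z
    using der[OF zu] u unfolding gateaux_derivative_on_def has_field_derivative_def DERIV_def[symmetric]
    by (simp add: DERIV_def has_field_derivative_def[symmetric] scaleR_add_left)
  then obtain z where z: "0 < z" "z < 1" "\<psi> (1 *\<^sub>R u) - \<psi> (0 *\<^sub>R u) = (1 - 0) * D\<psi> (z *\<^sub>R u) u"
    using MVT2[of 0 1 "\<lambda>z. \<psi> (z *\<^sub>R u)" "\<lambda>z. D\<psi> (z *\<^sub>R u) u"] by auto
  have "\<bar>\<psi> u\<bar> = \<bar>G (z *\<^sub>R u) \<bullet> u\<bar>" using z(3) grad[OF zu u] \<open>\<psi> 0 = 0\<close> by simp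
  also have "\<dots> \<le> norm (G (z *\<^sub>R u)) * norm u" by (rule Cauchy_Schwarz_ineq2)
  also have "\<dots> \<le> K * norm u" by (intro mult_right_mono G) (use z in auto)
  finally show ?thesis .
qed

context memory_phase_space
begin

text \<open>
  The states that change only the velocity. Both the delayed feedback and the source have values of this form.
\<close>

definition kick :: "'h \<Rightarrow> 'x" where "kick y = J (0, y, \<lambda>_. 0)"

lemma norm_kick: "norm (kick y) = norm y"
proof -
  have "(norm (kick y))\<^sup>2 = (norm y)\<^sup>2"
    unfolding kick_def using J_norm[OF subspace_0[OF subspace_V] L2mu_const[OF subspace_0[OF subspace_V]], of y]
    by (simp add: R_simps(3))
  then show ?thesis by simp
qed

lemma kick_add: "kick (y + z) = kick y + kick z" and kick_scale: "kick (c *\<^sub>R y) = c *\<^sub>R kick y"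
  unfolding kick_def
  using J_add[OF subspace_0[OF subspace_V] L2mu_const[OF subspace_0[OF subspace_V]] subspace_0[OF subspace_V]
      L2mu_const[OF subspace_0[OF subspace_V]], of y z]
    J_scale[OF subspace_0[OF subspace_V] L2mu_const[OF subspace_0[OF subspace_V]], of c y] by simp_all

lemma kick_diff: "kick (y - z) = kick y - kick z"
  using kick_add[of y "(-1) *\<^sub>R z"] kick_scale[of "-1" z] by simp

end

locale delayed_memory_system = memory_evolution D V A R \<mu> J S M \<omega>
  for D V :: "'h::{real_inner, banach, second_countable_topology} set" and A R :: "'h \<Rightarrow> 'h"
    and \<mu> :: "real \<Rightarrow> real"
    and J :: "'h \<times> 'h \<times> (real \<Rightarrow> 'h) \<Rightarrow> 'x::{real_inner, banach, second_countable_topology}"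
    and S :: "real \<Rightarrow> 'x \<Rightarrow> 'x" and M \<omega> :: real +
  fixes B G :: "'h \<Rightarrow> 'h" and \<tau> :: real and k :: "real \<Rightarrow> real" and \<psi> :: "'h \<Rightarrow> real"
    and D\<psi> :: "'h \<Rightarrow> 'h \<Rightarrow> real"
  assumes delay: "0 < \<tau>" and B: "bounded_linear B"
    and coefficient: "delay_coefficient \<tau> k"
    and source: "admissible_source V R \<psi> D\<psi> G"
begin

definition feedback :: "'x \<Rightarrow> 'x" where "feedback x = kick (B (adjoint B (velocity x)))"
definition source_field :: "'x \<Rightarrow> 'x" where "source_field x = kick (G (position x))"

lemma feedback_J: "p \<in> phase_carrier V R \<mu> \<Longrightarrow> J (delay_op B p) = feedback (J p)"
  by (cases p) (auto simp: feedback_def kick_def phase_carrier_def velocity_J)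

lemma source_field_J: "p \<in> phase_carrier V R \<mu> \<Longrightarrow> J (source_op G p) = source_field (J p)"
  by (cases p) (auto simp: source_field_def kick_def phase_carrier_def position_J)

lemma feedback_bound: "norm (feedback x) \<le> (onorm B)\<^sup>2 * norm x"
proof -
  have "norm (feedback x) \<le> onorm B * norm (adjoint B (velocity x))"
    unfolding feedback_def norm_kick by (rule onorm[OF B])
  also have "\<dots> \<le> onorm B * (onorm B * norm x)"
    using norm_adjoint_le[OF B, of "velocity x"] velocity_bound[of x] onorm_pos_le[OF B]
    by (intro mult_left_mono order_trans[OF norm_adjoint_le[OF B] mult_left_mono]) auto
  finally show ?thesis by (simp add: power2_eq_square mult.assoc)
qed

lemma bounded_linear_feedback: "bounded_linear feedback"
proof (rule bounded_linear_intro[where K = "(onorm B)\<^sup>2"])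
  note l = linear_adjoint[OF B]
  show "feedback (x + y) = feedback x + feedback y" for x y
    by (simp add: feedback_def linear_velocity linear_add[OF l] linear_add[OF bounded_linear.linear[OF B]] kick_add)
  show "feedback (c *\<^sub>R x) = c *\<^sub>R feedback x" for c x
    by (simp add: feedback_def linear_velocity linear_scale[OF l] linear_scale[OF bounded_linear.linear[OF B]]
        kick_scale)
  show "norm (feedback x) \<le> norm x * (onorm B)\<^sup>2" for x
    using feedback_bound[of x] by (simp add: mult.commute)
qed

lemma k_integrable: "0 \<le> t \<Longrightarrow> set_integrable lborel {0..t} k"
  using coefficient by (simp add: delay_coefficient_def)

lemma source_field_lipschitz:
  assumes "0 < r"
  shows "\<exists>L\<ge>0. \<forall>x\<in>cball 0 r. \<forall>y\<in>cball 0 r. norm (source_field x - source_field y) \<le> L * norm (x - y)"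
proof -
  define \<kappa> where "\<kappa> = sqrt (1 - mu_tilde \<mu>)"
  have \<kappa>: "0 < \<kappa>" using \<mu>_tilde by (simp add: \<kappa>_def)
  have "0 < r / \<kappa>" using assms \<kappa> by simp
  moreover have "\<forall>r>0. \<exists>L>0. \<forall>u\<in>V. \<forall>v\<in>V. norm (R u) \<le> r \<longrightarrow> norm (R v) \<le> r \<longrightarrow>
      norm (G u - G v) \<le> L * norm (R (u - v))"
    using source unfolding admissible_source_def by (elim conjE)
  ultimately have "\<exists>L>0. \<forall>u\<in>V. \<forall>v\<in>V. norm (R u) \<le> r / \<kappa> \<longrightarrow> norm (R v) \<le> r / \<kappa> \<longrightarrow>
      norm (G u - G v) \<le> L * norm (R (u - v))"
    by simp
  then obtain L where L: "0 < L" "\<And>u v. u \<in> V \<Longrightarrow> v \<in> V \<Longrightarrow> norm (R u) \<le> r / \<kappa> \<Longrightarrow> norm (R v) \<le> r / \<kappa>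
      \<Longrightarrow> norm (G u - G v) \<le> L * norm (R (u - v))"
    by auto
  interpret P: bounded_linear position by (rule bounded_linear_position)
  have "norm (source_field x - source_field y) \<le> L / \<kappa> * norm (x - y)" if "x \<in> cball 0 r" "y \<in> cball 0 r" for x y
  proof -
    have le: "norm (R (position z)) \<le> r / \<kappa>" if "z \<in> cball 0 r" for z
      using R_position_bound[of z] divide_right_mono[of "norm z" r \<kappa>] that \<kappa> by (simp add: \<kappa>_def)
    have "norm (source_field x - source_field y) = norm (G (position x) - G (position y))"
      by (simp add: source_field_def kick_diff[symmetric] norm_kick)
    also have "\<dots> \<le> L * norm (R (position x - position y))"
      by (rule L(2)[OF rep(1) rep(1) le le]) (use that in auto)
    also have "\<dots> \<le> L * (norm (x - y) / \<kappa>)"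
      using R_position_bound[of "x - y"] L(1) by (intro mult_left_mono) (auto simp: P.diff \<kappa>_def)
    finally show ?thesis by simp
  qed
  then show ?thesis using L(1) \<kappa> by (intro exI[of _ "L / \<kappa>"]) auto
qed

text \<open>
  The modulus \<open>h\<close> is continuous and vanishes at \<open>0\<close>, so on a small ball the source is bounded by an
  arbitrarily small multiple of the norm, and the potential by a multiple of its square.
\<close>

lemma source_small:
  assumes "0 < e"
  shows "\<exists>r>0. (\<forall>x. norm x \<le> r \<longrightarrow> norm (source_field x) \<le> e * norm x) \<and>
     (\<exists>K\<ge>0. \<forall>x. norm x \<le> r \<longrightarrow> \<bar>\<psi> (position x)\<bar> \<le> K * (norm x)\<^sup>2)"
proof -
  define \<kappa> where "\<kappa> = sqrt (1 - mu_tilde \<mu>)"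
  have \<kappa>: "0 < \<kappa>" using \<mu>_tilde by (simp add: \<kappa>_def)
  obtain h where h: "strict_mono_on {0..} h" "continuous_on {0..} h" "h 0 = 0"
    "\<And>u. u \<in> V \<Longrightarrow> norm (G u) \<le> h (norm (R u)) * norm (R u)"
  proof -
    have "\<exists>h::real \<Rightarrow> real. strict_mono_on {0..} h \<and> continuous_on {0..} h \<and> h 0 = 0 \<and>
        (\<forall>u\<in>V. norm (G u) \<le> h (norm (R u)) * norm (R u))"
      using source unfolding admissible_source_def by (elim conjE)
    then show ?thesis using that by auto
  qed
  have hmono: "h p \<le> h q" if "0 \<le> p" "p \<le> q" for p q :: real
    using strict_mono_onD[OF h(1), of p q] that by (cases "p = q") auto
  have "\<exists>d>0. \<forall>p\<in>{0..}. dist p 0 < d \<longrightarrow> dist (h p) (h 0) < e * \<kappa>"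
    using h(2) assms \<kappa> unfolding continuous_on_iff by (metis atLeast_iff mult_pos_pos order_refl)
  then obtain d where d: "0 < d" "\<And>p. 0 \<le> p \<Longrightarrow> p < d \<Longrightarrow> \<bar>h p\<bar> < e * \<kappa>"
    using h(3) by (auto simp: dist_real_def)
  define r where "r = \<kappa> * (d / 2)"
  have r: "0 < r" using \<kappa> d by (simp add: r_def)
  have small: "norm (R (position x)) \<le> norm x / \<kappa>" "norm (R (position x)) < d" if "norm x \<le> r" for x
  proof -
    show a: "norm (R (position x)) \<le> norm x / \<kappa>" using R_position_bound[of x] by (simp add: \<kappa>_def)
    also have "\<dots> \<le> r / \<kappa>" using that \<kappa> by (simp add: divide_right_mono)
    also have "\<dots> < d" using \<kappa> d by (simp add: r_def)
    finally show "norm (R (position x)) < d" .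
  qed
  have G1: "norm (G (z *\<^sub>R position x)) \<le> e * norm x" if x: "norm x \<le> r" and z: "0 \<le> z" "z \<le> 1" for x z
  proof -
    let ?p = "norm (R (z *\<^sub>R position x))"
    have p: "?p \<le> norm (R (position x))"
      using z mult_right_mono[of z 1 "norm (R (position x))"] by (simp add: R_simps rep)
    have "norm (G (z *\<^sub>R position x)) \<le> h ?p * ?p"
      by (rule h(4)[OF subspace_scale[OF subspace_V rep(1)]])
    also have "\<dots> \<le> (e * \<kappa>) * (norm x / \<kappa>)"
      using d(2)[of ?p] small[OF x] p by (intro mult_mono) (use hmono[of 0 ?p] h(3) assms \<kappa> in auto)
    finally show ?thesis using \<kappa> by simp
  qed
  have f: "norm (source_field x) \<le> e * norm x" if "norm x \<le> r" for x
    using G1[OF that, of 1] by (simp add: source_field_def norm_kick)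
  obtain c where c: "0 < c" "\<And>x. norm (position x) \<le> norm x * c"
    using bounded_linear.pos_bounded[OF bounded_linear_position] by blast
  have p: "\<bar>\<psi> (position x)\<bar> \<le> (e * c) * (norm x)\<^sup>2" if x: "norm x \<le> r" for x
  proof -
    have "\<bar>\<psi> (position x)\<bar> \<le> (e * norm x) * norm (position x)"
      by (rule potential_bound[where V = V and G = G and D\<psi> = D\<psi>, OF _ _ subspace_V _ rep(1) G1[OF x]])
        (use source in \<open>auto simp: admissible_source_def\<close>)
    also have "\<dots> \<le> (e * norm x) * (norm x * c)"
      using assms by (intro mult_left_mono c) auto
    finally show ?thesis by (simp add: power2_eq_square mult_ac)
  qed
  show ?thesis using r f p assms c(1) by (intro exI[of _ r] conjI exI[of _ "e * c"]) auto
qed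

lemma mild_solution_equation:
  assumes sol: "mild_solution V R \<mu> J S B \<tau> k G u0 u1 g I v vt" and I: "I = {0..} \<or> I = {0..T}" and t: "t \<in> I"
  defines "W \<equiv> (\<lambda>t. J (state v vt t))"
  shows "W t = S t (J (initial_state u0 u1))
      + duhamel (delayed_rhs k \<tau> (\<lambda>s. J (g_tilde B \<tau> g s)) feedback source_field W) t"
proof -
  have car: "state v vt s \<in> phase_carrier V R \<mu>" if "s \<in> I" for s
    using sol that by (simp add: mild_solution_def)
  have "W t = S t (J (initial_state u0 u1)) + (LBINT s:{0..t}. S (t - s)
                   (- k s *\<^sub>R (if s \<le> \<tau> then J (g_tilde B \<tau> g s)
                                else J (delay_op B (state v vt (s - \<tau>))))
                    + J (source_op G (state v vt s))))"
    using sol t unfolding mild_solution_def W_def Let_def by blast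
  also have "(LBINT s:{0..t}. S (t - s)
                   (- k s *\<^sub>R (if s \<le> \<tau> then J (g_tilde B \<tau> g s)
                                else J (delay_op B (state v vt (s - \<tau>))))
                    + J (source_op G (state v vt s))))
     = duhamel (delayed_rhs k \<tau> (\<lambda>s. J (g_tilde B \<tau> g s)) feedback source_field W) t"
    unfolding duhamel_def
  proof (rule set_lebesgue_integral_cong)
    show "\<forall>s. s \<in> {0..t} \<longrightarrow> S (t - s) (- k s *\<^sub>R (if s \<le> \<tau> then J (g_tilde B \<tau> g s)
                                else J (delay_op B (state v vt (s - \<tau>)))) + J (source_op G (state v vt s)))
       = S (t - s) (delayed_rhs k \<tau> (\<lambda>s. J (g_tilde B \<tau> g s)) feedback source_field W s)"
    proof (intro allI impI)
      fix s assume s: "s \<in> {0..t}"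
      have "s \<in> I" using s t I by auto
      moreover have "s - \<tau> \<in> I" if "\<not> s \<le> \<tau>" using that s t I delay by auto
      ultimately show "S (t - s) (- k s *\<^sub>R (if s \<le> \<tau> then J (g_tilde B \<tau> g s)
                                else J (delay_op B (state v vt (s - \<tau>)))) + J (source_op G (state v vt s)))
       = S (t - s) (delayed_rhs k \<tau> (\<lambda>s. J (g_tilde B \<tau> g s)) feedback source_field W s)"
        by (auto simp: delayed_rhs_def W_def feedback_J car source_field_J)
    qed
  qed simp
  finally show ?thesis .
qed

lemma mild_solution_unique:
  assumes data: "admissible_data V R \<mu> J B \<tau> k u0 u1 g"
    and sol: "mild_solution V R \<mu> J S B \<tau> k G u0 u1 g {0..} u ut"
    and sol': "mild_solution V R \<mu> J S B \<tau> k G u0 u1 g {0..T} v vt"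
    and t: "t \<in> {0..T}"
  shows "v t = u t"
proof -
  define U where "U t = J (state u ut t)" for t
  define W where "W t = J (state v vt t)" for t
  have Uc: "continuous_on {0..T} U"
    by (rule continuous_on_subset[of "{0..}"]) (use sol in \<open>auto simp: mild_solution_def U_def[abs_def]\<close>)
  have Wc: "continuous_on {0..T} W"
    using sol' by (simp add: mild_solution_def W_def[abs_def])
  have "bounded (U ` {0..T} \<union> W ` {0..T})"
    using compact_continuous_image[OF Uc] compact_continuous_image[OF Wc] compact_imp_bounded by auto
  then obtain r where r: "0 < r" "\<And>y. y \<in> U ` {0..T} \<union> W ` {0..T} \<Longrightarrow> norm y \<le> r"
    unfolding bounded_pos by blast
  obtain L where L: "0 \<le> L" "\<And>x y. x \<in> cball 0 r \<Longrightarrow> y \<in> cball 0 r \<Longrightarrow> norm (source_field x - source_field y)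
      \<le> L * norm (x - y)"
    using source_field_lipschitz[OF r(1)] by blast
  have "U t = W t"
  proof (rule delayed_evolution_unique[where Y = "cball 0 r" and N = source_field and L = L and C = feedback and k
      = k and \<tau> = \<tau>
        and \<phi> = "\<lambda>s. J (g_tilde B \<tau> g s)" and x = "J (initial_state u0 u1)"])
    show "continuous_on {0..\<tau>} (\<lambda>s. J (g_tilde B \<tau> g s))" using data by (simp add: admissible_data_def)
    show "continuous_on {0..t} U" "continuous_on {0..t} W"
      using t continuous_on_subset[OF Uc] continuous_on_subset[OF Wc] by auto
    show "U ` {0..t} \<subseteq> cball 0 r" "W ` {0..t} \<subseteq> cball 0 r" using r(2) t by auto
    show "U s = S s (J (initial_state u0 u1))
        + duhamel (delayed_rhs k \<tau> (\<lambda>s. J (g_tilde B \<tau> g s)) feedback source_field U) s"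
      if "s \<in> {0..t}" for s
      using mild_solution_equation[OF sol, of T s] that unfolding U_def[abs_def] by auto
    show "W s = S s (J (initial_state u0 u1))
        + duhamel (delayed_rhs k \<tau> (\<lambda>s. J (g_tilde B \<tau> g s)) feedback source_field W) s"
      if "s \<in> {0..t}" for s
      using mild_solution_equation[OF sol', of T s] that t unfolding W_def[abs_def] by auto
  qed (use t delay k_integrable bounded_linear_feedback L in auto)
  then have eq: "J (state u ut t) = J (state v vt t)" by (simp add: U_def W_def)
  have "state u ut t \<in> phase_carrier V R \<mu>" "state v vt t \<in> phase_carrier V R \<mu>"
    using sol sol' t by (auto simp: mild_solution_def)
  then show ?thesis using J_inject(1)[OF _ _ _ _ eq[unfolded state_def]] by (auto simp: state_def phase_carrier_def)
qed

text \<open>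
  The source is replaced by its composition with \<open>truncate r\<close>. For that equation the decay estimate
  bounds the solution by \<open>r\<close>, and in the ball of radius \<open>r\<close> the truncation is the identity.
\<close>

lemma small_solution_exists:
  assumes data: "admissible_data V R \<mu> J B \<tau> k u0 u1 g"
    and growth: "\<And>t. 0 \<le> t \<Longrightarrow> (onorm B)\<^sup>2 * M * exp (\<omega> * \<tau>) * (LBINT s:{0..t}. \<bar>k (s + \<tau>)\<bar>) \<le> \<gamma> + \<omega>' * t"
    and r: "0 < r" and e: "0 \<le> e" "\<And>x. norm x \<le> r \<Longrightarrow> norm (source_field x) \<le> e * norm x"
    and rate: "0 \<le> \<omega> - \<omega>' - M * e"
    and small: "M * (norm (J (initial_state u0 u1)) + exp (\<omega> * \<tau>) * (LBINT s:{0..\<tau>}. \<bar>k s\<bar> * norm (B (g (s - \<tau>)))))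
       * exp \<gamma> \<le> r"
  shows "\<exists>u ut. mild_solution V R \<mu> J S B \<tau> k G u0 u1 g {0..} u ut \<and>
     (\<forall>t\<ge>0. norm (J (state u ut t)) \<le> r * exp (- (\<omega> - \<omega>' - M * e) * t))"
proof -
  define x where "x = J (initial_state u0 u1)"
  define \<phi> where "\<phi> s = J (g_tilde B \<tau> g s)" for s
  define N where "N y = source_field (truncate r y)" for y
  have \<phi>: "continuous_on {0..\<tau>} \<phi>" using data by (simp add: admissible_data_def \<phi>_def[abs_def])
  have \<phi>_kick: "\<phi> s = kick (B (g (s - \<tau>)))" for s by (simp add: \<phi>_def g_tilde_def kick_def)
  obtain K where K: "\<And>t. 0 < t \<Longrightarrow> (LBINT s:{max 0 (t - \<tau>)..t}. \<bar>k s\<bar>) \<le> K"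
    using coefficient unfolding delay_coefficient_def by (meson less_imp_le)
  obtain L where L: "0 \<le> L" "\<And>x y. x \<in> cball 0 r \<Longrightarrow> y \<in> cball 0 r \<Longrightarrow> norm (source_field x - source_field y)
      \<le> L * norm (x - y)"
    using source_field_lipschitz[OF r] by blast
  have NL: "norm (N y - N z) \<le> (L * 2) * norm (y - z)" for y z
  proof -
    have "norm (N y - N z) \<le> L * norm (truncate r y - truncate r z)"
      unfolding N_def by (rule L(2)) (use norm_truncate_le[OF r] in auto)
    also have "\<dots> \<le> L * (2 * norm (y - z))" by (intro mult_left_mono truncate_lipschitz r L)
    finally show ?thesis by simp
  qed
  have Ne: "norm (N y) \<le> e * norm y" for y
    unfolding N_def using order_trans[OF e(2)[OF norm_truncate_le(1)[OF r]] mult_left_mono[OF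
        norm_truncate_le(2)[OF r] e(1)]] .
  have N0: "N 0 = 0" using Ne[of 0] by simp
  have "(L * 2)-lipschitz_on UNIV N"
    by (rule lipschitz_onI) (use NL L in \<open>auto simp: dist_norm\<close>)
  then have Nc: "continuous_on UNIV N" by (rule lipschitz_on_continuous_on)
  obtain U where U: "continuous_on {0..} U" "\<And>t. 0 \<le> t \<Longrightarrow> U t = S t x + duhamel (delayed_rhs k \<tau> \<phi> feedback N U) t"
    using delayed_evolution_exists[OF k_integrable K delay \<phi> bounded_linear_feedback NL N0] by blast
  have Ub: "norm (U t) \<le> r * exp (- (\<omega> - \<omega>' - M * e) * t)" if "0 \<le> t" for t
  proof -
    have "norm (U t) \<le> M * (norm x + exp (\<omega> * \<tau>) * (LBINT s:{0..\<tau>}. \<bar>k s\<bar> * norm (\<phi> s)))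
      * exp \<gamma> * exp (- (\<omega> - \<omega>' - M * e) * t)"
      by (rule delayed_evolution_decay[OF k_integrable delay \<phi> bounded_linear_feedback zero_le_power2
          feedback_bound Nc e(1) Ne U growth that])
    also have "\<dots> \<le> r * exp (- (\<omega> - \<omega>' - M * e) * t)"
      using small by (intro mult_right_mono) (auto simp: x_def \<phi>_kick norm_kick)
    finally show ?thesis .
  qed
  have Ur: "norm (U t) \<le> r" if "0 \<le> t" for t
  proof -
    have "0 \<le> (\<omega> - \<omega>' - M * e) * t" using rate that by (rule mult_nonneg_nonneg)
    then have "exp (- (\<omega> - \<omega>' - M * e) * t) \<le> 1" by (simp only: mult_minus_left exp_le_one_iff neg_le_0_iff_le)
    then have "r * exp (- (\<omega> - \<omega>' - M * e) * t) \<le> r * 1"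
      using r by (intro mult_left_mono) auto
    then show ?thesis using Ub[OF that] by simp
  qed
  define f where "f = delayed_rhs k \<tau> \<phi> feedback source_field U"
  have f_eq: "delayed_rhs k \<tau> \<phi> feedback N U s = f s" if "0 \<le> s" for s
    using Ur[OF that] r by (simp add: f_def delayed_rhs_def N_def truncate_id)
  have fi: "set_integrable lborel {0..t} f" if "0 \<le> t" for t
  proof -
    have "continuous_on {0..t} U" using U(1) by (rule continuous_on_subset) auto
    then have "set_integrable lborel {0..t} (delayed_rhs k \<tau> \<phi> feedback N U)"
      by (rule set_integrable_delayed_rhs[OF k_integrable[OF that] _ \<phi> delay that bounded_linear_feedback
            continuous_on_subset[OF Nc subset_UNIV]])
    then show ?thesis
      by (rule set_integrable_cong[THEN iffD1, rotated -1]) (use f_eq in auto)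
  qed
  have Uf: "U t = S t (J (initial_state u0 u1)) + duhamel f t" if "0 \<le> t" for t
  proof -
    have "duhamel (delayed_rhs k \<tau> \<phi> feedback N U) t = duhamel f t"
      unfolding duhamel_def by (rule set_lebesgue_integral_cong) (use f_eq in auto)
    then show ?thesis using U(2)[OF that] by (simp add: x_def)
  qed
  have forcing_form: "\<exists>y. f s = J (0, y, \<lambda>_. 0)" for s
  proof -
    have "\<exists>y. f s = kick y"
      unfolding f_def delayed_rhs_def \<phi>_kick feedback_def source_field_def
      by (cases "s \<le> \<tau>") (auto simp: kick_scale[symmetric] kick_add[symmetric] simp del: scaleR_minus_left)
    then show ?thesis by (simp add: kick_def)
  qed
  have ini: "initial_state u0 u1 \<in> phase_carrier V R \<mu>" using data by (simp add: admissible_data_def)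
  define u where "u t = (if t \<le> 0 then u0 t else position (U t))" for t
  define ut where "ut t = velocity (U t)" for t
  note traj = ini fi forcing_form U(1) Uf u_def
  have st: "state u ut t \<in> phase_carrier V R \<mu>" "J (state u ut t) = U t" if "0 \<le> t" for t
    unfolding ut_def[abs_def] using trajectory_state[OF traj that] by auto
  have "mild_solution V R \<mu> J S B \<tau> k G u0 u1 g {0..} u ut"
    unfolding mild_solution_def Let_def
  proof (intro conjI ballI allI impI)
    show "ut 0 = u1" unfolding ut_def by (rule velocity_U_zero[OF traj])
    show "(u has_vector_derivative ut t) (at t within {0..})" if "t \<in> {0..}" for t
      unfolding ut_def by (rule trajectory_has_velocity[OF traj]) (use that in auto)
    show "state u ut t \<in> phase_carrier V R \<mu>" if "t \<in> {0..}" for t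
      by (rule st(1)) (use that in auto)
    show "continuous_on {0..} (\<lambda>t. J (state u ut t))"
      using U(1) by (rule continuous_on_cong[THEN iffD1, rotated -1]) (use st in auto)
    fix t :: real assume "t \<in> {0..}"
    then have t: "0 \<le> t" by simp
    have eq: "S (t - s) (f s) = S (t - s) (- k s *\<^sub>R (if s \<le> \<tau> then J (g_tilde B \<tau> g s)
            else J (delay_op B (state u ut (s - \<tau>)))) + J (source_op G (state u ut s)))" if "s \<in> {0..t}" for s
      using that delay by (auto simp: f_def delayed_rhs_def \<phi>_def feedback_J source_field_J st)
    show "set_integrable lborel {0..t} (\<lambda>s. S (t - s) (- k s *\<^sub>R (if s \<le> \<tau> then J (g_tilde B \<tau> g s)
            else J (delay_op B (state u ut (s - \<tau>)))) + J (source_op G (state u ut s))))"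
      using duhamel_integrable[OF fi[OF t]] by (rule set_integrable_cong[THEN iffD1, rotated -1]) (use eq in auto)
    show "J (state u ut t) = S t (J (initial_state u0 u1)) + (LBINT s:{0..t}. S (t - s)
          (- k s *\<^sub>R (if s \<le> \<tau> then J (g_tilde B \<tau> g s)
            else J (delay_op B (state u ut (s - \<tau>)))) + J (source_op G (state u ut s))))"
      unfolding st(2)[OF t] Uf[OF t] duhamel_def
      by (rule arg_cong[where f = "\<lambda>y. _ + y"], rule set_lebesgue_integral_cong) (use eq in auto)
  qed (simp add: u_def)
  moreover have "\<forall>t\<ge>0. norm (J (state u ut t)) \<le> r * exp (- (\<omega> - \<omega>' - M * e) * t)"
    using Ub st(2) by metis
  ultimately show ?thesis by blast
qed

text \<open>
  For \<open>t \<ge> \<tau>\<close> the whole window lies in the time of the solution, and the window bound of \<open>|k|\<close> leaves the decay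
  of \<open>(norm (ut s))\<^sup>2\<close>. For \<open>t \<le> \<tau>\<close> the window meets the initial data \<open>g\<close>; there any constant will do, because
  \<open>t\<close> stays bounded.
\<close>

lemma delay_energy_decay:
  assumes data: "admissible_data V R \<mu> J B \<tau> k u0 u1 g" and \<beta>: "0 \<le> \<beta>"
    and ut: "\<And>t. 0 \<le> t \<Longrightarrow> norm (ut t) \<le> r * exp (- \<beta> * t)"
  shows "\<exists>C. \<forall>t\<ge>0. (LBINT s:{t - \<tau>..t}.
      \<bar>k (s + \<tau>)\<bar> * (norm (if s < 0 then g s else adjoint B (ut s)))\<^sup>2) \<le> C * exp (- (2 * \<beta>) * t)"
proof -
  obtain K where K: "\<And>t. 0 < t \<Longrightarrow> (LBINT s:{max 0 (t - \<tau>)..t}. \<bar>k s\<bar>) \<le> K"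
    using coefficient unfolding delay_coefficient_def by (meson less_imp_le)
  define c where "c = (onorm B * r)\<^sup>2"
  define q where "q s = \<bar>k (s + \<tau>)\<bar> * (norm (if s < 0 then g s else adjoint B (ut s)))\<^sup>2" for s
  have q: "q s \<le> \<bar>k (s + \<tau>)\<bar> * (c * exp (- (2 * \<beta>) * s))" if "0 \<le> s" for s
  proof -
    have "norm (adjoint B (ut s)) \<le> onorm B * (r * exp (- \<beta> * s))"
      by (rule order_trans[OF norm_adjoint_le[OF B] mult_left_mono[OF ut[OF that] onorm_pos_le[OF B]]])
    then have "(norm (adjoint B (ut s)))\<^sup>2 \<le> (onorm B * (r * exp (- \<beta> * s)))\<^sup>2"
      by (rule power_mono) simp
    also have "\<dots> = c * exp (- (2 * \<beta>) * s)"
      by (simp add: c_def power_mult_distrib exp_double[symmetric] mult.assoc)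
    finally show ?thesis unfolding q_def using that by (intro mult_left_mono) auto
  qed
  have ki: "set_integrable lborel {a..b} (\<lambda>s. \<bar>k (s + \<tau>)\<bar>)" if "- \<tau> \<le> a" for a b
  proof (cases "a \<le> b")
    case True
    show ?thesis
      by (rule set_integrable_shift, rule set_integrable_abs, rule set_integrable_subset[OF k_integrable[of "b + \<tau>"]])
        (use that True in auto)
  qed (simp add: set_integrable_def)
  define C0 where "C0 = (LBINT s. indicator {- \<tau>..0} s *\<^sub>R (\<bar>k (s + \<tau>)\<bar> * (norm (g s))\<^sup>2)
      + indicator {0..\<tau>} s *\<^sub>R (\<bar>k (s + \<tau>)\<bar> * c))"
  have early: "(LBINT s:{t - \<tau>..t}. q s) \<le> C0" if t: "0 \<le> t" "t \<le> \<tau>" for t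
    unfolding C0_def set_lebesgue_integral_def
  proof (rule integral_mono')
    have "integrable lborel (\<lambda>s. indicator {- \<tau>..0} s *\<^sub>R (\<bar>k (s + \<tau>)\<bar> * (norm (g s))\<^sup>2))"
      using data by (simp add: admissible_data_def set_integrable_def)
    moreover have "integrable lborel (\<lambda>s. indicator {0..\<tau>} s *\<^sub>R (\<bar>k (s + \<tau>)\<bar> * c))"
      using set_integrable_mult_left[OF ki[of 0 \<tau>], of c] delay unfolding set_integrable_def by simp
    ultimately show "integrable lborel (\<lambda>s. indicator {- \<tau>..0} s *\<^sub>R (\<bar>k (s + \<tau>)\<bar> * (norm (g s))\<^sup>2)
      + indicator {0..\<tau>} s *\<^sub>R (\<bar>k (s + \<tau>)\<bar> * c))" by (rule Bochner_Integration.integrable_add)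
    fix s
    have c0: "0 \<le> c" by (simp add: c_def)
    have "q s \<le> \<bar>k (s + \<tau>)\<bar> * c" if "0 \<le> s"
    proof -
      have "c * exp (- (2 * \<beta>) * s) \<le> c * 1" using c0 \<beta> that by (intro mult_left_mono) auto
      then show ?thesis using q[OF that] mult_left_mono[of "c * exp (- (2 * \<beta>) * s)" c "\<bar>k (s + \<tau>)\<bar>"] by simp
    qed
    moreover have "q s = \<bar>k (s + \<tau>)\<bar> * (norm (g s))\<^sup>2" if "s < 0" using that by (simp add: q_def)
    ultimately show "indicat_real {t - \<tau>..t} s *\<^sub>R q s \<le> indicator {- \<tau>..0} s *\<^sub>R (\<bar>k (s + \<tau>)\<bar> * (norm (g s))\<^sup>2)
      + indicator {0..\<tau>} s *\<^sub>R (\<bar>k (s + \<tau>)\<bar> * c)"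
      using t c0 by (cases "s < 0") (auto simp: indicator_def intro: add_increasing)
    show "0 \<le> indicat_real {- \<tau>..0} s *\<^sub>R (\<bar>k (s + \<tau>)\<bar> * (norm (g s))\<^sup>2)
      + indicat_real {0..\<tau>} s *\<^sub>R (\<bar>k (s + \<tau>)\<bar> * c)" using c0 by simp
  qed
  have late: "(LBINT s:{t - \<tau>..t}. q s) \<le> c * exp (2 * \<beta> * \<tau>) * K * exp (- (2 * \<beta>) * t)" if t: "\<tau> \<le> t" for t
  proof -
    define d where "d = c * exp (- (2 * \<beta>) * (t - \<tau>))"
    have d0: "0 \<le> d" by (simp add: d_def c_def)
    have "(LBINT s:{t - \<tau>..t}. q s) \<le> (LBINT s:{t - \<tau>..t}. \<bar>k (s + \<tau>)\<bar> * d)"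
      unfolding set_lebesgue_integral_def
    proof (rule integral_mono')
      show "integrable lborel (\<lambda>s. indicat_real {t - \<tau>..t} s *\<^sub>R (\<bar>k (s + \<tau>)\<bar> * d))"
        using set_integrable_mult_left[OF ki[of "t - \<tau>" t], of d] t delay unfolding set_integrable_def by simp
      fix s
      have "q s \<le> \<bar>k (s + \<tau>)\<bar> * d" if s: "s \<in> {t - \<tau>..t}"
      proof -
        have "exp (- (2 * \<beta>) * s) \<le> exp (- (2 * \<beta>) * (t - \<tau>))" using s \<beta> by (simp add: mult_left_mono)
        then have "c * exp (- (2 * \<beta>) * s) \<le> d" unfolding d_def by (intro mult_left_mono) (auto simp: c_def)
        then show ?thesis
          using order_trans[OF q mult_left_mono[of _ d]] s t by auto
      qed
      then show "indicat_real {t - \<tau>..t} s *\<^sub>R q s \<le> indicat_real {t - \<tau>..t} s *\<^sub>R (\<bar>k (s + \<tau>)\<bar> * d)"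
        by (simp add: indicator_def)
    qed (use d0 in auto)
    also have "\<dots> = (LBINT s:{t - \<tau>..t}. \<bar>k (s + \<tau>)\<bar>) * d" by simp
    also have "(LBINT s:{t - \<tau>..t}. \<bar>k (s + \<tau>)\<bar>) = (LBINT s:{t..t + \<tau>}. \<bar>k s\<bar>)"
      using set_integral_shift[of "t - \<tau>" \<tau> t "\<lambda>s. \<bar>k s\<bar>"] by simp
    also have "\<dots> * d \<le> K * d"
      using K[of "t + \<tau>"] t delay d0 by (intro mult_right_mono) (auto simp: max_def)
    also have "K * d = c * exp (2 * \<beta> * \<tau>) * K * exp (- (2 * \<beta>) * t)"
      by (simp add: d_def mult_exp_exp algebra_simps)
    finally show ?thesis .
  qed
  have "0 \<le> (LBINT s:{0 - \<tau>..0}. q s)" by (rule set_integral_nonneg) (simp add: q_def)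
  then have C0: "0 \<le> C0" using early[of 0] delay by linarith
  have K0: "0 \<le> K" using order_trans[OF set_integral_nonneg K[of 1]] by auto
  define C where "C = C0 * exp (2 * \<beta> * \<tau>) + c * exp (2 * \<beta> * \<tau>) * K"
  have "(LBINT s:{t - \<tau>..t}. q s) \<le> C * exp (- (2 * \<beta>) * t)" if t: "0 \<le> t" for t
  proof (cases "t \<le> \<tau>")
    case True
    have "1 \<le> exp (2 * \<beta> * \<tau>) * exp (- (2 * \<beta>) * t)"
      using True \<beta> by (simp add: mult_exp_exp mult_left_mono)
    then have "C0 * 1 \<le> C0 * (exp (2 * \<beta> * \<tau>) * exp (- (2 * \<beta>) * t))" using C0 by (intro mult_left_mono)
    also have "\<dots> \<le> C * exp (- (2 * \<beta>) * t)"
      using K0 by (simp add: C_def distrib_right c_def)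
    finally show ?thesis using early[OF t True] by simp
  next
    case False
    have "c * exp (2 * \<beta> * \<tau>) * K * exp (- (2 * \<beta>) * t) \<le> C * exp (- (2 * \<beta>) * t)"
      using C0 by (simp add: C_def)
    then show ?thesis using late[of t] False by linarith
  qed
  then show ?thesis unfolding q_def by blast
qed

text \<open>
  The quadratic part of the energy is half the squared norm of the state, and the potential is at most a
  multiple of it.
\<close>

lemma energy_decay:
  assumes data: "admissible_data V R \<mu> J B \<tau> k u0 u1 g"
    and sol: "mild_solution V R \<mu> J S B \<tau> k G u0 u1 g {0..} u ut"
    and r: "0 < r" and \<beta>: "0 \<le> \<beta>"
    and decay: "\<And>t. 0 \<le> t \<Longrightarrow> norm (J (state u ut t)) \<le> r * exp (- \<beta> * t)"
    and K: "0 \<le> K" "\<And>x. norm x \<le> r \<Longrightarrow> \<bar>\<psi> (position x)\<bar> \<le> K * (norm x)\<^sup>2"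
  shows "\<exists>C. \<forall>t\<ge>0. energy R \<mu> B \<tau> k \<psi> g u ut t \<le> C * exp (- (2 * \<beta>) * t)"
proof -
  define U where "U t = J (state u ut t)" for t
  have car: "u t \<in> V" "(\<lambda>s. u t - u (t - s)) \<in> L2mu V R \<mu>" if "0 \<le> t" for t
    using sol that by (auto simp: mild_solution_def state_def phase_carrier_def)
  have pos: "position (U t) = u t" "velocity (U t) = ut t" if "0 \<le> t" for t
    unfolding U_def state_def using position_J[OF car[OF that]] velocity_J[OF car[OF that]] by auto
  have Un: "(norm (U t))\<^sup>2 = (1 - mu_tilde \<mu>) * (norm (R (u t)))\<^sup>2 + (norm (ut t))\<^sup>2
     + (LBINT s:{0<..}. \<mu> s * (norm (R (u t - u (t - s))))\<^sup>2)" if "0 \<le> t" for t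
    unfolding U_def state_def using J_norm[OF car[OF that]] by simp
  have Ud: "norm (U t) \<le> r * exp (- \<beta> * t)" if "0 \<le> t" for t using decay[OF that] by (simp add: U_def)
  have Ur: "norm (U t) \<le> r" if "0 \<le> t" for t
  proof -
    have "r * exp (- \<beta> * t) \<le> r * 1" using \<beta> that r by (intro mult_left_mono) auto
    then show ?thesis using Ud[OF that] by simp
  qed
  have "norm (ut t) \<le> r * exp (- \<beta> * t)" if "0 \<le> t" for t
    using velocity_bound[of "U t"] pos[OF that] Ud[OF that] by simp
  then obtain C where C: "\<And>t. 0 \<le> t \<Longrightarrow> (LBINT s:{t - \<tau>..t}.
      \<bar>k (s + \<tau>)\<bar> * (norm (if s < 0 then g s else adjoint B (ut s)))\<^sup>2) \<le> C * exp (- (2 * \<beta>) * t)"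
    using delay_energy_decay[OF data \<beta>] by blast
  have "energy R \<mu> B \<tau> k \<psi> g u ut t \<le> ((1/2 + K) * r\<^sup>2 + 1/2 * C) * exp (- (2 * \<beta>) * t)" if t: "0 \<le> t" for t
  proof -
    have "energy R \<mu> B \<tau> k \<psi> g u ut t = 1/2 * (norm (U t))\<^sup>2 - \<psi> (u t) + 1/2 * (LBINT s:{t - \<tau>..t}.
      \<bar>k (s + \<tau>)\<bar> * (norm (if s < 0 then g s else adjoint B (ut s)))\<^sup>2)"
      unfolding energy_def Un[OF t] by (simp add: field_simps)
    also have "\<dots> \<le> (1/2 + K) * (norm (U t))\<^sup>2 + 1/2 * (C * exp (- (2 * \<beta>) * t))"
      using K(2)[OF Ur[OF t]] pos[OF t] C[OF t] by (simp add: distrib_right)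
    also have "(1/2 + K) * (norm (U t))\<^sup>2 \<le> (1/2 + K) * (r\<^sup>2 * exp (- (2 * \<beta>) * t))"
    proof (intro mult_left_mono)
      have "(norm (U t))\<^sup>2 \<le> (r * exp (- \<beta> * t))\<^sup>2" by (rule power_mono[OF Ud[OF t]]) simp
      also have "\<dots> = r\<^sup>2 * exp (- (2 * \<beta>) * t)"
        by (simp add: power_mult_distrib exp_double[symmetric] mult.assoc)
      finally show "(norm (U t))\<^sup>2 \<le> r\<^sup>2 * exp (- (2 * \<beta>) * t)" .
    qed (use K in auto)
    finally show ?thesis by (simp add: algebra_simps)
  qed
  then show ?thesis by blast
qed

text \<open>
  Integrating \<open>2 s y \<le> s\<^sup>2 + y\<^sup>2\<close> against \<open>|k|\<close> gives a bound that is linear in \<open>s\<close>.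
\<close>

lemma initial_delay_bound:
  assumes data: "admissible_data V R \<mu> J B \<tau> k u0 u1 g" and s: "0 < s"
    and K: "(LBINT s:{0..\<tau>}. \<bar>k s\<bar>) \<le> K"
    and small: "(LBINT s:{0..\<tau>}. \<bar>k s\<bar> * (norm (B (g (s - \<tau>))))\<^sup>2) \<le> s\<^sup>2"
  shows "(LBINT s:{0..\<tau>}. \<bar>k s\<bar> * norm (B (g (s - \<tau>)))) \<le> s * (K + 1) / 2"
proof -
  have "continuous_on {0..\<tau>} (\<lambda>s. velocity (J (g_tilde B \<tau> g s)))"
    using data by (intro bounded_linear.continuous_on[OF bounded_linear_velocity]) (simp add: admissible_data_def)
  then have c: "continuous_on {0..\<tau>} (\<lambda>s. B (g (s - \<tau>)))"
    using velocity_J[OF subspace_0[OF subspace_V] L2mu_const[OF subspace_0[OF subspace_V]]] by (simp add: g_tilde_def)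
  have ak: "set_integrable lborel {0..\<tau>} (\<lambda>s. \<bar>k s\<bar>)" using delay by (intro set_integrable_abs k_integrable) simp
  have i1: "set_integrable lborel {0..\<tau>} (\<lambda>s. \<bar>k s\<bar> * norm (B (g (s - \<tau>))))"
    using set_integrable_scaleR_continuous[OF ak continuous_on_norm[OF c]] by simp
  have i2: "set_integrable lborel {0..\<tau>} (\<lambda>s. \<bar>k s\<bar> * (norm (B (g (s - \<tau>))))\<^sup>2)"
    using set_integrable_scaleR_continuous[OF ak continuous_on_power[OF continuous_on_norm[OF c]], of 2] by simp
  have "(LBINT r:{0..\<tau>}. \<bar>k r\<bar> * norm (B (g (r - \<tau>))))
      \<le> (LBINT r:{0..\<tau>}. s / 2 * \<bar>k r\<bar> + 1 / (2 * s) * (\<bar>k r\<bar> * (norm (B (g (r - \<tau>))))\<^sup>2))"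
  proof (rule set_integral_mono[OF i1])
    show "set_integrable lborel {0..\<tau>} (\<lambda>r. s / 2 * \<bar>k r\<bar> + 1 / (2 * s) * (\<bar>k r\<bar> * (norm (B (g (r - \<tau>))))\<^sup>2))"
      by (intro set_integral_add(1) set_integrable_mult_right ak i2)
    fix r
    define y where "y = norm (B (g (r - \<tau>)))"
    have "2 * s * y \<le> s\<^sup>2 + y\<^sup>2" by (rule sum_squares_bound)
    then have "y \<le> s / 2 + 1 / (2 * s) * y\<^sup>2" using s by (simp add: field_simps power2_eq_square)
    then have "\<bar>k r\<bar> * y \<le> \<bar>k r\<bar> * (s / 2 + 1 / (2 * s) * y\<^sup>2)" by (intro mult_left_mono) auto
    then show "\<bar>k r\<bar> * norm (B (g (r - \<tau>))) \<le> s / 2 * \<bar>k r\<bar> + 1 / (2 * s) * (\<bar>k r\<bar> * (norm (B (g (r - \<tau>))))\<^sup>2)"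
      by (simp add: y_def algebra_simps)
  qed
  also have "\<dots> = s / 2 * (LBINT r:{0..\<tau>}. \<bar>k r\<bar>) + 1 / (2 * s) * (LBINT r:{0..\<tau>}. \<bar>k r\<bar> * (norm (B (g (r - \<tau>))))\<^sup>2)"
    using set_integral_add(2)[OF set_integrable_mult_right[OF ak, of "s / 2"] set_integrable_mult_right[OF i2,
        of "1 / (2 * s)"]]
    by (simp only: set_integral_mult_right)
  also have "\<dots> \<le> s / 2 * K + 1 / (2 * s) * s\<^sup>2"
    using s K small by (intro add_mono mult_left_mono) auto
  also have "\<dots> = s * (K + 1) / 2" using s by (simp add: field_simps power2_eq_square)
  finally show ?thesis .
qed

theorem small_data_stability:
  assumes "0 \<le> \<omega>'" and "\<omega>' < \<omega>"
    and growth: "\<And>t. 0 \<le> t \<Longrightarrow> (onorm B)\<^sup>2 * M * exp (\<omega> * \<tau>) * (LBINT s:{0..t}. \<bar>k (s + \<tau>)\<bar>) \<le> \<gamma> + \<omega>' * t"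
  shows "\<exists>\<delta>>0. \<exists>\<beta>>0. \<forall>u0 u1 g.
           admissible_data V R \<mu> J B \<tau> k u0 u1 g \<longrightarrow>
           (1 - mu_tilde \<mu>) * (norm (R (u0 0)))\<^sup>2 + (norm u1)\<^sup>2
             + (LBINT s:{0<..}. \<mu> s * (norm (R (u0 0 - u0 (- s))))\<^sup>2)
             + (LBINT s:{0..\<tau>}. \<bar>k s\<bar> * (norm (B (g (s - \<tau>))))\<^sup>2) < \<delta> \<longrightarrow>
           (\<exists>u ut. mild_solution V R \<mu> J S B \<tau> k G u0 u1 g {0..} u ut \<and>
              (\<forall>T>0. \<forall>v vt. mild_solution V R \<mu> J S B \<tau> k G u0 u1 g {0..T} v vt \<longrightarrow>
                 (\<forall>t\<in>{0..T}. v t = u t)) \<and>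
              (\<exists>C. \<forall>t\<ge>0. energy R \<mu> B \<tau> k \<psi> g u ut t \<le> C * exp (- \<beta> * t)))"
proof -
  \<comment> \<open>The source may consume half of the gap \<open>\<omega> - \<omega>'\<close>.\<close>
  define e where "e = (\<omega> - \<omega>') / (2 * M)"
  define \<beta> where "\<beta> = (\<omega> - \<omega>') / 2"
  have e: "0 < e" and \<beta>: "0 < \<beta>" using assms M by (auto simp: e_def \<beta>_def)
  have rate: "\<omega> - \<omega>' - M * e = \<beta>" using M by (simp add: e_def \<beta>_def field_simps)
  obtain r K\<psi> where r: "0 < r" "\<And>x. norm x \<le> r \<Longrightarrow> norm (source_field x) \<le> e * norm x"
    and K\<psi>: "0 \<le> K\<psi>" "\<And>x. norm x \<le> r \<Longrightarrow> \<bar>\<psi> (position x)\<bar> \<le> K\<psi> * (norm x)\<^sup>2"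
    using source_small[OF e] by blast
  define K where "K = (LBINT s:{0..\<tau>}. \<bar>k s\<bar>)"
  have K0: "0 \<le> K" unfolding K_def by (rule set_integral_nonneg) simp
  define a where "a = M * (1 + exp (\<omega> * \<tau>) * ((K + 1) / 2)) * exp \<gamma>"
  have a: "0 < a" using M K0 by (simp add: a_def add_pos_nonneg)
  \<comment> \<open>Data of norm at most \<open>s\<close> give the bound \<open>s * a = r\<close> in \<open>small_solution_exists\<close>.\<close>
  define s where "s = r / a"
  have s: "0 < s" using r a by (simp add: s_def)
  have main: "\<exists>u ut. mild_solution V R \<mu> J S B \<tau> k G u0 u1 g {0..} u ut \<and>
              (\<forall>T>0. \<forall>v vt. mild_solution V R \<mu> J S B \<tau> k G u0 u1 g {0..T} v vt \<longrightarrow>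
                 (\<forall>t\<in>{0..T}. v t = u t)) \<and>
              (\<exists>C. \<forall>t\<ge>0. energy R \<mu> B \<tau> k \<psi> g u ut t \<le> C * exp (- (2 * \<beta>) * t))"
    if data: "admissible_data V R \<mu> J B \<tau> k u0 u1 g"
      and small: "(1 - mu_tilde \<mu>) * (norm (R (u0 0)))\<^sup>2 + (norm u1)\<^sup>2
             + (LBINT s:{0<..}. \<mu> s * (norm (R (u0 0 - u0 (- s))))\<^sup>2)
             + (LBINT s:{0..\<tau>}. \<bar>k s\<bar> * (norm (B (g (s - \<tau>))))\<^sup>2) < s\<^sup>2" for u0 u1 g
  proof -
    define x where "x = J (initial_state u0 u1)"
    define D0 where "D0 = (LBINT s:{0..\<tau>}. \<bar>k s\<bar> * norm (B (g (s - \<tau>))))"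
    have ini: "u0 0 \<in> V" "(\<lambda>s. u0 0 - u0 (- s)) \<in> L2mu V R \<mu>"
      using data by (auto simp: admissible_data_def initial_state_def phase_carrier_def)
    have xn: "(norm x)\<^sup>2 = (1 - mu_tilde \<mu>) * (norm (R (u0 0)))\<^sup>2 + (norm u1)\<^sup>2
             + (LBINT s:{0<..}. \<mu> s * (norm (R (u0 0 - u0 (- s))))\<^sup>2)"
      unfolding x_def initial_state_def using J_norm[OF ini] by simp
    have "0 \<le> (LBINT s:{0..\<tau>}. \<bar>k s\<bar> * (norm (B (g (s - \<tau>))))\<^sup>2)"
      by (rule set_integral_nonneg) simp
    then have "(norm x)\<^sup>2 \<le> s\<^sup>2" "(LBINT s:{0..\<tau>}. \<bar>k s\<bar> * (norm (B (g (s - \<tau>))))\<^sup>2) \<le> s\<^sup>2"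
      using small xn zero_le_power2[of "norm x"] by linarith+
    then have xs: "norm x \<le> s" and D0: "D0 \<le> s * ((K + 1) / 2)"
      using power2_le_imp_le[of "norm x" s] s initial_delay_bound[OF data s, of K] by (auto simp: K_def D0_def)
    have "M * (norm x + exp (\<omega> * \<tau>) * D0) * exp \<gamma> \<le> M * (s + exp (\<omega> * \<tau>) * (s * ((K + 1) / 2))) * exp \<gamma>"
      using M xs D0 by (intro mult_right_mono mult_left_mono add_mono) auto
    also have "\<dots> = s * a" by (simp add: a_def algebra_simps)
    also have "\<dots> = r" using a by (simp add: s_def)
    finally have sm: "M * (norm x + exp (\<omega> * \<tau>) * D0) * exp \<gamma> \<le> r" .
    obtain u ut where sol: "mild_solution V R \<mu> J S B \<tau> k G u0 u1 g {0..} u ut"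
      and dec: "\<And>t. 0 \<le> t \<Longrightarrow> norm (J (state u ut t)) \<le> r * exp (- \<beta> * t)"
      using small_solution_exists[OF data growth r(1) less_imp_le[OF e] r(2) _ sm[unfolded x_def D0_def]] \<beta>
      unfolding rate by auto
    have "\<exists>C. \<forall>t\<ge>0. energy R \<mu> B \<tau> k \<psi> g u ut t \<le> C * exp (- (2 * \<beta>) * t)"
      by (rule energy_decay[OF data sol r(1) less_imp_le[OF \<beta>] dec K\<psi>])
    then show ?thesis using sol mild_solution_unique[OF data sol] by blast
  qed
  show ?thesis
    by (rule exI[of _ "s\<^sup>2"], rule conjI, use s in simp, rule exI[of _ "2 * \<beta>"], rule conjI, use \<beta> in simp)
      (use main in blast)
qed

end

theorem theorem3p6:
  fixes A R B G :: "'h::{real_inner, banach, second_countable_topology} \<Rightarrow> 'h"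
    and D V :: "'h set"
    and \<tau> b M \<omega> \<omega>' \<gamma> :: real
    and k \<mu> :: "real \<Rightarrow> real"
    and \<psi> :: "'h \<Rightarrow> real"
    and D\<psi> :: "'h \<Rightarrow> 'h \<Rightarrow> real"
    and J :: "'h \<times> 'h \<times> (real \<Rightarrow> 'h) \<Rightarrow> 'x::{real_inner, banach, second_countable_topology}"
    and S :: "real \<Rightarrow> 'x \<Rightarrow> 'x"
  assumes "positive_self_adjoint D A" and "compact_inverse D A"
    and "square_root_operator D A V R"
    and "\<tau> > 0" and "bounded_linear B" and "b = onorm B"
    and "delay_coefficient \<tau> k"
    and "memory_kernel \<mu>"
    and "admissible_source V R \<psi> D\<psi> G"
    and "phase_space V R \<mu> J"
    and "C0_semigroup S" and "generator_graph S = evolution_graph D A V R \<mu> J"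
    and "M > 0" and "\<omega> > 0" and "\<forall>t\<ge>0. onorm (S t) \<le> M * exp (- \<omega> * t)"
    and "0 \<le> \<omega>'" and "\<omega>' < \<omega>"
    and "\<forall>t\<ge>0. b\<^sup>2 * M * exp (\<omega> * \<tau>) * (LINT s:{0..t}|lborel. \<bar>k (s + \<tau>)\<bar>) \<le> \<gamma> + \<omega>' * t"
  shows "\<exists>\<delta>>0. \<exists>\<beta>>0. \<forall>u0 u1 g.
           admissible_data V R \<mu> J B \<tau> k u0 u1 g \<longrightarrow>
           (1 - mu_tilde \<mu>) * (norm (R (u0 0)))\<^sup>2 + (norm u1)\<^sup>2
             + (LINT s:{0<..}|lborel. \<mu> s * (norm (R (u0 0 - u0 (- s))))\<^sup>2)
             + (LINT s:{0..\<tau>}|lborel. \<bar>k s\<bar> * (norm (B (g (s - \<tau>))))\<^sup>2) < \<delta> \<longrightarrow>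
           (\<exists>u ut. mild_solution V R \<mu> J S B \<tau> k G u0 u1 g {0..} u ut \<and>
              (\<forall>T>0. \<forall>v vt. mild_solution V R \<mu> J S B \<tau> k G u0 u1 g {0..T} v vt \<longrightarrow>
                 (\<forall>t\<in>{0..T}. v t = u t)) \<and>
              (\<exists>C. \<forall>t\<ge>0. energy R \<mu> B \<tau> k \<psi> g u ut t \<le> C * exp (- \<beta> * t)))"
proof -
  interpret delayed_memory_system D V A R \<mu> J S M \<omega> B G \<tau> k \<psi> D\<psi>
  proof (intro delayed_memory_system.intro memory_evolution.intro memory_phase_space.intro decaying_semigroup.intro
      memory_evolution_axioms.intro delayed_memory_system_axioms.intro)
    fix t :: real and x assume t: "0 \<le> t"
    have "bounded_linear (S t)" using \<open>C0_semigroup S\<close> t by (simp add: C0_semigroup_def)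
    then have "norm (S t x) \<le> onorm (S t) * norm x" by (rule onorm)
    also have "\<dots> \<le> M * exp (- \<omega> * t) * norm x" using assms(15) t by (intro mult_right_mono) auto
    finally show "norm (S t x) \<le> M * exp (- \<omega> * t) * norm x" .
  qed (use assms in auto)
  show ?thesis
    by (rule small_data_stability[OF \<open>0 \<le> \<omega>'\<close> \<open>\<omega>' < \<omega>\<close>]) (use assms in auto)
qed

end
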